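(* There exist positive functions $\delta_1(\varepsilon),\delta_2(\varepsilon)$ of $\varepsilon$ with $\delta_i(\varepsilon)\to 0$ as $\varepsilon\to 0$, $i=1,2$, such that for all sufficiently small $\varepsilon>0$ $$\sigma(\mathcal{H}_\varepsilon)\subset S_{\delta_2(\varepsilon)}\big(\mu_0^+-\delta_1(\varepsilon)\big).$$
   Context: Let $p,q:\mathbb{R}\to\mathbb{R}$ be $1$-periodic, $p$ piecewise continuously differentiable (continuous with piecewise continuous derivative), $q$ piecewise continuous, $p(x)\geq p_0>0$ for all $x$, and $p(0)=1$. Let $\mathcal{H}_0:=-\frac{d}{dx}p\frac{d}{dx}+q$ be the self-adjoint operator in $L_2(\mathbb{R})$ with domain $W_2^2(\mathbb{R})$. Let $Q\subset\mathbb{R}$ be a fixed bounded open interval. For each small $\varepsilon>0$ let $\mathcal{L}_\varepsilon:W_2^2(Q)\to L_2(Q)$ be a linear operator, bounded uniformly in $\varepsilon$ (operator norms bounded by a constant independent of $\varepsilon$). Denote also by $\mathcal{L}_\varepsilon$ the operator $W_{2,loc}^2(\mathbb{R})\to L_2(\mathbb{R})$ that restricts a function to $Q$, applies $\mathcal{L}_\varepsilon$, and extends the result by zero outside $Q$. Set $\mathcal{H}_\varepsilon:=\mathcal{H}_0-\varepsilon\mathcal{L}_\varepsilon$, an operator in $L_2(\mathbb{R})$ with domain $W_2^2(\mathbb{R})$. $\sigma(\cdot)$ is the spectrum. $\mu_0^+$ is the lowest eigenvalue of $-\frac{d}{dx}p\frac{d}{dx}+q$ on $(0,1)$ with periodic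 boundary conditions $\phi(0)=\phi(1)$, $\phi'(0)=\phi'(1)$; it is the bottom of $\sigma(\mathcal{H}_0)$. For $a\in\mathbb{C}$, $\delta>0$, $S_\delta(a):=\{\lambda\in\mathbb{C}:|\arg(\lambda-a)|<\delta\}$. *)

theory Defs
  imports "HOL-Analysis.Analysis"
begin

section \<open>Piecewise continuous and piecewise smooth coefficients\<close>

(* Finitely many exceptional points in every bounded interval, and finite one-sided limits
   everywhere.  The library's piecewise_C1_differentiable_on is not used for the class below,
   because it does not require the derivative to have one-sided limits. *)
definition piecewise_continuous :: "(real \<Rightarrow> real) \<Rightarrow> bool" where
  "piecewise_continuous f \<longleftrightarrow>
     (\<exists>S. (\<forall>a b. finite (S \<inter> {a..b})) \<and> (\<forall>x. x \<notin> S \<longrightarrow> isCont f x)) \<and>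
     (\<forall>x. (\<exists>l. (f \<longlongrightarrow> l) (at_left x)) \<and> (\<exists>r. (f \<longlongrightarrow> r) (at_right x)))"

definition piecewise_C1 :: "(real \<Rightarrow> real) \<Rightarrow> bool" where
  "piecewise_C1 f \<longleftrightarrow> continuous_on UNIV f \<and>
     (\<exists>f' S. piecewise_continuous f' \<and> (\<forall>a b. finite (S \<inter> {a..b})) \<and>
             (\<forall>x. x \<notin> S \<longrightarrow> (f has_real_derivative f' x) (at x)))"

definition one_periodic :: "(real \<Rightarrow> real) \<Rightarrow> bool" where
  "one_periodic f \<longleftrightarrow> (\<forall>x. f (x + 1) = f x)"


section \<open>Lebesgue and Sobolev spaces on an open set\<close>

(* Elements of function spaces on an open set X are represented by functions on the whole line,
   whose values outside X are irrelevant; two functions represent the same element iff they agree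
   almost everywhere on X.  No quotient is formed: all operators and conditions below are
   formulated up to this relation. *)
definition ae_eq :: "real set \<Rightarrow> (real \<Rightarrow> complex) \<Rightarrow> (real \<Rightarrow> complex) \<Rightarrow> bool" where
  "ae_eq X f g \<longleftrightarrow> (AE x in lebesgue_on X. f x = g x)"

definition L2_space :: "real set \<Rightarrow> (real \<Rightarrow> complex) set" where
  "L2_space X = {f. f \<in> borel_measurable (lebesgue_on X) \<and>
                    integrable (lebesgue_on X) (\<lambda>x. (cmod (f x))\<^sup>2)}"

definition L2_norm :: "real set \<Rightarrow> (real \<Rightarrow> complex) \<Rightarrow> real" where
  "L2_norm X f = sqrt (integral\<^sup>L (lebesgue_on X) (\<lambda>x. (cmod (f x))\<^sup>2))"

definition test_functions :: "real set \<Rightarrow> (real \<Rightarrow> real) set" where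
  "test_functions X = {\<phi>. (\<forall>k x. (deriv ^^ k) \<phi> differentiable (at x)) \<and>
                          (\<exists>K. compact K \<and> K \<subseteq> X \<and> (\<forall>x. x \<notin> K \<longrightarrow> \<phi> x = 0))}"

definition locally_integrable :: "real set \<Rightarrow> (real \<Rightarrow> complex) \<Rightarrow> bool" where
  "locally_integrable X f \<longleftrightarrow> (\<forall>K. compact K \<and> K \<subseteq> X \<longrightarrow> f absolutely_integrable_on K)"

definition has_weak_deriv :: "real set \<Rightarrow> (real \<Rightarrow> complex) \<Rightarrow> (real \<Rightarrow> complex) \<Rightarrow> bool" where
  "has_weak_deriv X u g \<longleftrightarrow> locally_integrable X u \<and> locally_integrable X g \<and>
     (\<forall>\<phi>\<in>test_functions X.
        integral\<^sup>L (lebesgue_on X) (\<lambda>x. deriv \<phi> x *\<^sub>R u x) =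
        - integral\<^sup>L (lebesgue_on X) (\<lambda>x. \<phi> x *\<^sub>R g x))"

(* The weak derivative is unique only up to ae_eq X; some representative is chosen. *)
definition weak_deriv :: "real set \<Rightarrow> (real \<Rightarrow> complex) \<Rightarrow> (real \<Rightarrow> complex)" where
  "weak_deriv X u = (SOME g. has_weak_deriv X u g)"

definition W22 :: "real set \<Rightarrow> (real \<Rightarrow> complex) set" where
  "W22 X = {u \<in> L2_space X. \<exists>v\<in>L2_space X. \<exists>w\<in>L2_space X.
              has_weak_deriv X u v \<and> has_weak_deriv X v w}"

definition W22_norm :: "real set \<Rightarrow> (real \<Rightarrow> complex) \<Rightarrow> real" where
  "W22_norm X u = sqrt ((L2_norm X u)\<^sup>2 + (L2_norm X (weak_deriv X u))\<^sup>2
                        + (L2_norm X (weak_deriv X (weak_deriv X u)))\<^sup>2)"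


section \<open>Operators\<close>

(* Complex-linear operator from the Sobolev space to the Lebesgue space on X, in the sense of
   almost-everywhere equivalence classes. *)
definition linear_W22_L2 ::
    "real set \<Rightarrow> ((real \<Rightarrow> complex) \<Rightarrow> (real \<Rightarrow> complex)) \<Rightarrow> bool" where
  "linear_W22_L2 X T \<longleftrightarrow>
     (\<forall>u\<in>W22 X. T u \<in> L2_space X) \<and>
     (\<forall>u\<in>W22 X. \<forall>v\<in>W22 X. ae_eq X u v \<longrightarrow> ae_eq X (T u) (T v)) \<and>
     (\<forall>u\<in>W22 X. \<forall>v\<in>W22 X. ae_eq X (T (\<lambda>x. u x + v x)) (\<lambda>x. T u x + T v x)) \<and>
     (\<forall>c. \<forall>u\<in>W22 X. ae_eq X (T (\<lambda>x. c * u x)) (\<lambda>x. c * T u x))"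

definition bounded_by_W22_L2 ::
    "real set \<Rightarrow> real \<Rightarrow> ((real \<Rightarrow> complex) \<Rightarrow> (real \<Rightarrow> complex)) \<Rightarrow> bool" where
  "bounded_by_W22_L2 X C T \<longleftrightarrow> (\<forall>u\<in>W22 X. L2_norm X (T u) \<le> C * W22_norm X u)"

definition sl_op ::
    "real set \<Rightarrow> (real \<Rightarrow> real) \<Rightarrow> (real \<Rightarrow> real) \<Rightarrow> (real \<Rightarrow> complex) \<Rightarrow> (real \<Rightarrow> complex)" where
  "sl_op X p q u = (\<lambda>x. - weak_deriv X (\<lambda>y. of_real (p y) * weak_deriv X u y) x
                        + of_real (q x) * u x)"

(* Since T respects equality almost everywhere on Q, T u is T applied to the restriction
   of u to Q. *)
definition zero_extended ::
    "real set \<Rightarrow> ((real \<Rightarrow> complex) \<Rightarrow> (real \<Rightarrow> complex)) \<Rightarrow> (real \<Rightarrow> complex) \<Rightarrow> (real \<Rightarrow> complex)" where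
  "zero_extended Q T u = (\<lambda>x. if x \<in> Q then T u x else 0)"

definition perturbed_op ::
    "(real \<Rightarrow> real) \<Rightarrow> (real \<Rightarrow> real) \<Rightarrow> real set \<Rightarrow> real \<Rightarrow>
     ((real \<Rightarrow> complex) \<Rightarrow> (real \<Rightarrow> complex)) \<Rightarrow> (real \<Rightarrow> complex) \<Rightarrow> (real \<Rightarrow> complex)" where
  "perturbed_op p q Q \<epsilon> T u = (\<lambda>x. sl_op UNIV p q u x - of_real \<epsilon> * zero_extended Q T u x)"


section \<open>Spectrum and eigenvalues\<close>

(* For an operator T on the square-integrable functions of the whole line with domain D: z is
   in the resolvent set iff T - z is injective, onto, and has a bounded inverse. *)
definition resolvent_set ::
    "(real \<Rightarrow> complex) set \<Rightarrow> ((real \<Rightarrow> complex) \<Rightarrow> (real \<Rightarrow> complex)) \<Rightarrow> complex set" where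
  "resolvent_set D T = {z.
     (\<forall>u\<in>D. \<forall>v\<in>D. ae_eq UNIV (\<lambda>x. T u x - z * u x) (\<lambda>x. T v x - z * v x) \<longrightarrow> ae_eq UNIV u v) \<and>
     (\<forall>f\<in>L2_space UNIV. \<exists>u\<in>D. ae_eq UNIV (\<lambda>x. T u x - z * u x) f) \<and>
     (\<exists>C. \<forall>u\<in>D. L2_norm UNIV u \<le> C * L2_norm UNIV (\<lambda>x. T u x - z * u x))}"

definition op_spectrum ::
    "(real \<Rightarrow> complex) set \<Rightarrow> ((real \<Rightarrow> complex) \<Rightarrow> (real \<Rightarrow> complex)) \<Rightarrow> complex set" where
  "op_spectrum D T = - resolvent_set D T"

(* The boundary values of \<phi> and of its derivative are those of the representative that is
   continuously differentiable on the closed unit interval. *)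
definition periodic_eigenvalue :: "(real \<Rightarrow> real) \<Rightarrow> (real \<Rightarrow> real) \<Rightarrow> real \<Rightarrow> bool" where
  "periodic_eigenvalue p q \<mu> \<longleftrightarrow>
     (\<exists>\<phi> \<phi>'. \<phi> \<in> W22 {0<..<1} \<and>
        (\<forall>x\<in>{0..1}. (\<phi> has_vector_derivative \<phi>' x) (at x within {0..1})) \<and>
        continuous_on {0..1} \<phi>' \<and>
        \<phi> 0 = \<phi> 1 \<and> \<phi>' 0 = \<phi>' 1 \<and>
        \<not> ae_eq {0<..<1} \<phi> (\<lambda>x. 0) \<and>
        ae_eq {0<..<1} (sl_op {0<..<1} p q \<phi>) (\<lambda>x. of_real \<mu> * \<phi> x))"

definition lowest_periodic_eigenvalue :: "(real \<Rightarrow> real) \<Rightarrow> (real \<Rightarrow> real) \<Rightarrow> real \<Rightarrow> bool" where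
  "lowest_periodic_eigenvalue p q \<mu>0 \<longleftrightarrow>
     periodic_eigenvalue p q \<mu>0 \<and> (\<forall>\<mu>. periodic_eigenvalue p q \<mu> \<longrightarrow> \<mu>0 \<le> \<mu>)"

(* arg 0 is undefined, so the vertex is excluded (the library sets Arg 0 = 0). *)
definition sector :: "real \<Rightarrow> complex \<Rightarrow> complex set" where
  "sector \<delta> a = {z. z \<noteq> a \<and> \<bar>Arg (z - a)\<bar> < \<delta>}"

end

theory Submission
  imports Defs
begin

text \<open>
  Every element of the Sobolev space on the line is
  represented by an absolutely continuous function with absolutely continuous derivative, and
  integration by parts turns \<open>\<H>\<^sub>0\<close> into a quadratic form. If this form is bounded below by \<open>m\<close>, then
  \<open>\<parallel>(\<H>\<^sub>0 - z) u\<parallel> \<ge> max \<bar>Im z\<bar> (m - Re z) \<parallel>u\<parallel>\<close>, and surjectivity follows from the method of continuity,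
  starting from the explicitly solvable \<open>- u'' + k\<^sup>2 u = f\<close>.

  The form is indeed bounded below by \<open>\<mu>0\<close>: the trace of the monodromy matrix is a continuous
  function of the spectral parameter that is at least 2 far to the left and takes the value 2 only at
  periodic eigenvalues, so it exceeds 2 on the left of \<open>\<mu>0\<close>. There the exponentially growing and decaying
  Floquet solutions show that \<open>\<H>\<^sub>0 - \<lambda>\<close> is bounded below, which is impossible when \<open>\<lambda>\<close> is the infimum
  of the form.

  Moreover \<open>\<L>\<^sub>\<epsilon>\<close> is bounded relative to \<open>\<H>\<^sub>0\<close>, with relative bound on \<open>\<H>\<^sub>0 - z\<close> of order \<open>\<delta>\<^sup>-\<^sup>2\<close> outside the sector of
  opening \<open>\<delta>\<close> with vertex \<open>\<mu>0 - \<delta>\<close>. With \<open>\<delta> = \<epsilon>\<^sup>1\<^sup>/\<^sup>4\<close> the perturbation is of relative size \<open>\<epsilon>\<^sup>1\<^sup>/\<^sup>2\<close>.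
\<close>

section \<open>Smooth cut-off functions\<close>

text \<open>The operators \<L> carry no symmetry, so the spectrum of the perturbed operator may
  leave the real axis and has to be located by resolvent estimates at complex z. As \<L> sees second
  derivatives, these estimates must bound the full Sobolev norm; the equation supplies that norm at
  the price of a factor of order (|z| + 1) / gap, where the gap measures how far z is from the
  half-line above \<mu>0. Along the edges of a sector |z| and the gap grow at the same rate, up to
  the factor \<delta>. Near the vertex |z| stays bounded, but an edge of slope \<delta> comes within
  order \<delta>^2 of the half-line: this is where \<delta>^-2 comes from. At \<mu>0 itself the gap
  is zero, so the vertex has to be moved to the left.

  A lower bound alone does not give a resolvent, since the range could be a proper closed subspace;
  hence every lower bound is proved with constants uniform along a path that ends at an operator
  solved by hand.

  Members of the function spaces are functions, not classes. Each computation is therefore done on a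
  representative whose derivatives are related by genuine integrals, and is transferred afterwards
  by equality almost everywhere.\<close>

definition n_smooth :: "nat \<Rightarrow> (real \<Rightarrow> real) \<Rightarrow> bool" where
  "n_smooth n f \<longleftrightarrow> (\<forall>k<n. \<forall>x. (deriv ^^ k) f differentiable (at x))"

lemma n_smooth_0 [simp]: "n_smooth 0 f"
  by (simp add: n_smooth_def)

lemma n_smooth_Suc:
  "n_smooth (Suc n) f \<longleftrightarrow> (\<forall>x. f differentiable (at x)) \<and> n_smooth n (deriv f)"
proof -
  have "(\<forall>k<Suc n. \<forall>x. (deriv ^^ k) f differentiable (at x)) \<longleftrightarrow>
      (\<forall>x. f differentiable (at x)) \<and> (\<forall>k<n. \<forall>x. (deriv ^^ Suc k) f differentiable (at x))"
    by (auto simp: less_Suc_eq_0_disj)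
  then show ?thesis
    by (simp add: n_smooth_def funpow_Suc_right del: funpow.simps)
qed

text \<open>Closure properties go by induction on the order: it suffices to exhibit a derivative
  that is smooth to one order less. \<open>test_functions\<close> demands all orders at once, which
  leaves nothing to induct on.\<close>

lemma n_smooth_SucI:
  assumes "\<And>x. (f has_real_derivative f' x) (at x)" "n_smooth n f'"
  shows "n_smooth (Suc n) f"
proof -
  have "deriv f = f'" using assms(1) by (auto intro!: DERIV_imp_deriv)
  then show ?thesis using assms by (auto simp: n_smooth_Suc real_differentiable_def)
qed

lemma n_smooth_SucE:
  assumes "n_smooth (Suc n) f"
  shows "(f has_real_derivative deriv f x) (at x)" "n_smooth n (deriv f)"
  using assms by (auto simp: n_smooth_Suc DERIV_deriv_iff_real_differentiable)

lemma n_smooth_mono: "n_smooth n f \<Longrightarrow> m \<le> n \<Longrightarrow> n_smooth m f"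
  by (auto simp: n_smooth_def)

lemma n_smooth_add: "n_smooth n f \<Longrightarrow> n_smooth n g \<Longrightarrow> n_smooth n (\<lambda>x. f x + g x)"
proof (induction n arbitrary: f g)
  case (Suc n)
  note F = n_smooth_SucE[OF Suc.prems(1)] and G = n_smooth_SucE[OF Suc.prems(2)]
  show ?case
    by (rule n_smooth_SucI[where f' = "\<lambda>x. deriv f x + deriv g x"])
       (auto intro!: derivative_eq_intros F G Suc.IH)
qed simp

lemma n_smooth_const: "n_smooth n (\<lambda>x. c)"
proof (induction n arbitrary: c)
  case (Suc n)
  show ?case by (rule n_smooth_SucI[where f' = "\<lambda>x. 0"]) (auto intro!: derivative_eq_intros Suc)
qed simp

lemma n_smooth_mult: "n_smooth n f \<Longrightarrow> n_smooth n g \<Longrightarrow> n_smooth n (\<lambda>x. f x * g x)"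
proof (induction n arbitrary: f g)
  case (Suc n)
  note F = n_smooth_SucE[OF Suc.prems(1)] and G = n_smooth_SucE[OF Suc.prems(2)]
  have "n_smooth n f" "n_smooth n g"
    using Suc.prems n_smooth_mono by force+
  then show ?case
    by (intro n_smooth_SucI[where f' = "\<lambda>x. deriv f x * g x + f x * deriv g x"])
       (auto intro!: derivative_eq_intros F G Suc.IH n_smooth_add)
qed simp

lemma n_smooth_affine: "n_smooth n f \<Longrightarrow> n_smooth n (\<lambda>x. f (a * x + b))"
proof (induction n arbitrary: f)
  case (Suc n)
  note F = n_smooth_SucE[OF Suc.prems]
  have "((\<lambda>x. f (a * x + b)) has_real_derivative a * deriv f (a * x + b)) (at x)" for x
    by (rule DERIV_cong[OF DERIV_chain2[OF F(1)]]) (auto intro!: derivative_eq_intros)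
  then show ?case
    by (rule n_smooth_SucI[where f' = "\<lambda>x. a * deriv f (a * x + b)"])
       (intro n_smooth_mult n_smooth_const Suc.IH F)
qed simp

text \<open>The functions x^(-j) exp(-1/x), cut off at 0. The exponent stays a parameter because
  differentiation raises it: the span of the family is closed under derivatives, so smoothness is
  one induction for all \<open>j\<close>.\<close>

definition bump_seed :: "nat \<Rightarrow> real \<Rightarrow> real" where
  "bump_seed j x = (if x > 0 then inverse x ^ j * exp (- inverse x) else 0)"

lemma bump_seed_tendsto: "(bump_seed j \<longlongrightarrow> 0) (at 0)"
proof (rule filterlim_split_at)
  show "(bump_seed j \<longlongrightarrow> 0) (at_left 0)"
  proof (rule tendsto_eventually)
    show "\<forall>\<^sub>F x in at_left 0. bump_seed j x = 0"
      by (auto simp: eventually_at_filter bump_seed_def)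
  qed
  have "((\<lambda>x::real. inverse x ^ j / exp (inverse x)) \<longlongrightarrow> 0) (at_right 0)"
    using filterlim_compose[OF tendsto_power_div_exp_0[of j] filterlim_inverse_at_top_right] by simp
  then show "(bump_seed j \<longlongrightarrow> 0) (at_right 0)"
  proof (rule Lim_transform_eventually)
    show "\<forall>\<^sub>F x::real in at_right 0. inverse x ^ j / exp (inverse x) = bump_seed j x"
      by (auto simp: eventually_at_filter bump_seed_def exp_minus divide_inverse)
  qed
qed

lemma bump_seed_deriv:
  "(bump_seed j has_real_derivative bump_seed (j + 2) x + (- real j) * bump_seed (Suc j) x) (at x)"
proof (cases x "0 :: real" rule: linorder_cases)
  case less
  have "((\<lambda>x. 0) has_real_derivative 0) (at x)" by simp
  then have "(bump_seed j has_real_derivative 0) (at x)"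
    by (rule has_field_derivative_transform_within_open[where S = "{..<0}"])
       (use less in \<open>auto simp: bump_seed_def\<close>)
  then show ?thesis using less by (simp add: bump_seed_def)
next
  case greater
  have "((\<lambda>x. inverse x ^ j * exp (- inverse x)) has_real_derivative
        real j * inverse x ^ (j - 1) * - (inverse x * inverse x) * exp (- inverse x)
        + inverse x ^ j * (exp (- inverse x) * (inverse x * inverse x))) (at x)"
    using greater by (auto intro!: derivative_eq_intros)
  also have "real j * inverse x ^ (j - 1) * - (inverse x * inverse x) * exp (- inverse x)
        + inverse x ^ j * (exp (- inverse x) * (inverse x * inverse x))
      = bump_seed (j + 2) x + (- real j) * bump_seed (Suc j) x"
    using greater by (cases j) (simp_all add: bump_seed_def algebra_simps)
  finally have "((\<lambda>x. inverse x ^ j * exp (- inverse x)) has_real_derivative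
        bump_seed (j + 2) x + (- real j) * bump_seed (Suc j) x) (at x)" .
  then show ?thesis
    by (rule has_field_derivative_transform_within_open[where S = "{0<..}"])
       (use greater in \<open>auto simp: bump_seed_def\<close>)
next
  case equal
  \<comment> \<open>At the origin the difference quotient of \<open>bump_seed j\<close> is
    \<open>bump_seed (Suc j)\<close>, whose limit is already known.\<close>
  have "((\<lambda>h. bump_seed j h / h) \<longlongrightarrow> 0) (at 0)"
  proof (rule Lim_transform_eventually[OF bump_seed_tendsto[of "Suc j"]])
    show "\<forall>\<^sub>F h in at 0. bump_seed (Suc j) h = bump_seed j h / h"
      by (auto simp: bump_seed_def divide_inverse eventually_at_filter)
  qed
  then show ?thesis
    using equal by (simp add: DERIV_def bump_seed_def)
qed

lemma n_smooth_bump_seed: "n_smooth n (bump_seed j)"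
proof (induction n arbitrary: j)
  case (Suc n)
  show ?case
    by (rule n_smooth_SucI[OF bump_seed_deriv]) (intro n_smooth_add n_smooth_mult n_smooth_const Suc)
qed simp

text \<open>The parameter \<open>n\<close> raises the cut-off function to the power \<open>1/n\<close>, which drives it to the indicator.\<close>
definition bump :: "nat \<Rightarrow> real \<Rightarrow> real \<Rightarrow> real \<Rightarrow> real" where
  "bump n a b x = bump_seed 0 (real n * x + (- real n * a)) * bump_seed 0 ((- real n) * x + real n * b)"

lemma n_smooth_imp_test:
  assumes "\<And>n. n_smooth n f" "\<And>x. x \<notin> {a..b} \<Longrightarrow> f x = 0" "{a..b} \<subseteq> X"
  shows "f \<in> test_functions X"
  using assms compact_Icc[of a b] unfolding test_functions_def n_smooth_def by blast

lemma test_imp_n_smooth: "f \<in> test_functions X \<Longrightarrow> n_smooth n f"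
  by (auto simp: test_functions_def n_smooth_def)

lemma bump_test: "{a..b} \<subseteq> X \<Longrightarrow> bump n a b \<in> test_functions X"
proof (rule n_smooth_imp_test)
  show "n_smooth k (bump n a b)" for k
    unfolding bump_def by (intro n_smooth_mult n_smooth_affine n_smooth_bump_seed)
  show "bump n a b x = 0" if "x \<notin> {a..b}" for x
    using that by (auto simp: bump_def bump_seed_def zero_less_mult_iff simp flip: right_diff_distrib)
qed

lemma bump_nonneg: "0 \<le> bump n a b x" and bump_le_1: "bump n a b x \<le> 1"
  by (auto simp: bump_def bump_seed_def intro!: mult_le_one)

lemma bump_pos: "a < x \<Longrightarrow> x < b \<Longrightarrow> 0 < n \<Longrightarrow> 0 < bump n a b x"
  by (auto simp: bump_def bump_seed_def simp flip: right_diff_distrib)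

lemma bump_eq_0: "x \<le> a \<or> b \<le> x \<Longrightarrow> bump n a b x = 0"
  by (auto simp: bump_def bump_seed_def zero_less_mult_iff simp flip: right_diff_distrib)

lemma bump_tendsto: "(\<lambda>n. bump n a b x) \<longlonglongrightarrow> indicator {a<..<b} x"
proof (cases "a < x \<and> x < b")
  case True
  have *: "(\<lambda>n. bump_seed 0 (real n * d)) \<longlonglongrightarrow> 1" if "d > 0" for d
  proof -
    have "(\<lambda>n. inverse (real n)) \<longlonglongrightarrow> 0" by (rule LIMSEQ_inverse_real_of_nat[THEN LIMSEQ_imp_Suc])
    then have "(\<lambda>n. exp (- (inverse (real n) * inverse d))) \<longlonglongrightarrow> exp (- (0 * inverse d))"
      by (intro tendsto_intros)
    then have "(\<lambda>n. exp (- (inverse (real n) * inverse d))) \<longlonglongrightarrow> 1" by simp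
    then show ?thesis
    proof (rule Lim_transform_eventually)
      show "\<forall>\<^sub>F n in sequentially. exp (- (inverse (real n) * inverse d)) = bump_seed 0 (real n * d)"
        using eventually_gt_at_top[of 0] by eventually_elim (use that in \<open>simp add: bump_seed_def\<close>)
    qed
  qed
  have "(\<lambda>n. bump_seed 0 (real n * (x - a)) * bump_seed 0 (real n * (b - x))) \<longlonglongrightarrow> 1 * 1"
    using True by (intro tendsto_mult *) auto
  then show ?thesis using True by (simp add: bump_def algebra_simps)
next
  case False
  then show ?thesis by (auto simp: bump_eq_0 not_less)
qed

section \<open>Lebesgue integrals over subsets of the line and local integrability\<close>

lemma sigma_finite_lebesgue: "sigma_finite_measure (lebesgue :: 'a::euclidean_space measure)"
proof
  obtain A :: "nat \<Rightarrow> 'a set" where A: "range A \<subseteq> sets lborel" "(\<Union>i. A i) = space lborel"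
      "\<And>i. emeasure lborel (A i) \<noteq> \<infinity>"
    using lborel.sigma_finite by metis
  show "\<exists>A::'a set set. countable A \<and> A \<subseteq> sets lebesgue \<and> \<Union> A = space lebesgue
      \<and> (\<forall>a\<in>A. emeasure lebesgue a \<noteq> \<infinity>)"
    using A by (intro exI[of _ "range A"]) (auto simp: image_subset_iff)
qed

interpretation lebesgue: sigma_finite_measure lebesgue
  by (rule sigma_finite_lebesgue)

text \<open>Fubini is applied to the product of the completed measures, since the integrands are
  only Lebesgue measurable in each variable.\<close>

interpretation lebesgue_pair: pair_sigma_finite lebesgue lebesgue ..

lemma integral_lebesgue_on_indicator:
  fixes f :: "real \<Rightarrow> 'b::euclidean_space"
  assumes "X \<in> sets lebesgue"
  shows "integral\<^sup>L (lebesgue_on X) f = integral\<^sup>L lebesgue (\<lambda>x. indicator X x *\<^sub>R f x)"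
  using assms by (simp add: integral_restrict_space)

text \<open>Weak derivatives are defined with Bochner integrals over X, the fundamental theorem of
  calculus is applied to gauge integrals over intervals; a function supported in both sets has the
  same integral in either sense.\<close>

lemma integral_lebesgue_on_supported:
  fixes h :: "real \<Rightarrow> complex"
  assumes "h absolutely_integrable_on {a..b}" "\<And>x. x \<notin> {a..b} \<Longrightarrow> h x = 0"
    and "\<And>x. x \<notin> X \<Longrightarrow> h x = 0" "X \<in> sets lebesgue"
  shows "integral\<^sup>L (lebesgue_on X) h = integral {a..b} h"
proof -
  have "integral\<^sup>L (lebesgue_on X) h = integral\<^sup>L lebesgue (\<lambda>x. indicator X x *\<^sub>R h x)"
    using assms(4) by (rule integral_lebesgue_on_indicator)
  also have "(\<lambda>x. indicator X x *\<^sub>R h x) = (\<lambda>x. indicator {a..b} x *\<^sub>R h x)"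
    using assms by (auto simp: indicator_def fun_eq_iff)
  also have "integral\<^sup>L lebesgue \<dots> = integral\<^sup>L (lebesgue_on {a..b}) h"
    by (simp add: integral_lebesgue_on_indicator)
  also have "\<dots> = integral {a..b} h"
    using assms(1) by (intro lebesgue_integral_eq_integral absolutely_integrable_imp_integrable) auto
  finally show ?thesis .
qed

lemma locally_integrable_UNIV_iff:
  "locally_integrable UNIV g \<longleftrightarrow> (\<forall>a b. g absolutely_integrable_on {a..b})"
proof safe
  fix a b assume "locally_integrable UNIV g"
  then show "g absolutely_integrable_on {a..b}"
    by (auto simp: locally_integrable_def)
next
  assume *: "\<forall>a b. g absolutely_integrable_on {a..b}"
  show "locally_integrable UNIV g"
    unfolding locally_integrable_def
  proof safe
    fix K :: "real set" assume K: "compact K"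
    then obtain a where "K \<subseteq> cbox (-a) a"
      using bounded_subset_cbox_symmetric[OF compact_imp_bounded] by blast
    then have "K \<subseteq> {-a..a}" by simp
    then show "g absolutely_integrable_on K"
      using set_integrable_subset[OF *[rule_format] _ \<open>K \<subseteq> {-a..a}\<close>] fmeasurableD[OF lmeasurable_compact[OF K]]
      by blast
  qed
qed

lemma locally_integrable_subset: "locally_integrable X f \<Longrightarrow> Y \<subseteq> X \<Longrightarrow> locally_integrable Y f"
  by (auto simp: locally_integrable_def)

lemma continuous_mult_absolutely_integrable:
  fixes g f :: "real \<Rightarrow> complex"
  assumes "continuous_on {a..b} f" "g absolutely_integrable_on {a..b}"
  shows "(\<lambda>x. f x * g x) absolutely_integrable_on {a..b}"
proof (rule absolutely_integrable_bounded_measurable_product[where h = "(*)", OF _ _ _ _ assms(2)])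
  show "bilinear ((*) :: complex \<Rightarrow> complex \<Rightarrow> complex)"
    by (rule bilinear_times)
  show "f \<in> borel_measurable (lebesgue_on {a..b})"
    using assms(1) by (intro continuous_imp_measurable_on_sets_lebesgue) auto
  show "bounded (f ` {a..b})"
    using assms(1) by (intro compact_imp_bounded compact_continuous_image) auto
qed auto

text \<open>The support lies in an open ball of radius \<open>N\<close>, so the function is zero at
  \<open>N\<close> and \<open>-N\<close> themselves and boundary terms disappear.\<close>

lemma test_functionE:
  assumes "\<phi> \<in> test_functions X"
  obtains N where "N > 0" "\<And>x. x \<le> -N \<or> x \<ge> N \<Longrightarrow> \<phi> x = 0" "\<And>x. x \<notin> X \<Longrightarrow> \<phi> x = 0"
    "\<And>x. (\<phi> has_real_derivative deriv \<phi> x) (at x)" "deriv \<phi> \<in> test_functions X"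
    "continuous_on A \<phi>"
proof -
  obtain K where K: "compact K" "K \<subseteq> X" "\<And>x. x \<notin> K \<Longrightarrow> \<phi> x = 0"
    using assms by (auto simp: test_functions_def)
  obtain N0 where N0: "N0 > 0" "K \<subseteq> ball 0 N0"
    using bounded_subset_ballD[OF compact_imp_bounded[OF K(1)]] by blast
  have d: "(\<phi> has_real_derivative deriv \<phi> x) (at x)" for x
    using n_smooth_SucE(1)[OF test_imp_n_smooth[OF assms]] .
  \<comment> \<open>The function is constant on the open complement of its support, so the
    derivative is supported in the same compact set.\<close>
  have d0: "deriv \<phi> x = 0" if "x \<notin> K" for x
  proof -
    have "((\<lambda>x. 0) has_real_derivative 0) (at x)" by simp
    then have "(\<phi> has_real_derivative 0) (at x)"
      by (rule has_field_derivative_transform_within_open[where S = "-K"])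
        (use that K in \<open>auto intro: open_Compl compact_imp_closed\<close>)
    then show ?thesis by (rule DERIV_imp_deriv)
  qed
  show ?thesis
  proof
    show "N0 > 0" by fact
    show "\<phi> x = 0" if "x \<le> -N0 \<or> x \<ge> N0" for x
    proof -
      have "x \<notin> ball 0 N0" using that N0(1) by (auto simp: dist_real_def)
      then show ?thesis using K(3) N0(2) by blast
    qed
    show "\<phi> x = 0" if "x \<notin> X" for x using K that by blast
    show "(\<phi> has_real_derivative deriv \<phi> x) (at x)" for x by (rule d)
    have "n_smooth n (deriv \<phi>)" for n
      using n_smooth_SucE(2)[OF test_imp_n_smooth[OF assms]] .
    then show "deriv \<phi> \<in> test_functions X"
      using K(1,2) d0 unfolding test_functions_def n_smooth_def
      by (intro CollectI conjI exI[of _ K] allI impI) (meson lessI, auto)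
    show "continuous_on A \<phi>"
      by (intro continuous_at_imp_continuous_on ballI DERIV_isCont[OF d])
  qed
qed

section \<open>The fundamental lemma of the calculus of variations\<close>

text \<open>Intervals are an intersection-stable generator of the Borel sets, so zero integrals pass
  from intervals to Borel sets, and then to Lebesgue sets, each an F-sigma set up to a null set. A
  function with zero integral over every measurable set vanishes almost everywhere.\<close>

lemma integral_subintervals_zero_imp_AE_zero:
  fixes g :: "real \<Rightarrow> complex"
  assumes g: "g absolutely_integrable_on {a..b}"
    and zero: "\<And>c d. a \<le> c \<Longrightarrow> c \<le> d \<Longrightarrow> d \<le> b \<Longrightarrow> integral {c..d} g = 0"
  shows "AE x in lebesgue_on {a..b}. g x = 0"
proof -
  define h where "h x = indicator {a..b} x *\<^sub>R g x" for x
  have h: "integrable lebesgue h"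
    using g by (simp add: set_integrable_def h_def[abs_def])
  have hs: "set_integrable lebesgue A h" if "A \<in> sets lebesgue" for A
    using integrable_mult_indicator[OF that h] by (simp add: set_integrable_def)
  have int: "set_lebesgue_integral lebesgue {c..d} h = 0" for c d
  proof -
    have eq: "indicator {c..d} x *\<^sub>R h x = indicator {max a c..min b d} x *\<^sub>R g x" for x
      by (auto simp: h_def indicator_def)
    have sub: "{max a c..min b d} \<subseteq> {a..b}" by auto
    have "set_lebesgue_integral lebesgue {c..d} h = set_lebesgue_integral lebesgue {max a c..min b d} g"
      by (simp add: set_lebesgue_integral_def eq)
    also have "\<dots> = integral {max a c..min b d} g"
      by (rule set_lebesgue_integral_eq_integral) (rule set_integrable_subset[OF g _ sub], simp)
    also have "\<dots> = 0"
      using zero[of "max a c" "min b d"] by (cases "max a c \<le> min b d") auto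
    finally show ?thesis .
  qed
  have all: "set_lebesgue_integral lebesgue UNIV h = 0"
  proof -
    have "set_lebesgue_integral lebesgue UNIV h = set_lebesgue_integral lebesgue {a..b} h"
      by (auto simp: set_lebesgue_integral_def h_def indicator_def intro!: Bochner_Integration.integral_cong)
    then show ?thesis by (simp add: int)
  qed
  have borel: "set_lebesgue_integral lebesgue A h = 0" if "A \<in> sets borel" for A
    using that
  proof (induction A rule: borel_set_induct)
    case (compl A)
    have A: "A \<in> sets lebesgue" "- A \<in> sets lebesgue"
      using compl.hyps by (auto simp: Compl_in_sets_lebesgue)
    have "set_lebesgue_integral lebesgue (A \<union> -A) h
        = set_lebesgue_integral lebesgue A h + set_lebesgue_integral lebesgue (-A) h"
      by (rule set_integral_Un) (auto intro: hs A)
    then show ?case using all compl.IH by simp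
  next
    case (union f)
    have *: "(\<Union>i. f i) \<in> sets lebesgue" using union.hyps(2) by auto
    have "set_lebesgue_integral lebesgue (\<Union>i. f i) h = (\<Sum>i. set_lebesgue_integral lebesgue (f i) h)"
      by (rule lebesgue_integral_countable_add)
        (use union.hyps in \<open>auto intro: hs[OF *] simp: disjoint_family_on_def\<close>)
    then show ?case by (simp add: union)
  next
    case empty
    show ?case by (simp add: set_lebesgue_integral_def)
  qed (rule int)
  have "AE x in lebesgue. h x = 0"
  proof (rule lebesgue.density_zero[OF h])
    fix A :: "real set" assume "A \<in> sets lebesgue"
    then obtain C T where CT: "fsigma C" "T \<in> null_sets lebesgue" "C \<union> T = A" "disjnt C T"
      by (rule lebesgue_set_almost_fsigma)
    obtain F :: "nat \<Rightarrow> real set" where F: "range F \<subseteq> Collect compact" "C = \<Union>(range F)"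
      using CT(1) fsigma_Union_compact by metis
    have C: "C \<in> sets borel"
      unfolding F(2) using F(1) by (intro sets.countable_UN) (auto intro: borel_compact)
    have "set_lebesgue_integral lebesgue A h
        = set_lebesgue_integral lebesgue C h + set_lebesgue_integral lebesgue T h"
    proof -
      have "C \<inter> T = {}" using CT(4) by (simp add: disjnt_def)
      moreover have "C \<in> sets lebesgue" using C by simp
      moreover have "T \<in> sets lebesgue" using CT(2) by (rule null_setsD2)
      ultimately show ?thesis
        unfolding CT(3)[symmetric] by (intro set_integral_Un hs)
    qed
    also have "set_lebesgue_integral lebesgue T h = 0"
    proof -
      have "AE x in lebesgue. indicator T x *\<^sub>R h x = 0"
        using AE_not_in[OF CT(2)] by eventually_elim simp
      then show ?thesis unfolding set_lebesgue_integral_def by (rule integral_eq_zero_AE)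
    qed
    finally show "set_lebesgue_integral lebesgue A h = 0" using borel[OF C] by simp
  qed
  then have "AE x in lebesgue. x \<in> {a..b} \<longrightarrow> g x = 0"
    by eventually_elim (auto simp: h_def)
  then show ?thesis by (simp add: AE_restrict_space_iff)
qed

text \<open>The bumps converge boundedly to the indicator of an interval, so dominated convergence
  turns the test condition into zero integrals over compact subintervals.\<close>

lemma weak_zero_imp_AE_zero:
  assumes X: "open X" and g: "locally_integrable X g"
    and zero: "\<And>\<phi>. \<phi> \<in> test_functions X \<Longrightarrow> integral\<^sup>L (lebesgue_on X) (\<lambda>x. \<phi> x *\<^sub>R g x) = 0"
  shows "AE x in lebesgue_on X. g x = 0"
proof -
  have int0: "integral {a..b} g = 0" if ab: "{a..b} \<subseteq> X" for a b
  proof -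
    have ga: "g absolutely_integrable_on {a..b}"
      using g ab by (auto simp: locally_integrable_def)
    have bi: "(\<lambda>x. bump n a b x *\<^sub>R g x) absolutely_integrable_on {a..b}" for n
    proof -
      have "continuous_on {a..b} (bump n a b)"
        by (rule test_functionE[OF bump_test[of a b UNIV n]]) auto
      then show ?thesis
        using continuous_mult_absolutely_integrable[OF _ ga, of "\<lambda>x. of_real (bump n a b x)"]
        by (simp add: continuous_on_of_real scaleR_conv_of_real)
    qed
    have "integral {a..b} (\<lambda>x. bump n a b x *\<^sub>R g x) = 0" for n
    proof -
      have "integral\<^sup>L (lebesgue_on X) (\<lambda>x. bump n a b x *\<^sub>R g x) = integral {a..b} (\<lambda>x. bump n a b x *\<^sub>R g x)"
      proof (rule integral_lebesgue_on_supported[OF bi])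
        show "bump n a b x *\<^sub>R g x = 0" if "x \<notin> {a..b}" for x
          using that by (auto simp: bump_eq_0)
        show "bump n a b x *\<^sub>R g x = 0" if "x \<notin> X" for x
          using that ab by (cases "x \<in> {a..b}") (auto simp: bump_eq_0)
      qed (use X in auto)
      then show ?thesis using zero[OF bump_test[OF ab]] by simp
    qed
    moreover have "(\<lambda>n. integral {a..b} (\<lambda>x. bump n a b x *\<^sub>R g x)) \<longlonglongrightarrow>
        integral {a..b} (\<lambda>x. indicator {a<..<b} x *\<^sub>R g x)"
    proof (rule dominated_convergence(2))
      show "(\<lambda>x. bump n a b x *\<^sub>R g x) integrable_on {a..b}" for n
        using bi by (simp add: absolutely_integrable_on_def)
      show "(\<lambda>x. norm (g x)) integrable_on {a..b}"
        using ga by (simp add: absolutely_integrable_on_def)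
      show "norm (bump n a b x *\<^sub>R g x) \<le> norm (g x)" for n x
        using bump_nonneg[of n a b x] bump_le_1[of n a b x] by (simp add: mult_left_le_one_le)
      show "(\<lambda>n. bump n a b x *\<^sub>R g x) \<longlonglongrightarrow> indicator {a<..<b} x *\<^sub>R g x" for x
        by (intro tendsto_scaleR bump_tendsto tendsto_const)
    qed
    moreover have "integral {a..b} (\<lambda>x. indicator {a<..<b} x *\<^sub>R g x) = integral {a..b} g"
      by (rule integral_spike[of "{a,b}"]) (auto simp: indicator_def)
    ultimately show ?thesis by (simp add: LIMSEQ_const_iff)
  qed
  \<comment> \<open>Countably many compact intervals exhaust the open set, so the exceptional null
    sets can be united.\<close>
  obtain \<D> where D: "countable \<D>" "\<D> \<subseteq> Pow X" "\<And>S. S \<in> \<D> \<Longrightarrow> \<exists>a b. S = cbox a b" "\<Union>\<D> = X"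
    using open_countable_Union_open_cbox[OF X] by metis
  have "AE x in lebesgue. \<forall>S\<in>\<D>. x \<in> S \<longrightarrow> g x = 0"
  proof (subst AE_ball_countable[OF D(1)], safe)
    fix S assume S: "S \<in> \<D>"
    then obtain a b where ab: "S = {a..b}" using D(3)[OF S] by auto
    then have "{a..b} \<subseteq> X" using S D(2) by auto
    then have "AE x in lebesgue_on {a..b}. g x = 0"
      using g by (intro integral_subintervals_zero_imp_AE_zero int0) (auto simp: locally_integrable_def)
    then show "AE x in lebesgue. x \<in> S \<longrightarrow> g x = 0" by (simp add: AE_restrict_space_iff ab)
  qed
  then have "AE x in lebesgue. x \<in> X \<longrightarrow> g x = 0"
    by eventually_elim (use D(4) in auto)
  then show ?thesis using X by (simp add: AE_restrict_space_iff)
qed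

section \<open>Absolutely continuous functions\<close>

text \<open>Local absolute continuity on the whole line, with the integral formula in place of the
  epsilon-delta condition. The derivative is an argument because \<open>u\<close> determines it only
  almost everywhere.\<close>

definition abs_cont :: "(real \<Rightarrow> complex) \<Rightarrow> (real \<Rightarrow> complex) \<Rightarrow> bool" where
  "abs_cont u g \<longleftrightarrow> (\<forall>a b. g absolutely_integrable_on {a..b}) \<and>
     (\<forall>a b. a \<le> b \<longrightarrow> u b - u a = integral {a..b} g)"

lemma acD:
  assumes "abs_cont u g"
  shows "g absolutely_integrable_on {a..b}" "g integrable_on {a..b}"
    and "a \<le> b \<Longrightarrow> u b - u a = integral {a..b} g"
    and "a \<le> b \<Longrightarrow> (g has_integral (u b - u a)) {a..b}"
  using assms
  by (auto simp: abs_cont_def absolutely_integrable_on_def has_integral_integrable_integral)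

lemma acI:
  assumes "\<And>a b. g absolutely_integrable_on {a..b}"
    and "\<And>a b. a \<le> b \<Longrightarrow> (g has_integral (u b - u a)) {a..b}"
  shows "abs_cont u g"
  using assms by (auto simp: abs_cont_def intro!: integral_unique[symmetric])

lemma abs_cont_continuous_on:
  assumes "abs_cont u g"
  shows "continuous_on A u"
proof (rule continuous_at_imp_continuous_on, safe)
  fix x
  have "continuous_on {x - 1..x + 1} (\<lambda>y. u (x - 1) + integral {x - 1..y} g)"
    by (intro continuous_intros indefinite_integral_continuous_1 acD(2)[OF assms])
  moreover have "u (x - 1) + integral {x - 1..y} g = u y" if "y \<in> {x - 1..x + 1}" for y
    using acD(3)[OF assms, of "x - 1" y] that by (simp add: algebra_simps)
  ultimately have "continuous_on {x - 1..x + 1} u"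
    by (rule continuous_on_eq)
  then show "isCont u x"
    by (rule continuous_on_interior) auto
qed

lemma abs_cont_lincomb:
  assumes "abs_cont u g" "abs_cont v h"
  shows "abs_cont (\<lambda>x. c * u x + d * v x) (\<lambda>x. c * g x + d * h x)"
proof (rule acI)
  show "(\<lambda>x. c * g x + d * h x) absolutely_integrable_on {a..b}" for a b
    using acD(1)[OF assms(1)] acD(1)[OF assms(2)]
    by (intro set_integral_add(1) set_integrable_mult_right)
  show "((\<lambda>x. c * g x + d * h x) has_integral (c * u b + d * v b - (c * u a + d * v a))) {a..b}"
    if "a \<le> b" for a b
  proof -
    have "((\<lambda>x. c * g x + d * h x) has_integral (c * (u b - u a) + d * (v b - v a))) {a..b}"
      using that by (intro has_integral_add has_integral_mult_right acD(4) assms)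
    then show ?thesis by (simp add: algebra_simps)
  qed
qed

lemma abs_cont_add: "abs_cont u g \<Longrightarrow> abs_cont v h \<Longrightarrow> abs_cont (\<lambda>x. u x + v x) (\<lambda>x. g x + h x)"
  using abs_cont_lincomb[of u g v h 1 1] by simp

lemma abs_cont_diff: "abs_cont u g \<Longrightarrow> abs_cont v h \<Longrightarrow> abs_cont (\<lambda>x. u x - v x) (\<lambda>x. g x - h x)"
  using abs_cont_lincomb[of u g v h 1 "-1"] by simp

lemma abs_cont_cmult: "abs_cont u g \<Longrightarrow> abs_cont (\<lambda>x. c * u x) (\<lambda>x. c * g x)"
  using abs_cont_lincomb[of u g u g c 0] by simp

lemma abs_cont_cnj: "abs_cont u g \<Longrightarrow> abs_cont (\<lambda>x. cnj (u x)) (\<lambda>x. cnj (g x))"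
proof (rule acI)
  assume abs_cont: "abs_cont u g"
  show "(\<lambda>x. cnj (g x)) absolutely_integrable_on {a..b}" for a b
    using absolutely_integrable_linear[OF acD(1)[OF abs_cont] bounded_linear_cnj] by (simp add: o_def)
  show "((\<lambda>x. cnj (g x)) has_integral (cnj (u b) - cnj (u a))) {a..b}" if "a \<le> b" for a b
    using has_integral_linear[OF acD(4)[OF abs_cont that] bounded_linear_cnj] by (simp add: o_def)
qed

lemma abs_cont_cong:
  assumes "abs_cont u g" "\<And>x. u x = v x" "AE x in lebesgue. g x = h x"
  shows "abs_cont v h"
proof -
  have uv: "u = v" using assms(2) by auto
  have neg: "negligible {x. g x \<noteq> h x}"
    using assms(3) unfolding eventually_ae_filter_negligible by (meson negligible_subset)
  show ?thesis
  proof (rule acI)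
    show "h absolutely_integrable_on {a..b}" for a b
      by (rule absolutely_integrable_spike[OF acD(1)[OF assms(1)] neg]) auto
    show "(h has_integral (v b - v a)) {a..b}" if "a \<le> b" for a b
      using has_integral_spike[OF neg _ acD(4)[OF assms(1) that], of h] by (auto simp: uv)
  qed
qed

text \<open>The exceptional set is locally finite: this is how piecewise smooth coefficients
  enter.\<close>

lemma abs_cont_strong:
  assumes S: "\<And>a b. finite (S \<inter> {a..b})"
    and u: "continuous_on UNIV u" "\<And>x. x \<notin> S \<Longrightarrow> (u has_vector_derivative g x) (at x)"
    and g: "\<And>a b. g absolutely_integrable_on {a..b}"
  shows "abs_cont u g"
proof (rule acI[OF g])
  show "(g has_integral u b - u a) {a..b}" if "a \<le> b" for a b
    by (rule fundamental_theorem_of_calculus_interior_strong[OF S[of a b] that])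
      (use u in \<open>auto intro: continuous_on_subset\<close>)
qed

lemma abs_cont_C1:
  assumes "\<And>x. (u has_vector_derivative g x) (at x)" "continuous_on UNIV g"
  shows "abs_cont u g"
proof (rule abs_cont_strong[of "{}"])
  show "continuous_on UNIV u"
    using assms(1) by (meson has_vector_derivative_continuous continuous_at_imp_continuous_on)
  show "g absolutely_integrable_on {a..b}" for a b
    by (rule absolutely_integrable_continuous_real) (rule continuous_on_subset[OF assms(2)], simp)
qed (use assms in auto)

section \<open>Fubini's theorem and the product rule for absolutely continuous functions\<close>

lemma integrable_lebesgue_pair_product:
  fixes g h :: "real \<Rightarrow> complex"
  assumes "integrable lebesgue g" "integrable lebesgue h"
  shows "integrable (lebesgue \<Otimes>\<^sub>M lebesgue) (\<lambda>(x, y). g x * h y)"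
proof (rule lebesgue_pair.Fubini_integrable)
  have "g \<in> borel_measurable lebesgue" "h \<in> borel_measurable lebesgue" using assms by auto
  then have "(\<lambda>p. g (fst p)) \<in> borel_measurable (lebesgue \<Otimes>\<^sub>M lebesgue)"
    "(\<lambda>p. h (snd p)) \<in> borel_measurable (lebesgue \<Otimes>\<^sub>M lebesgue)"
    by (auto intro: measurable_compose[OF measurable_fst] measurable_compose[OF measurable_snd])
  then have "(\<lambda>p. g (fst p) * h (snd p)) \<in> borel_measurable (lebesgue \<Otimes>\<^sub>M lebesgue)"
    by (rule borel_measurable_times)
  then show "(\<lambda>(x, y). g x * h y) \<in> borel_measurable (lebesgue \<Otimes>\<^sub>M lebesgue)"
    by (simp add: case_prod_unfold)
qed (use assms in \<open>auto simp: norm_mult\<close>)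

lemma pair_fst_snd_measurable:
  "(\<lambda>p. fst p) \<in> borel_measurable (lebesgue \<Otimes>\<^sub>M lebesgue :: (real \<times> real) measure)"
  "(\<lambda>p. snd p) \<in> borel_measurable (lebesgue \<Otimes>\<^sub>M lebesgue :: (real \<times> real) measure)"
  using measurable_compose[OF measurable_fst id_borel_measurable_lebesgue]
    measurable_compose[OF measurable_snd id_borel_measurable_lebesgue] by (auto simp: id_def)

text \<open>Cut the square along its diagonal and integrate g(x) h(y): below the diagonal y is the
  inner variable, above it x. This is integration by parts for two primitives.\<close>

lemma integral_triangle_split:
  fixes g h :: "real \<Rightarrow> complex"
  assumes g: "g absolutely_integrable_on {a..b}" and h: "h absolutely_integrable_on {a..b}"
  shows "integral {a..b} (\<lambda>x. g x * integral {a..x} h) + integral {a..b} (\<lambda>x. h x * integral {a..x} g)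
       = integral {a..b} g * integral {a..b} h"
proof -
  define G where "G x = indicator {a..b} x *\<^sub>R g x" for x
  define H where "H x = indicator {a..b} x *\<^sub>R h x" for x
  have GH: "integrable lebesgue G" "integrable lebesgue H"
    using g h by (simp_all add: set_integrable_def G_def[abs_def] H_def[abs_def])
  note prod = integrable_lebesgue_pair_product[OF GH]
  define T where "T = {p \<in> space (lebesgue \<Otimes>\<^sub>M lebesgue). snd p \<le> (fst p :: real)}"
  have T: "T \<in> sets (lebesgue \<Otimes>\<^sub>M lebesgue)"
    unfolding T_def using pair_fst_snd_measurable by (intro borel_measurable_le)
  have T_iff: "(x, y) \<in> T \<longleftrightarrow> y \<le> x" for x y by (simp add: T_def space_pair_measure)
  have I1: "integrable (lebesgue \<Otimes>\<^sub>M lebesgue) (\<lambda>(x, y). indicator T (x, y) *\<^sub>R (G x * H y))"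
    using integrable_mult_indicator[OF T prod] by (simp add: case_prod_unfold)
  have I2: "integrable (lebesgue \<Otimes>\<^sub>M lebesgue) (\<lambda>(x, y). indicator (- T) (x, y) *\<^sub>R (G x * H y))"
  proof -
    have "- T = space (lebesgue \<Otimes>\<^sub>M lebesgue) - T" by (auto simp: space_pair_measure)
    then have "- T \<in> sets (lebesgue \<Otimes>\<^sub>M lebesgue)" using T by auto
    from integrable_mult_indicator[OF this prod] show ?thesis by (simp add: case_prod_unfold)
  qed
  have inner: "indicator {a..b} x * (\<integral>y. indicator {a..x} y *\<^sub>R f y \<partial>lebesgue) = indicator {a..b} x * integral {a..x} f"
    if "f absolutely_integrable_on {a..b}" for f :: "real \<Rightarrow> complex" and x
  proof (cases "x \<in> {a..b}")
    case True
    have "f absolutely_integrable_on {a..x}"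
      by (rule set_integrable_subset[OF that]) (use True in auto)
    then have "set_lebesgue_integral lebesgue {a..x} f = integral {a..x} f"
      by (rule set_lebesgue_integral_eq_integral)
    then show ?thesis using True by (simp add: set_lebesgue_integral_def)
  qed simp
  have "integral {a..b} g = (\<integral>x. G x \<partial>lebesgue)" "integral {a..b} h = (\<integral>y. H y \<partial>lebesgue)"
    using set_lebesgue_integral_eq_integral(2)[OF g] set_lebesgue_integral_eq_integral(2)[OF h]
    by (simp_all add: set_lebesgue_integral_def G_def H_def)
  then have "integral {a..b} g * integral {a..b} h = (\<integral>x. G x * (\<integral>y. H y \<partial>lebesgue) \<partial>lebesgue)"
    by simp
  also have "\<dots> = (\<integral>x. (\<integral>y. G x * H y \<partial>lebesgue) \<partial>lebesgue)" by simp
  also have "\<dots> = integral\<^sup>L (lebesgue \<Otimes>\<^sub>M lebesgue) (\<lambda>(x, y). G x * H y)"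
    using lebesgue_pair.integral_fst'[of "\<lambda>(x, y). G x * H y"] prod by simp
  also have "\<dots> = integral\<^sup>L (lebesgue \<Otimes>\<^sub>M lebesgue)
      (\<lambda>p. (case p of (x, y) \<Rightarrow> indicator T (x, y) *\<^sub>R (G x * H y))
         + (case p of (x, y) \<Rightarrow> indicator (- T) (x, y) *\<^sub>R (G x * H y)))"
    by (rule Bochner_Integration.integral_cong) (auto simp: indicator_def)
  also have "\<dots> = integral\<^sup>L (lebesgue \<Otimes>\<^sub>M lebesgue) (\<lambda>(x, y). indicator T (x, y) *\<^sub>R (G x * H y))
      + integral\<^sup>L (lebesgue \<Otimes>\<^sub>M lebesgue) (\<lambda>(x, y). indicator (- T) (x, y) *\<^sub>R (G x * H y))"
    by (rule Bochner_Integration.integral_add[OF I1 I2])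
  also have "integral\<^sup>L (lebesgue \<Otimes>\<^sub>M lebesgue) (\<lambda>(x, y). indicator T (x, y) *\<^sub>R (G x * H y))
      = integral {a..b} (\<lambda>x. g x * integral {a..x} h)"
  proof -
    have "integral\<^sup>L (lebesgue \<Otimes>\<^sub>M lebesgue) (\<lambda>(x, y). indicator T (x, y) *\<^sub>R (G x * H y))
        = (\<integral>x. (\<integral>y. indicator T (x, y) *\<^sub>R (G x * H y) \<partial>lebesgue) \<partial>lebesgue)"
      using lebesgue_pair.integral_fst'[OF I1] by simp
    also have "\<dots> = (\<integral>x. (\<integral>y. g x * (indicator {a..b} x * (indicator {a..x} y *\<^sub>R h y)) \<partial>lebesgue) \<partial>lebesgue)"
      by (intro Bochner_Integration.integral_cong) (auto simp: T_iff G_def H_def indicator_def)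
    also have "\<dots> = (\<integral>x. g x * (indicator {a..b} x * integral {a..x} h) \<partial>lebesgue)"
      by (simp only: integral_mult_right_zero inner[OF h])
    also have "\<dots> = (\<integral>x. indicator {a..b} x *\<^sub>R (g x * integral {a..x} h) \<partial>lebesgue)"
      by (intro Bochner_Integration.integral_cong) (auto simp: indicator_def)
    also have "\<dots> = integral {a..b} (\<lambda>x. g x * integral {a..x} h)"
    proof -
      have "(\<lambda>x. integral {a..x} h * g x) absolutely_integrable_on {a..b}"
        using g h by (intro continuous_mult_absolutely_integrable indefinite_integral_continuous_1)
          (auto simp: absolutely_integrable_on_def)
      from set_lebesgue_integral_eq_integral(2)[OF this]
      show ?thesis by (simp add: set_lebesgue_integral_def mult.commute)
    qed
    finally show ?thesis .
  qed
  also have "integral\<^sup>L (lebesgue \<Otimes>\<^sub>M lebesgue) (\<lambda>(x, y). indicator (- T) (x, y) *\<^sub>R (G x * H y))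
      = integral {a..b} (\<lambda>y. h y * integral {a..y} g)"
  proof -
    have "integral\<^sup>L (lebesgue \<Otimes>\<^sub>M lebesgue) (\<lambda>(x, y). indicator (- T) (x, y) *\<^sub>R (G x * H y))
        = (\<integral>y. (\<integral>x. indicator (- T) (x, y) *\<^sub>R (G x * H y) \<partial>lebesgue) \<partial>lebesgue)"
      using lebesgue_pair.integral_snd[OF I2] by simp
    also have "\<dots> = (\<integral>y. (\<integral>x. h y * (indicator {a..b} y * (indicator {a..y} x *\<^sub>R g x)) \<partial>lebesgue) \<partial>lebesgue)"
    proof (rule Bochner_Integration.integral_cong[OF refl], rule integral_cong_AE)
      fix y :: real
      show "(\<lambda>x. indicator (- T) (x, y) *\<^sub>R (G x * H y)) \<in> borel_measurable lebesgue"
      proof -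
        have "(\<lambda>x. indicator {..<y} x *\<^sub>R G x * H y) \<in> borel_measurable lebesgue"
          by (intro borel_measurable_times borel_measurable_scaleR borel_measurable_const
              borel_measurable_indicator borel_measurable_integrable[OF GH(1)]) simp
        then show ?thesis
          by (rule back_subst[where P = "\<lambda>f. f \<in> borel_measurable lebesgue"]) (auto simp: T_iff indicator_def)
      qed
      show "(\<lambda>x. h y * (indicator {a..b} y * (indicator {a..y} x *\<^sub>R g x))) \<in> borel_measurable lebesgue"
      proof -
        have "(\<lambda>x. h y * (indicator {a..b} y * (indicator {a..y} x *\<^sub>R G x))) \<in> borel_measurable lebesgue"
          by (intro borel_measurable_times borel_measurable_scaleR borel_measurable_const
              borel_measurable_indicator borel_measurable_integrable[OF GH(1)]) simp
        then show ?thesis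
          by (rule back_subst[where P = "\<lambda>f. f \<in> borel_measurable lebesgue"]) (auto simp: G_def indicator_def)
      qed
      \<comment> \<open>The complement of \<open>T\<close> is the strict inequality x < y, whereas
        the target integrates over x up to and including y; the two differ in one point.\<close>
      have "AE x in lebesgue. x \<noteq> y"
        by (rule AE_not_in[of "{y}", simplified]) auto
      then show "AE x in lebesgue. indicator (- T) (x, y) *\<^sub>R (G x * H y)
          = h y * (indicator {a..b} y * (indicator {a..y} x *\<^sub>R g x))"
        by eventually_elim (auto simp: T_iff G_def H_def indicator_def)
    qed
    also have "\<dots> = (\<integral>y. h y * (indicator {a..b} y * integral {a..y} g) \<partial>lebesgue)"
      by (simp only: integral_mult_right_zero inner[OF g])
    also have "\<dots> = (\<integral>y. indicator {a..b} y *\<^sub>R (h y * integral {a..y} g) \<partial>lebesgue)"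
      by (intro Bochner_Integration.integral_cong) (auto simp: indicator_def)
    also have "\<dots> = integral {a..b} (\<lambda>y. h y * integral {a..y} g)"
    proof -
      have "(\<lambda>x. integral {a..x} g * h x) absolutely_integrable_on {a..b}"
        using g h by (intro continuous_mult_absolutely_integrable indefinite_integral_continuous_1)
          (auto simp: absolutely_integrable_on_def)
      from set_lebesgue_integral_eq_integral(2)[OF this]
      show ?thesis by (simp add: set_lebesgue_integral_def mult.commute)
    qed
    finally show ?thesis .
  qed
  finally show ?thesis by simp
qed

lemma abs_cont_mult:
  assumes "abs_cont u g" "abs_cont v h"
  shows "abs_cont (\<lambda>x. u x * v x) (\<lambda>x. g x * v x + u x * h x)"
proof (rule acI)
  fix a b :: real
  have gv: "(\<lambda>x. g x * v x) absolutely_integrable_on {a..b}"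
    using continuous_mult_absolutely_integrable[OF abs_cont_continuous_on[OF assms(2)] acD(1)[OF assms(1)]]
    by (simp add: mult.commute)
  have uh: "(\<lambda>x. u x * h x) absolutely_integrable_on {a..b}"
    using continuous_mult_absolutely_integrable[OF abs_cont_continuous_on[OF assms(1)] acD(1)[OF assms(2)]]
    by simp
  show abs: "(\<lambda>x. g x * v x + u x * h x) absolutely_integrable_on {a..b}"
    using gv uh by (rule set_integral_add)
  assume ab: "a \<le> b"
  \<comment> \<open>Splitting off the values at the left end leaves two primitives that vanish
    there; their product is covered by the triangle identity, and the mixed terms are
    linear.\<close>
  define G where "G x = integral {a..x} g" for x
  define H where "H x = integral {a..x} h" for x
  have u: "u x = u a + G x" and v: "v x = v a + H x" if "a \<le> x" for x
    using acD(3)[OF assms(1) that] acD(3)[OF assms(2) that] by (simp_all add: G_def H_def algebra_simps)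
  have gi: "g integrable_on {a..b}" and hi: "h integrable_on {a..b}"
    using acD(2) assms by auto
  have gH: "(\<lambda>x. g x * H x) integrable_on {a..b}"
  proof -
    have "(\<lambda>x. H x * g x) absolutely_integrable_on {a..b}"
      unfolding H_def
      by (intro continuous_mult_absolutely_integrable indefinite_integral_continuous_1 hi acD(1)[OF assms(1)])
    then show ?thesis by (simp add: absolutely_integrable_on_def mult.commute)
  qed
  have hG: "(\<lambda>x. h x * G x) integrable_on {a..b}"
  proof -
    have "(\<lambda>x. G x * h x) absolutely_integrable_on {a..b}"
      unfolding G_def
      by (intro continuous_mult_absolutely_integrable indefinite_integral_continuous_1 gi acD(1)[OF assms(2)])
    then show ?thesis by (simp add: absolutely_integrable_on_def mult.commute)
  qed
  have "((\<lambda>x. (v a * g x + g x * H x) + (u a * h x + h x * G x)) has_integral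
      (v a * G b + integral {a..b} (\<lambda>x. g x * H x)) + (u a * H b + integral {a..b} (\<lambda>x. h x * G x))) {a..b}"
    unfolding G_def[of b] H_def[of b]
    by (intro has_integral_add has_integral_mult_right integrable_integral gi hi gH hG)
  then have "((\<lambda>x. g x * v x + u x * h x) has_integral
      (v a * G b + integral {a..b} (\<lambda>x. g x * H x)) + (u a * H b + integral {a..b} (\<lambda>x. h x * G x))) {a..b}"
  proof (rule has_integral_eq[rotated])
    fix x assume "x \<in> {a..b}"
    then have "a \<le> x" by simp
    then have "u x = u a + G x" "v x = v a + H x" by (rule u, rule v)
    then show "v a * g x + g x * H x + (u a * h x + h x * G x) = g x * v x + u x * h x"
      by (simp add: algebra_simps)
  qed
  moreover have "(v a * G b + integral {a..b} (\<lambda>x. g x * H x)) + (u a * H b + integral {a..b} (\<lambda>x. h x * G x))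
      = v a * G b + u a * H b + G b * H b"
    using integral_triangle_split[OF acD(1)[OF assms(1)] acD(1)[OF assms(2)], of a b]
    by (simp add: G_def H_def)
  moreover have "\<dots> = u b * v b - u a * v a"
    using u[OF ab] v[OF ab] by (simp add: algebra_simps)
  ultimately show "((\<lambda>x. g x * v x + u x * h x) has_integral (u b * v b - u a * v a)) {a..b}"
    by simp
qed

section \<open>Weak derivatives\<close>

lemma ae_eq_iff: "X \<in> sets lebesgue \<Longrightarrow> ae_eq X f g \<longleftrightarrow> (AE x in lebesgue. x \<in> X \<longrightarrow> f x = g x)"
  by (simp add: ae_eq_def AE_restrict_space_iff)

lemma ae_eq_UNIV_iff: "ae_eq UNIV f g \<longleftrightarrow> (AE x in lebesgue. f x = g x)"
  by (simp add: ae_eq_iff)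

lemma ae_eq_refl [simp]: "ae_eq X f f"
  by (simp add: ae_eq_def)

lemma ae_eq_sym: "ae_eq X f g \<Longrightarrow> ae_eq X g f"
  by (auto simp: ae_eq_def)

lemma ae_eq_trans: "ae_eq X f g \<Longrightarrow> ae_eq X g h \<Longrightarrow> ae_eq X f h"
  unfolding ae_eq_def by (rule eventually_elim2) auto

lemma ae_eq_subset: "ae_eq UNIV f g \<Longrightarrow> X \<in> sets lebesgue \<Longrightarrow> ae_eq X f g"
  by (auto simp: ae_eq_iff)

lemma test_scaleR_integrable:
  assumes "\<phi> \<in> test_functions X" "locally_integrable X f" "open X"
  shows "integrable (lebesgue_on X) (\<lambda>x. \<phi> x *\<^sub>R f x)"
proof -
  obtain K where K: "compact K" "K \<subseteq> X" "\<And>x. x \<notin> K \<Longrightarrow> \<phi> x = 0"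
    using assms(1) by (auto simp: test_functions_def)
  have cont: "continuous_on K \<phi>"
    by (rule test_functionE[OF assms(1)]) auto
  have K_sets: "K \<in> sets lebesgue" using K(1) by (auto intro: fmeasurableD lmeasurable_compact)
  have "(\<lambda>x. \<phi> x *\<^sub>R f x) absolutely_integrable_on K"
  proof (rule absolutely_integrable_bounded_measurable_product[where h = "(*\<^sub>R)"])
    show "bilinear ((*\<^sub>R) :: real \<Rightarrow> complex \<Rightarrow> complex)"
      by (simp add: bilinear_conv_bounded_bilinear bounded_bilinear_scaleR)
    show "\<phi> \<in> borel_measurable (lebesgue_on K)"
      using cont K_sets by (rule continuous_imp_measurable_on_sets_lebesgue)
    show "bounded (\<phi> ` K)"
      using cont K(1) by (intro compact_imp_bounded compact_continuous_image)
    show "f absolutely_integrable_on K" using assms(2) K by (auto simp: locally_integrable_def)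
  qed fact
  then have "integrable lebesgue (\<lambda>x. indicator K x *\<^sub>R (\<phi> x *\<^sub>R f x))"
    by (simp add: set_integrable_def)
  also have "(\<lambda>x. indicator K x *\<^sub>R (\<phi> x *\<^sub>R f x)) = (\<lambda>x. indicator X x *\<^sub>R (\<phi> x *\<^sub>R f x))"
    using K by (auto simp: indicator_def fun_eq_iff)
  finally show ?thesis
    using assms(3) by (simp add: integrable_restrict_space)
qed

lemma locally_integrable_cong:
  assumes "ae_eq X f g" "open X" "locally_integrable X f"
  shows "locally_integrable X g"
  unfolding locally_integrable_def
proof safe
  fix K assume K: "compact K" "K \<subseteq> X"
  have "AE x in lebesgue. x \<in> X \<longrightarrow> f x = g x"
    using assms(1,2) by (simp add: ae_eq_iff)
  then have neg: "negligible {x \<in> X. f x \<noteq> g x}"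
    unfolding eventually_ae_filter_negligible
    by (rule exE) (auto intro: negligible_subset)
  have "f absolutely_integrable_on K" using assms(3) K by (auto simp: locally_integrable_def)
  then show "g absolutely_integrable_on K"
    by (rule absolutely_integrable_spike[OF _ neg]) (use K in auto)
qed

lemma has_weak_deriv_cong:
  assumes "has_weak_deriv X u g" "ae_eq X u u'" "ae_eq X g g'" "open X"
  shows "has_weak_deriv X u' g'"
  unfolding has_weak_deriv_def
proof safe
  show loc: "locally_integrable X u'" "locally_integrable X g'"
    using assms locally_integrable_cong by (auto simp: has_weak_deriv_def)
  fix \<phi> assume phi: "\<phi> \<in> test_functions X"
  have d: "deriv \<phi> \<in> test_functions X" by (rule test_functionE[OF phi])
  have "integral\<^sup>L (lebesgue_on X) (\<lambda>x. deriv \<phi> x *\<^sub>R u' x) = integral\<^sup>L (lebesgue_on X) (\<lambda>x. deriv \<phi> x *\<^sub>R u x)"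
  proof (rule integral_cong_AE)
    show "AE x in lebesgue_on X. deriv \<phi> x *\<^sub>R u' x = deriv \<phi> x *\<^sub>R u x"
      using assms(2) unfolding ae_eq_def by eventually_elim simp
  qed (use assms(1,4) loc d in \<open>auto simp: has_weak_deriv_def
        intro!: borel_measurable_integrable test_scaleR_integrable\<close>)
  also have "\<dots> = - integral\<^sup>L (lebesgue_on X) (\<lambda>x. \<phi> x *\<^sub>R g x)"
    using assms(1) phi by (auto simp: has_weak_deriv_def)
  also have "integral\<^sup>L (lebesgue_on X) (\<lambda>x. \<phi> x *\<^sub>R g x) = integral\<^sup>L (lebesgue_on X) (\<lambda>x. \<phi> x *\<^sub>R g' x)"
  proof (rule integral_cong_AE)
    show "AE x in lebesgue_on X. \<phi> x *\<^sub>R g x = \<phi> x *\<^sub>R g' x"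
      using assms(3) unfolding ae_eq_def by eventually_elim simp
  qed (use assms(1,4) loc phi in \<open>auto simp: has_weak_deriv_def
        intro!: borel_measurable_integrable test_scaleR_integrable\<close>)
  finally show "integral\<^sup>L (lebesgue_on X) (\<lambda>x. deriv \<phi> x *\<^sub>R u' x) = - integral\<^sup>L (lebesgue_on X) (\<lambda>x. \<phi> x *\<^sub>R g' x)" .
qed

lemma locally_integrable_lincomb:
  assumes "locally_integrable X f" "locally_integrable X g"
  shows "locally_integrable X (\<lambda>x. c * f x + d * g x)"
  using assms unfolding locally_integrable_def by (auto intro!: set_integral_add(1) set_integrable_mult_right)

lemma locally_integrable_diff:
  assumes "locally_integrable X f" "locally_integrable X g"
  shows "locally_integrable X (\<lambda>x. f x - g x)"
  using locally_integrable_lincomb[OF assms, of 1 "-1"] by simp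

lemma has_weak_deriv_unique:
  assumes "has_weak_deriv X u g" "has_weak_deriv X u h" "open X"
  shows "ae_eq X g h"
proof -
  have loc: "locally_integrable X g" "locally_integrable X h" using assms by (auto simp: has_weak_deriv_def)
  have "AE x in lebesgue_on X. g x - h x = 0"
  proof (rule weak_zero_imp_AE_zero[OF assms(3)])
    show "locally_integrable X (\<lambda>x. g x - h x)" using loc by (rule locally_integrable_diff)
    fix \<phi> assume phi: "\<phi> \<in> test_functions X"
    have "integral\<^sup>L (lebesgue_on X) (\<lambda>x. \<phi> x *\<^sub>R (g x - h x))
        = integral\<^sup>L (lebesgue_on X) (\<lambda>x. \<phi> x *\<^sub>R g x) - integral\<^sup>L (lebesgue_on X) (\<lambda>x. \<phi> x *\<^sub>R h x)"
      using Bochner_Integration.integral_diff[OF test_scaleR_integrable[OF phi loc(1) assms(3)]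
          test_scaleR_integrable[OF phi loc(2) assms(3)]]
      by (simp add: scaleR_diff_right)
    also have "\<dots> = 0" using assms(1,2) phi by (simp add: has_weak_deriv_def)
    finally show "integral\<^sup>L (lebesgue_on X) (\<lambda>x. \<phi> x *\<^sub>R (g x - h x)) = 0" .
  qed
  then show ?thesis by (simp add: ae_eq_def)
qed

lemma weak_deriv_ae_eq:
  assumes "has_weak_deriv X u g" "open X"
  shows "has_weak_deriv X u (weak_deriv X u)" "ae_eq X (weak_deriv X u) g"
proof -
  show *: "has_weak_deriv X u (weak_deriv X u)"
    unfolding weak_deriv_def using assms(1) by (rule someI[where P = "has_weak_deriv X u"])
  show "ae_eq X (weak_deriv X u) g"
    using * assms by (rule has_weak_deriv_unique)
qed

lemma continuous_imp_locally_integrable: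
  "continuous_on UNIV u \<Longrightarrow> locally_integrable X u"
proof (rule locally_integrable_subset)
  assume "continuous_on UNIV u"
  then show "locally_integrable UNIV u"
    unfolding locally_integrable_UNIV_iff
    by (auto intro!: absolutely_integrable_continuous_real intro: continuous_on_subset)
qed simp

lemma abs_cont_imp_locally_integrable:
  assumes "abs_cont u g"
  shows "locally_integrable X u" "locally_integrable X g"
proof -
  show "locally_integrable X u"
    by (intro continuous_imp_locally_integrable abs_cont_continuous_on[OF assms])
  have "locally_integrable UNIV g"
    unfolding locally_integrable_UNIV_iff using acD(1)[OF assms] by blast
  then show "locally_integrable X g" by (rule locally_integrable_subset) simp
qed

text \<open>Integrate the derivative of the product with a test function over an interval around its
  support: both boundary values are zero.\<close>

lemma abs_cont_imp_weak_deriv: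
  assumes abs_cont: "abs_cont u g" and X: "open X"
  shows "has_weak_deriv X u g"
  unfolding has_weak_deriv_def
proof safe
  show "locally_integrable X u" "locally_integrable X g"
    by (rule abs_cont_imp_locally_integrable[OF abs_cont])+
  fix \<phi> assume phi: "\<phi> \<in> test_functions X"
  obtain N where N: "N > 0" "\<And>x. x \<le> -N \<or> x \<ge> N \<Longrightarrow> \<phi> x = 0"
    and X0: "\<And>x. x \<notin> X \<Longrightarrow> \<phi> x = 0" and der: "\<And>x. (\<phi> has_real_derivative deriv \<phi> x) (at x)"
    and dt: "deriv \<phi> \<in> test_functions X"
    by (rule test_functionE[OF phi]) (use that in auto)
  have dX0: "deriv \<phi> x = 0" if "x \<notin> X" for x
    by (rule test_functionE[OF dt]) (use that in blast)
  have cd: "continuous_on A (deriv \<phi>)" for A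
    by (rule test_functionE[OF dt])
  have dN: "deriv \<phi> x = 0" if "x \<notin> {-N..N}" for x
  proof -
    have "((\<lambda>x. 0) has_real_derivative 0) (at x)" by simp
    then have "(\<phi> has_real_derivative 0) (at x)"
      by (rule has_field_derivative_transform_within_open[where S = "-{-N..N}"])
        (use that N in auto)
    then show ?thesis by (rule DERIV_imp_deriv)
  qed
  have acphi: "abs_cont (\<lambda>x. of_real (\<phi> x)) (\<lambda>x. of_real (deriv \<phi> x))"
  proof (rule abs_cont_C1)
    show "((\<lambda>x. complex_of_real (\<phi> x)) has_vector_derivative complex_of_real (deriv \<phi> x)) (at x)" for x
      using der[of x] by (intro has_vector_derivative_of_real) (simp add: has_real_derivative_iff_has_vector_derivative)
    show "continuous_on UNIV (\<lambda>x. complex_of_real (deriv \<phi> x))" by (intro continuous_intros cd)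
  qed
  note prod = abs_cont_mult[OF acphi abs_cont]
  have i1: "(\<lambda>x. deriv \<phi> x *\<^sub>R u x) absolutely_integrable_on {-N..N}"
    by (intro absolutely_integrable_continuous_real continuous_intros cd abs_cont_continuous_on[OF abs_cont])
  have i2: "(\<lambda>x. \<phi> x *\<^sub>R g x) absolutely_integrable_on {-N..N}"
    unfolding scaleR_conv_of_real
    by (intro continuous_mult_absolutely_integrable acD(1)[OF abs_cont] abs_cont_continuous_on[OF acphi])
  have "integral\<^sup>L (lebesgue_on X) (\<lambda>x. deriv \<phi> x *\<^sub>R u x) = integral {-N..N} (\<lambda>x. deriv \<phi> x *\<^sub>R u x)"
    by (rule integral_lebesgue_on_supported[OF i1]) (use X dX0 dN in auto)
  moreover have "integral\<^sup>L (lebesgue_on X) (\<lambda>x. \<phi> x *\<^sub>R g x) = integral {-N..N} (\<lambda>x. \<phi> x *\<^sub>R g x)"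
    by (rule integral_lebesgue_on_supported[OF i2]) (use X X0 N in auto)
  moreover have "integral {-N..N} (\<lambda>x. deriv \<phi> x *\<^sub>R u x) + integral {-N..N} (\<lambda>x. \<phi> x *\<^sub>R g x) = 0"
  proof -
    have "((\<lambda>x. deriv \<phi> x *\<^sub>R u x + \<phi> x *\<^sub>R g x) has_integral
        (of_real (\<phi> N) * u N - of_real (\<phi> (-N)) * u (-N))) {-N..N}"
      using acD(4)[OF prod, of "-N" N] N(1) by (simp add: scaleR_conv_of_real)
    then have "integral {-N..N} (\<lambda>x. deriv \<phi> x *\<^sub>R u x + \<phi> x *\<^sub>R g x) = 0"
      using N(2)[of N] N(2)[of "-N"] by (simp add: integral_unique)
    then show ?thesis
      using i1 i2 by (simp add: integral_add absolutely_integrable_on_def)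
  qed
  ultimately show "integral\<^sup>L (lebesgue_on X) (\<lambda>x. deriv \<phi> x *\<^sub>R u x) =
      - integral\<^sup>L (lebesgue_on X) (\<lambda>x. \<phi> x *\<^sub>R g x)"
    by (simp add: eq_neg_iff_add_eq_0)
qed

lemma abs_cont_primitive:
  assumes "locally_integrable UNIV g"
  obtains G where "abs_cont G g" "G 0 = 0"
proof
  define G where "G x = (if 0 \<le> x then integral {0..x} g else - integral {x..0} g)" for x
  have g: "g absolutely_integrable_on {a..b}" for a b
    using assms by (simp add: locally_integrable_UNIV_iff)
  then have gi: "g integrable_on {a..b}" for a b by (simp add: absolutely_integrable_on_def)
  show "abs_cont G g"
  proof (rule acI[OF g])
    fix a b :: real assume "a \<le> b"
    then have "integral {a..b} g = G b - G a"
      using Henstock_Kurzweil_Integration.integral_combine[OF _ _ gi, of 0 a b] Henstock_Kurzweil_Integration.integral_combine[OF _ _ gi, of a 0 b]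
        Henstock_Kurzweil_Integration.integral_combine[OF _ _ gi, of a b 0]
      by (auto simp: G_def algebra_simps)
    then show "(g has_integral G b - G a) {a..b}"
      using integrable_integral[OF gi, of a b] by simp
  qed
  show "G 0 = 0" by (simp add: G_def)
qed

text \<open>The primitive is constant to the right of the support, and the constant is the total
  integral; if that is zero, the primitive is again a test function.\<close>

lemma test_antiderivative:
  assumes chi: "\<And>n. n_smooth n \<rho>" "\<And>x. x \<notin> {-N..N} \<Longrightarrow> \<rho> x = 0" and zero: "integral {-N..N} \<rho> = 0" and N: "N > 0"
  obtains \<phi> where "\<phi> \<in> test_functions UNIV" "deriv \<phi> = \<rho>"
proof -
  \<comment> \<open>The primitive starts one unit to the left of the support, so that every point
    from \<open>-N\<close> on is interior to the interval in which it is differentiated.\<close>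
  define \<phi> where "\<phi> x = integral {-(N+1)..x} \<rho>" for x
  have d\<rho>: "(\<rho> has_real_derivative deriv \<rho> x) (at x)" for x
    by (rule n_smooth_SucE(1)[OF chi(1)])
  have cont: "continuous_on A \<rho>" for A
    by (intro continuous_at_imp_continuous_on ballI DERIV_isCont[OF d\<rho>])
  have int: "\<rho> integrable_on {a..b}" for a b
    by (rule integrable_continuous_real[OF cont])
  have null: "integral S \<rho> = 0" if "S \<inter> {-N..N} \<subseteq> {}" for S
  proof -
    have "integral S \<rho> = integral S (\<lambda>_. 0)"
      using that chi(2) by (intro Henstock_Kurzweil_Integration.integral_cong) blast
    then show ?thesis by simp
  qed
  have low: "\<phi> x = 0" if "x < -N" for x
    unfolding \<phi>_def using that N by (intro null) auto
  have high: "\<phi> x = 0" if "x > N" for x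
  proof -
    have "\<phi> x = integral {-(N+1)..-N} \<rho> + integral {-N..N} \<rho> + integral {N..x} \<rho>"
      unfolding \<phi>_def using that N
      by (simp add: Henstock_Kurzweil_Integration.integral_combine[OF _ _ int] add.assoc)
    moreover have "integral {-(N+1)..-N} \<rho> = 0"
      by (subst integral_open_interval_real) (rule null, auto)
    moreover have "integral {N..x} \<rho> = 0"
      by (subst integral_open_interval_real) (rule null, auto)
    ultimately show ?thesis using zero by simp
  qed
  have der: "(\<phi> has_real_derivative \<rho> x) (at x)" for x
  proof (cases "x < -N")
    case True
    have "((\<lambda>x. 0) has_real_derivative 0) (at x)" by simp
    then have "(\<phi> has_real_derivative 0) (at x)"
      by (rule has_field_derivative_transform_within_open[where S = "{..<-N}"])
        (use True low in auto)
    then show ?thesis using True chi(2)[of x] by simp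
  next
    case False
    have "(\<phi> has_real_derivative \<rho> x) (at x within {-(N+1)..x+1})"
      unfolding \<phi>_def using False by (intro integral_has_real_derivative cont) auto
    moreover have "(at x within {-(N+1)..x+1}) = at x"
      using False by (intro at_within_interior) (auto simp: interior_atLeastAtMost_real)
    ultimately show ?thesis by simp
  qed
  have deriv: "deriv \<phi> = \<rho>" using der by (auto intro: DERIV_imp_deriv)
  have "\<phi> \<in> test_functions UNIV"
  proof (rule n_smooth_imp_test)
    show "n_smooth n \<phi>" for n
      by (cases n) (auto intro: n_smooth_SucI[OF der chi(1)])
    show "\<phi> x = 0" if "x \<notin> {-N..N}" for x using that low high by auto
  qed simp
  with deriv show ?thesis using that by blast
qed

text \<open>Subtracting a multiple of one fixed bump gives any test function zero integral and makes
  it the derivative of a test function. Hence \<open>w\<close> minus its normalised mean against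
  that bump is weakly zero.\<close>

lemma weak_deriv_zero_imp_const:
  assumes w: "locally_integrable UNIV w"
    and zero: "\<And>\<phi>. \<phi> \<in> test_functions UNIV \<Longrightarrow> integral\<^sup>L lebesgue (\<lambda>x. deriv \<phi> x *\<^sub>R w x) = 0"
  obtains c where "AE x in lebesgue. w x = c"
proof -
  define \<eta> where "\<eta> = bump 1 0 1"
  have \<eta>: "\<eta> \<in> test_functions UNIV" unfolding \<eta>_def by (rule bump_test) simp
  have \<eta>c: "continuous_on A \<eta>" for A by (rule test_functionE[OF \<eta>])
  have \<eta>0: "\<eta> x = 0" if "x \<notin> {0..1}" for x using that by (auto simp: \<eta>_def bump_eq_0)
  define I where "I = integral {0..1} \<eta>"
  have I: "I \<noteq> 0"
  proof
    assume "I = 0"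
    then have "\<And>x. x \<in> {0..1} \<Longrightarrow> \<eta> x = 0"
      using integral_eq_0_iff[of 0 1 \<eta>] \<eta>c bump_nonneg unfolding I_def \<eta>_def by auto
    from this[of "1/2"] show False using bump_pos[of 0 "1/2" 1 1] by (simp add: \<eta>_def)
  qed
  have iw: "integrable lebesgue (\<lambda>x. \<psi> x *\<^sub>R w x)" if "\<psi> \<in> test_functions UNIV" for \<psi>
    using test_scaleR_integrable[OF that w] by (simp add: lebesgue_on_UNIV_eq)
  define c where "c = (1 / I) *\<^sub>R integral\<^sup>L lebesgue (\<lambda>x. \<eta> x *\<^sub>R w x)"
  have loc: "locally_integrable UNIV (\<lambda>x. w x - c)"
    by (intro locally_integrable_diff w continuous_imp_locally_integrable continuous_intros)
  have "AE x in lebesgue_on UNIV. w x - c = 0"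
  proof (rule weak_zero_imp_AE_zero[OF open_UNIV loc])
    fix \<psi> :: "real \<Rightarrow> real" assume \<psi>: "\<psi> \<in> test_functions UNIV"
    obtain N0 where N0: "N0 > 0" "\<And>x. x \<le> -N0 \<or> x \<ge> N0 \<Longrightarrow> \<psi> x = 0"
      by (rule test_functionE[OF \<psi>]) (use that in auto)
    have \<psi>c: "continuous_on A \<psi>" for A by (rule test_functionE[OF \<psi>])
    \<comment> \<open>Large enough for the supports of both \<open>\<psi>\<close> and
      \<open>\<eta>\<close>.\<close>
    define N where "N = max N0 1"
    define J where "J = integral {-N..N} \<psi>"
    define \<rho> where "\<rho> x = \<psi> x + (- J / I) * \<eta> x" for x
    have sm: "n_smooth n \<rho>" for n
      unfolding \<rho>_def by (intro n_smooth_add n_smooth_mult n_smooth_const test_imp_n_smooth[OF \<psi>] test_imp_n_smooth[OF \<eta>])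
    have \<psi>N: "\<psi> x = 0" if "x \<notin> {-N..N}" for x
    proof -
      have "x \<le> -N0 \<or> x \<ge> N0" using that by (simp add: N_def) linarith
      then show ?thesis by (rule N0(2))
    qed
    have sup: "\<rho> x = 0" if "x \<notin> {-N..N}" for x
    proof -
      have "x \<notin> {0..1}" using that by (simp add: N_def) linarith
      then show ?thesis using \<psi>N[OF that] \<eta>0 by (simp add: \<rho>_def)
    qed
    have "integral {-N..N} \<eta> = I"
    proof -
      have "integral {-N..N} (\<lambda>x. if x \<in> {0..1} then \<eta> x else 0) = I"
      proof (rule integral_unique)
        have "{0..1} \<subseteq> {-N..N}" by (auto simp: N_def)
        moreover have "(\<eta> has_integral I) {0..1}"
          unfolding I_def by (intro integrable_integral integrable_continuous_real \<eta>c)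
        ultimately show "((\<lambda>x. if x \<in> {0..1} then \<eta> x else 0) has_integral I) {-N..N}"
          by (subst has_integral_restrict)
      qed
      moreover have "(\<lambda>x. if x \<in> {0..1} then \<eta> x else 0) = \<eta>" using \<eta>0 by auto
      ultimately show ?thesis by simp
    qed
    then have "integral {-N..N} \<rho> = 0"
      unfolding \<rho>_def using I \<psi>c \<eta>c
      by (subst integral_add) (auto intro!: integrable_continuous_real continuous_intros simp: J_def)
    moreover have "N > 0" by (simp add: N_def)
    ultimately obtain \<phi> where \<phi>: "\<phi> \<in> test_functions UNIV" "deriv \<phi> = \<rho>"
      using test_antiderivative[of \<rho> N, OF sm sup] by blast
    have "0 = integral\<^sup>L lebesgue (\<lambda>x. \<rho> x *\<^sub>R w x)" using zero[OF \<phi>(1)] \<phi>(2) by simp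
    also have "(\<lambda>x. \<rho> x *\<^sub>R w x) = (\<lambda>x. \<psi> x *\<^sub>R w x + (- J / I) *\<^sub>R (\<eta> x *\<^sub>R w x))"
      by (simp add: \<rho>_def scaleR_diff_left)
    also have "integral\<^sup>L lebesgue \<dots> = integral\<^sup>L lebesgue (\<lambda>x. \<psi> x *\<^sub>R w x) - J *\<^sub>R c"
      using Bochner_Integration.integral_add[OF iw[OF \<psi>] integrable_scaleR_right[OF iw[OF \<eta>], of "- J / I"]]
      unfolding integral_scaleR_right by (simp add: c_def)
    finally have 1: "integral\<^sup>L lebesgue (\<lambda>x. \<psi> x *\<^sub>R w x) = J *\<^sub>R c" by simp
    have ic: "integrable lebesgue (\<lambda>x. \<psi> x *\<^sub>R c)"
      using test_scaleR_integrable[OF \<psi> continuous_imp_locally_integrable[of "\<lambda>_. c"]]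
      by (simp add: lebesgue_on_UNIV_eq)
    have 2: "integral\<^sup>L lebesgue (\<lambda>x. \<psi> x *\<^sub>R c) = J *\<^sub>R c"
    proof -
      have "integral\<^sup>L (lebesgue_on UNIV) (\<lambda>x. \<psi> x *\<^sub>R c) = integral {-N..N} (\<lambda>x. \<psi> x *\<^sub>R c)"
      proof (rule integral_lebesgue_on_supported)
        show "(\<lambda>x. \<psi> x *\<^sub>R c) absolutely_integrable_on {-N..N}"
          by (intro absolutely_integrable_continuous_real continuous_intros \<psi>c)
        show "\<psi> x *\<^sub>R c = 0" if "x \<notin> {-N..N}" for x using \<psi>N[OF that] by simp
      qed auto
      also have "\<dots> = J *\<^sub>R c"
        unfolding J_def using \<psi>c
        by (intro integral_unique has_integral_scaleR_left integrable_integral integrable_continuous_real)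
      finally show ?thesis by (simp add: lebesgue_on_UNIV_eq)
    qed
    show "integral\<^sup>L (lebesgue_on UNIV) (\<lambda>x. \<psi> x *\<^sub>R (w x - c)) = 0"
      using 1 2 Bochner_Integration.integral_diff[OF iw[OF \<psi>] ic]
      by (simp add: lebesgue_on_UNIV_eq scaleR_diff_right)
  qed
  then have "AE x in lebesgue. w x = c"
    by (auto simp: AE_restrict_space_iff)
  then show ?thesis by (rule that)
qed

text \<open>A primitive of the weak derivative differs from \<open>u\<close> by a function with weak
  derivative zero, that is, by a constant.\<close>

lemma weak_deriv_imp_abs_cont:
  assumes "has_weak_deriv UNIV u g"
  obtains U where "abs_cont U g" "ae_eq UNIV u U"
proof -
  have loc: "locally_integrable UNIV u" "locally_integrable UNIV g"
    using assms by (auto simp: has_weak_deriv_def)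
  obtain G where G: "abs_cont G g" by (rule abs_cont_primitive[OF loc(2)])
  have wG: "has_weak_deriv UNIV G g" by (rule abs_cont_imp_weak_deriv[OF G open_UNIV])
  then have locG: "locally_integrable UNIV G" by (simp add: has_weak_deriv_def)
  obtain c where c: "AE x in lebesgue. u x - G x = c"
  proof (rule weak_deriv_zero_imp_const)
    show "locally_integrable UNIV (\<lambda>x. u x - G x)" using loc(1) locG by (rule locally_integrable_diff)
    fix \<phi> :: "real \<Rightarrow> real" assume phi: "\<phi> \<in> test_functions UNIV"
    have d: "deriv \<phi> \<in> test_functions UNIV" by (rule test_functionE[OF phi])
    have "integral\<^sup>L lebesgue (\<lambda>x. deriv \<phi> x *\<^sub>R (u x - G x))
        = integral\<^sup>L lebesgue (\<lambda>x. deriv \<phi> x *\<^sub>R u x) - integral\<^sup>L lebesgue (\<lambda>x. deriv \<phi> x *\<^sub>R G x)"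
      using Bochner_Integration.integral_diff[OF test_scaleR_integrable[OF d loc(1) open_UNIV]
          test_scaleR_integrable[OF d locG open_UNIV]]
      by (simp add: lebesgue_on_UNIV_eq scaleR_diff_right)
    also have "\<dots> = 0"
      using assms wG phi by (simp add: has_weak_deriv_def lebesgue_on_UNIV_eq)
    finally show "integral\<^sup>L lebesgue (\<lambda>x. deriv \<phi> x *\<^sub>R (u x - G x)) = 0" .
  qed (use that in blast)
  have "abs_cont (\<lambda>x. G x + c) (\<lambda>x. g x + 0)"
    by (intro abs_cont_add G abs_cont_C1) (auto intro!: derivative_eq_intros)
  moreover have "ae_eq UNIV u (\<lambda>x. G x + c)"
    unfolding ae_eq_UNIV_iff using c by eventually_elim (auto simp: algebra_simps)
  ultimately show ?thesis using that by simp
qed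

section \<open>Square-integrable functions\<close>

abbreviation (input) L2 :: "(real \<Rightarrow> complex) set" where "L2 \<equiv> L2_space UNIV"
abbreviation (input) N2 :: "(real \<Rightarrow> complex) \<Rightarrow> real" where "N2 \<equiv> L2_norm UNIV"

lemma L2_iff: "f \<in> L2 \<longleftrightarrow> f \<in> borel_measurable lebesgue \<and> integrable lebesgue (\<lambda>x. (cmod (f x))\<^sup>2)"
  by (simp add: L2_space_def lebesgue_on_UNIV_eq)

lemma N2_eq: "N2 f = sqrt (integral\<^sup>L lebesgue (\<lambda>x. (cmod (f x))\<^sup>2))"
  by (simp add: L2_norm_def lebesgue_on_UNIV_eq)

lemma N2_sq: "(N2 f)\<^sup>2 = integral\<^sup>L lebesgue (\<lambda>x. (cmod (f x))\<^sup>2)"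
  unfolding N2_eq by (rule real_sqrt_pow2) simp

lemma L2_norm_nonneg [simp]: "0 \<le> L2_norm X f"
  by (simp add: L2_norm_def)

lemma L2_measurable: "f \<in> L2 \<Longrightarrow> f \<in> borel_measurable lebesgue"
  by (simp add: L2_iff)

lemma L2_sq_integrable: "f \<in> L2 \<Longrightarrow> integrable lebesgue (\<lambda>x. (cmod (f x))\<^sup>2)"
  by (simp add: L2_iff)

lemma lebesgue_measurable_cong_AE:
  fixes f g :: "real \<Rightarrow> complex"
  assumes "f \<in> borel_measurable lebesgue" "AE x in lebesgue. f x = g x"
  shows "g \<in> borel_measurable lebesgue"
proof (rule measurableI)
  fix A :: "complex set" assume A: "A \<in> sets borel"
  have "AE x in lebesgue. x \<in> f -` A \<inter> space lebesgue \<longleftrightarrow> x \<in> g -` A \<inter> space lebesgue"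
    using assms(2) by eventually_elim auto
  then show "g -` A \<inter> space lebesgue \<in> sets lebesgue"
    by (rule completion.in_sets_AE) (use measurable_sets[OF assms(1) A] in auto)
qed simp

lemma L2_cong:
  assumes "ae_eq UNIV f g" "f \<in> L2"
  shows "g \<in> L2" "N2 g = N2 f"
proof -
  have ae: "AE x in lebesgue. f x = g x" using assms(1) by (simp add: ae_eq_UNIV_iff)
  have g: "g \<in> borel_measurable lebesgue"
    using lebesgue_measurable_cong_AE[OF L2_measurable[OF assms(2)] ae] .
  have ae2: "AE x in lebesgue. (cmod (f x))\<^sup>2 = (cmod (g x))\<^sup>2"
    using ae by eventually_elim simp
  have m: "(\<lambda>x. (cmod (g x))\<^sup>2) \<in> borel_measurable lebesgue"
    "(\<lambda>x. (cmod (f x))\<^sup>2) \<in> borel_measurable lebesgue"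
    using g L2_measurable[OF assms(2)] by measurable
  show "g \<in> L2"
    unfolding L2_iff using g integrable_cong_AE_imp[OF L2_sq_integrable[OF assms(2)] m(1)] ae2
    by (auto elim: eventually_mono)
  show "N2 g = N2 f"
    unfolding N2_eq using integral_cong_AE[OF m(2) m(1) ae2] by simp
qed

lemma L2_bound:
  assumes "g \<in> borel_measurable lebesgue" "integrable lebesgue h" "AE x in lebesgue. (cmod (g x))\<^sup>2 \<le> h x"
  shows "g \<in> L2" "(N2 g)\<^sup>2 \<le> integral\<^sup>L lebesgue h"
proof -
  have i: "integrable lebesgue (\<lambda>x. (cmod (g x))\<^sup>2)"
  proof (rule Bochner_Integration.integrable_bound[OF assms(2)])
    show "(\<lambda>x. (cmod (g x))\<^sup>2) \<in> borel_measurable lebesgue" using assms(1) by measurable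
    show "AE x in lebesgue. norm ((cmod (g x))\<^sup>2) \<le> norm (h x)"
      using assms(3) by eventually_elim auto
  qed
  then show "g \<in> L2" using assms(1) by (simp add: L2_iff)
  show "(N2 g)\<^sup>2 \<le> integral\<^sup>L lebesgue h"
    unfolding N2_sq by (rule integral_mono_AE[OF i assms(2,3)])
qed

lemma L2_mult_bounded:
  assumes "f \<in> L2" "m \<in> borel_measurable lebesgue" "AE x in lebesgue. cmod (m x) \<le> B" "0 \<le> B"
  shows "(\<lambda>x. m x * f x) \<in> L2" "N2 (\<lambda>x. m x * f x) \<le> B * N2 f"
proof -
  have meas: "(\<lambda>x. m x * f x) \<in> borel_measurable lebesgue"
    using assms(2) L2_measurable[OF assms(1)] by measurable
  have int: "integrable lebesgue (\<lambda>x. B\<^sup>2 * (cmod (f x))\<^sup>2)"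
    using L2_sq_integrable[OF assms(1)] by simp
  have ae: "AE x in lebesgue. (cmod (m x * f x))\<^sup>2 \<le> B\<^sup>2 * (cmod (f x))\<^sup>2"
    using assms(3)
  proof eventually_elim
    case (elim x)
    then show ?case by (simp add: norm_mult power_mult_distrib mult_right_mono power_mono)
  qed
  show "(\<lambda>x. m x * f x) \<in> L2" by (rule L2_bound(1)[OF meas int ae])
  have "(N2 (\<lambda>x. m x * f x))\<^sup>2 \<le> (B * N2 f)\<^sup>2"
    using L2_bound(2)[OF meas int ae] by (simp add: power_mult_distrib N2_sq)
  then show "N2 (\<lambda>x. m x * f x) \<le> B * N2 f"
    by (rule power2_le_imp_le) (use assms(4) in simp)
qed

lemma L2_scale: "f \<in> L2 \<Longrightarrow> (\<lambda>x. c * f x) \<in> L2"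
  by (rule L2_mult_bounded(1)[where B = "cmod c"]) auto

lemma N2_scale: "N2 (\<lambda>x. c * f x) = cmod c * N2 f"
  by (simp add: N2_eq norm_mult power_mult_distrib real_sqrt_mult)

lemma L2_uminus: "f \<in> L2 \<Longrightarrow> (\<lambda>x. - f x) \<in> L2"
  using L2_scale[of f "-1"] by simp

lemma N2_uminus: "N2 (\<lambda>x. - f x) = N2 f"
  by (simp add: N2_eq)

lemma L2_zero [simp]: "(\<lambda>x. 0) \<in> L2" and N2_zero [simp]: "N2 (\<lambda>x. 0) = 0"
  by (simp_all add: L2_iff N2_eq)

lemma L2_cnj: "f \<in> L2 \<Longrightarrow> (\<lambda>x. cnj (f x)) \<in> L2"
proof -
  assume f: "f \<in> L2"
  have "cnj \<in> borel_measurable borel"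
    by (intro borel_measurable_continuous_onI continuous_intros)
  from measurable_compose[OF L2_measurable[OF f] this] show ?thesis
    using L2_sq_integrable[OF f] by (simp add: L2_iff)
qed

lemma L2_add:
  assumes "f \<in> L2" "g \<in> L2"
  shows "(\<lambda>x. f x + g x) \<in> L2"
proof (rule L2_bound(1))
  show "(\<lambda>x. f x + g x) \<in> borel_measurable lebesgue"
    using L2_measurable[OF assms(1)] L2_measurable[OF assms(2)] by measurable
  show "integrable lebesgue (\<lambda>x. 2 * (cmod (f x))\<^sup>2 + 2 * (cmod (g x))\<^sup>2)"
    using L2_sq_integrable[OF assms(1)] L2_sq_integrable[OF assms(2)] by simp
  have "(cmod (f x + g x))\<^sup>2 \<le> 2 * (cmod (f x))\<^sup>2 + 2 * (cmod (g x))\<^sup>2" for x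
  proof -
    have "(cmod (f x + g x))\<^sup>2 \<le> (cmod (f x) + cmod (g x))\<^sup>2"
      by (intro power_mono norm_triangle_ineq) simp
    also have "\<dots> \<le> 2 * (cmod (f x))\<^sup>2 + 2 * (cmod (g x))\<^sup>2"
      using sum_squares_bound[of "cmod (f x)" "cmod (g x)"] by (simp add: power2_sum)
    finally show ?thesis .
  qed
  then show "AE x in lebesgue. (cmod (f x + g x))\<^sup>2 \<le> 2 * (cmod (f x))\<^sup>2 + 2 * (cmod (g x))\<^sup>2"
    by simp
qed

lemma L2_diff: "f \<in> L2 \<Longrightarrow> g \<in> L2 \<Longrightarrow> (\<lambda>x. f x - g x) \<in> L2"
  using L2_add[of f "\<lambda>x. - g x"] L2_uminus[of g] by simp

lemma L2_sum: "(\<And>i. i \<in> I \<Longrightarrow> f i \<in> L2) \<Longrightarrow> (\<lambda>x. \<Sum>i\<in>I. f i x) \<in> L2"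
  by (induction I rule: infinite_finite_induct) (auto intro: L2_add)

lemma L2_prod_integrable:
  assumes "f \<in> L2" "g \<in> L2"
  shows "integrable lebesgue (\<lambda>x. f x * g x)" "integrable lebesgue (\<lambda>x. cmod (f x) * cmod (g x))"
proof -
  have m: "(\<lambda>x. f x * g x) \<in> borel_measurable lebesgue"
    using L2_measurable[OF assms(1)] L2_measurable[OF assms(2)] by measurable
  have b: "cmod (f x) * cmod (g x) \<le> (cmod (f x))\<^sup>2 + (cmod (g x))\<^sup>2" for x
    using sum_squares_bound[of "cmod (f x)" "cmod (g x)"] mult_nonneg_nonneg[of "cmod (f x)" "cmod (g x)"]
    by (simp del: mult_nonneg_nonneg)
  show *: "integrable lebesgue (\<lambda>x. f x * g x)"
  proof (rule Bochner_Integration.integrable_bound[OF _ m])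
    show "integrable lebesgue (\<lambda>x. (cmod (f x))\<^sup>2 + (cmod (g x))\<^sup>2)"
      using L2_sq_integrable[OF assms(1)] L2_sq_integrable[OF assms(2)] by simp
    show "AE x in lebesgue. norm (f x * g x) \<le> norm ((cmod (f x))\<^sup>2 + (cmod (g x))\<^sup>2)"
      using b by (simp add: norm_mult)
  qed
  show "integrable lebesgue (\<lambda>x. cmod (f x) * cmod (g x))"
    using integrable_norm[OF *] by (simp add: norm_mult)
qed

lemma L2_Cauchy_Schwarz:
  assumes "f \<in> L2" "g \<in> L2"
  shows "integral\<^sup>L lebesgue (\<lambda>x. cmod (f x) * cmod (g x)) \<le> N2 f * N2 g"
    and "cmod (integral\<^sup>L lebesgue (\<lambda>x. f x * g x)) \<le> N2 f * N2 g"
proof -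
  define I where "I = integral\<^sup>L lebesgue (\<lambda>x. cmod (f x) * cmod (g x))"
  note i = L2_sq_integrable[OF assms(1)] L2_sq_integrable[OF assms(2)] L2_prod_integrable(2)[OF assms]
  have I0: "0 \<le> I" unfolding I_def by simp
  \<comment> \<open>The inequality (t |f| - |g|)^2 \<ge> 0, integrated. The minimising t, which is I
    / (N2 f)^2, gives the claim; if \<open>N2 f\<close> is zero, the left side is linear in t and
    the right side constant, which forces I = 0.\<close>
  have q: "2 * t * I \<le> t\<^sup>2 * (N2 f)\<^sup>2 + (N2 g)\<^sup>2" for t
  proof -
    have "integral\<^sup>L lebesgue (\<lambda>x. 2 * t * (cmod (f x) * cmod (g x)))
        \<le> integral\<^sup>L lebesgue (\<lambda>x. t\<^sup>2 * (cmod (f x))\<^sup>2 + (cmod (g x))\<^sup>2)"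
    proof (rule integral_mono)
      show "2 * t * (cmod (f x) * cmod (g x)) \<le> t\<^sup>2 * (cmod (f x))\<^sup>2 + (cmod (g x))\<^sup>2" for x
        using sum_squares_bound[of "t * cmod (f x)" "cmod (g x)"] by (simp add: power_mult_distrib mult.assoc)
    qed (use i in auto)
    then show ?thesis using i by (simp add: I_def N2_sq)
  qed
  have "I\<^sup>2 \<le> (N2 f * N2 g)\<^sup>2"
  proof (cases "N2 f = 0")
    case True
    have "I \<le> 0"
    proof (rule ccontr)
      assume "\<not> I \<le> 0"
      then show False using q[of "((N2 g)\<^sup>2 + 1) / (2 * I)"] True by (simp add: field_simps)
    qed
    then show ?thesis using I0 True by simp
  next
    case False
    define A where "A = (N2 f)\<^sup>2"
    have A: "A > 0" using False by (simp add: A_def)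
    have "2 * (I / A) * I \<le> (I / A)\<^sup>2 * A + (N2 g)\<^sup>2" unfolding A_def by (rule q)
    moreover have "2 * (I / A) * I = 2 * (I\<^sup>2 / A)" "(I / A)\<^sup>2 * A = I\<^sup>2 / A"
      using A by (simp_all add: power2_eq_square)
    ultimately have "I\<^sup>2 / A \<le> (N2 g)\<^sup>2" by linarith
    then have "I\<^sup>2 \<le> A * (N2 g)\<^sup>2" using A by (simp add: divide_le_eq mult.commute)
    then show ?thesis by (simp add: A_def power_mult_distrib)
  qed
  then show 1: "I \<le> N2 f * N2 g" by (rule power2_le_imp_le) simp
  have "cmod (integral\<^sup>L lebesgue (\<lambda>x. f x * g x)) \<le> integral\<^sup>L lebesgue (\<lambda>x. cmod (f x * g x))"
    by (rule integral_norm_bound)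
  then show "cmod (integral\<^sup>L lebesgue (\<lambda>x. f x * g x)) \<le> N2 f * N2 g"
    using 1 by (simp add: I_def norm_mult)
qed

lemma N2_triangle:
  assumes "f \<in> L2" "g \<in> L2"
  shows "N2 (\<lambda>x. f x + g x) \<le> N2 f + N2 g"
proof (rule power2_le_imp_le)
  note i = L2_sq_integrable[OF assms(1)] L2_sq_integrable[OF assms(2)] L2_prod_integrable(2)[OF assms]
  have "(N2 (\<lambda>x. f x + g x))\<^sup>2
      \<le> integral\<^sup>L lebesgue (\<lambda>x. (cmod (f x))\<^sup>2 + 2 * (cmod (f x) * cmod (g x)) + (cmod (g x))\<^sup>2)"
    unfolding N2_sq
  proof (rule integral_mono)
    show "(cmod (f x + g x))\<^sup>2 \<le> (cmod (f x))\<^sup>2 + 2 * (cmod (f x) * cmod (g x)) + (cmod (g x))\<^sup>2" for x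
    proof -
      have "(cmod (f x + g x))\<^sup>2 \<le> (cmod (f x) + cmod (g x))\<^sup>2"
        by (intro power_mono norm_triangle_ineq) simp
      then show ?thesis by (simp add: power2_sum)
    qed
  qed (use i L2_sq_integrable[OF L2_add[OF assms]] in auto)
  also have "\<dots> = (N2 f)\<^sup>2 + 2 * integral\<^sup>L lebesgue (\<lambda>x. cmod (f x) * cmod (g x)) + (N2 g)\<^sup>2"
    using i by (simp add: N2_sq)
  also have "\<dots> \<le> (N2 f)\<^sup>2 + 2 * (N2 f * N2 g) + (N2 g)\<^sup>2"
    using L2_Cauchy_Schwarz(1)[OF assms] by simp
  also have "\<dots> = (N2 f + N2 g)\<^sup>2" by (simp add: power2_sum)
  finally show "(N2 (\<lambda>x. f x + g x))\<^sup>2 \<le> (N2 f + N2 g)\<^sup>2" .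
qed simp

lemma N2_triangle_diff:
  assumes "f \<in> L2" "g \<in> L2"
  shows "N2 (\<lambda>x. f x - g x) \<le> N2 f + N2 g"
  using N2_triangle[OF assms(1) L2_uminus[OF assms(2)]] by (simp add: N2_uminus)

lemma N2_triangle_rev:
  assumes "f \<in> L2" "g \<in> L2"
  shows "N2 f - N2 g \<le> N2 (\<lambda>x. f x + g x)"
  using N2_triangle_diff[OF L2_add[OF assms] assms(2)] by simp

lemma N2_sum_le: "(\<And>i. i \<in> I \<Longrightarrow> f i \<in> L2) \<Longrightarrow> N2 (\<lambda>x. \<Sum>i\<in>I. f i x) \<le> (\<Sum>i\<in>I. N2 (f i))"
proof (induction I rule: infinite_finite_induct)
  case (insert i I)
  then have "N2 (\<lambda>x. f i x + (\<Sum>i\<in>I. f i x)) \<le> N2 (f i) + N2 (\<lambda>x. \<Sum>i\<in>I. f i x)"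
    by (intro N2_triangle L2_sum) auto
  then show ?case using insert by fastforce
qed simp_all

lemma N2_eq_0_imp:
  assumes "f \<in> L2" "N2 f = 0"
  shows "ae_eq UNIV f (\<lambda>x. 0)"
proof -
  have "integral\<^sup>L lebesgue (\<lambda>x. (cmod (f x))\<^sup>2) = 0" using assms(2) N2_sq[of f] by simp
  then have "AE x in lebesgue. (cmod (f x))\<^sup>2 = 0"
    using integral_nonneg_eq_0_iff_AE[OF L2_sq_integrable[OF assms(1)]] by simp
  then show ?thesis unfolding ae_eq_UNIV_iff by eventually_elim simp
qed

section \<open>Completeness of the space of square-integrable functions\<close>

lemma nn_integral_sq_N2: "f \<in> L2 \<Longrightarrow> (\<integral>\<^sup>+x. ennreal ((cmod (f x))\<^sup>2) \<partial>lebesgue) = ennreal ((N2 f)\<^sup>2)"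
  unfolding N2_sq by (rule nn_integral_eq_integral[OF L2_sq_integrable]) auto

lemma L2_Fatou:
  assumes h: "\<And>m. h m \<in> L2" "\<And>m. N2 (h m) \<le> c" and lim: "AE x in lebesgue. (\<lambda>m. h m x) \<longlonglongrightarrow> g x"
    and g: "g \<in> borel_measurable lebesgue"
  shows "g \<in> L2" "N2 g \<le> c"
proof -
  have c: "0 \<le> c" using h(2)[of 0] L2_norm_nonneg[of UNIV "h 0"] by linarith
  have "(\<integral>\<^sup>+x. ennreal ((cmod (g x))\<^sup>2) \<partial>lebesgue) = (\<integral>\<^sup>+x. liminf (\<lambda>m. ennreal ((cmod (h m x))\<^sup>2)) \<partial>lebesgue)"
  proof (rule nn_integral_cong_AE)
    show "AE x in lebesgue. ennreal ((cmod (g x))\<^sup>2) = liminf (\<lambda>m. ennreal ((cmod (h m x))\<^sup>2))"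
      using lim
    proof eventually_elim
      case (elim x)
      then have "(\<lambda>m. ennreal ((cmod (h m x))\<^sup>2)) \<longlonglongrightarrow> ennreal ((cmod (g x))\<^sup>2)"
        by (intro tendsto_intros)
      then show ?case by (intro lim_imp_Liminf[symmetric]) auto
    qed
  qed
  also have "\<dots> \<le> liminf (\<lambda>m. \<integral>\<^sup>+x. ennreal ((cmod (h m x))\<^sup>2) \<partial>lebesgue)"
  proof (rule nn_integral_liminf)
    show "(\<lambda>x. ennreal ((cmod (h m x))\<^sup>2)) \<in> borel_measurable lebesgue" for m
      using L2_measurable[OF h(1)[of m]] by measurable
  qed
  also have "\<dots> \<le> liminf (\<lambda>m. ennreal (c\<^sup>2))"
    using h by (intro Liminf_mono always_eventually) (auto simp: nn_integral_sq_N2 intro!: ennreal_leI power_mono)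
  also have "\<dots> = ennreal (c\<^sup>2)" by (simp add: Liminf_const)
  finally have le: "(\<integral>\<^sup>+x. ennreal ((cmod (g x))\<^sup>2) \<partial>lebesgue) \<le> ennreal (c\<^sup>2)" .
  have "integrable lebesgue (\<lambda>x. (cmod (g x))\<^sup>2)"
  proof (rule integrableI_bounded)
    show "(\<lambda>x. (cmod (g x))\<^sup>2) \<in> borel_measurable lebesgue" using g by measurable
    show "(\<integral>\<^sup>+x. ennreal (norm ((cmod (g x))\<^sup>2)) \<partial>lebesgue) < \<infinity>"
      using le by (auto simp: top.not_eq_extremum[symmetric] top_unique)
  qed
  then show gL: "g \<in> L2" using g by (simp add: L2_iff)
  have "(N2 g)\<^sup>2 \<le> c\<^sup>2" using le nn_integral_sq_N2[OF gL] by simp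
  then show "N2 g \<le> c" using c by (rule power2_le_imp_le)
qed

text \<open>The weight 2^k splits the decay in two: the weighted squares still have summable
  integrals, so almost everywhere they are bounded in k, and |f k x| decays like 2^(-k/2).\<close>

lemma L2_geometric_AE_summable:
  assumes f: "\<And>k. f k \<in> L2" "\<And>k. N2 (f k) \<le> B * (1/2) ^ k"
  shows "AE x in lebesgue. summable (\<lambda>k. f k x)"
proof -
  have B: "0 \<le> B" using order_trans[OF L2_norm_nonneg f(2)[of 0]] by simp
  have m: "(\<lambda>x. ennreal (2 ^ k * (cmod (f k x))\<^sup>2)) \<in> borel_measurable lebesgue" for k
    using L2_measurable[OF f(1)[of k]] by measurable
  have bnd: "(\<integral>\<^sup>+x. ennreal (2 ^ k * (cmod (f k x))\<^sup>2) \<partial>lebesgue) \<le> ennreal (B\<^sup>2 * (1/2) ^ k)" for k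
  proof -
    have "(\<integral>\<^sup>+x. ennreal (2 ^ k * (cmod (f k x))\<^sup>2) \<partial>lebesgue) = ennreal (2 ^ k) * ennreal ((N2 (f k))\<^sup>2)"
      using L2_measurable[OF f(1)[of k]]
      by (simp add: ennreal_mult nn_integral_cmult nn_integral_sq_N2[OF f(1), symmetric])
    also have "\<dots> = ennreal (2 ^ k * (N2 (f k))\<^sup>2)" by (simp add: ennreal_mult)
    also have "\<dots> \<le> ennreal (2 ^ k * (B * (1/2) ^ k)\<^sup>2)"
      by (intro ennreal_leI mult_left_mono power_mono f(2)) auto
    also have "2 ^ k * (B * (1/2) ^ k)\<^sup>2 = B\<^sup>2 * (1/2) ^ k"
      by (simp add: power_mult_distrib power2_eq_square power_divide)
    finally show ?thesis .
  qed
  have "(\<integral>\<^sup>+x. (\<Sum>k. ennreal (2 ^ k * (cmod (f k x))\<^sup>2)) \<partial>lebesgue)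
      = (\<Sum>k. \<integral>\<^sup>+x. ennreal (2 ^ k * (cmod (f k x))\<^sup>2) \<partial>lebesgue)"
    by (rule nn_integral_suminf[OF m])
  also have "\<dots> \<le> (\<Sum>k. ennreal (B\<^sup>2 * (1/2) ^ k))"
    by (intro suminf_le bnd) auto
  also have "\<dots> = ennreal (\<Sum>k. B\<^sup>2 * (1/2) ^ k)"
    by (intro suminf_ennreal2) (auto intro!: summable_mult summable_geometric)
  finally have fin: "(\<integral>\<^sup>+x. (\<Sum>k. ennreal (2 ^ k * (cmod (f k x))\<^sup>2)) \<partial>lebesgue) \<noteq> \<infinity>"
    by (auto simp: top_unique)
  have "AE x in lebesgue. (\<Sum>k. ennreal (2 ^ k * (cmod (f k x))\<^sup>2)) \<noteq> \<infinity>"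
    by (rule nn_integral_PInf_AE[OF _ fin]) (use m in measurable)
  then show ?thesis
  proof eventually_elim
    case (elim x)
    then have "summable (\<lambda>k. 2 ^ k * (cmod (f k x))\<^sup>2)"
      by (intro summable_suminf_not_top) auto
    then have "Bseq (\<lambda>k. 2 ^ k * (cmod (f k x))\<^sup>2)"
      by (intro convergent_imp_Bseq convergentI[of _ 0] summable_LIMSEQ_zero)
    then obtain K where K: "K > 0" "\<And>k. 2 ^ k * (cmod (f k x))\<^sup>2 \<le> K"
      by (auto simp: Bseq_def)
    have b: "cmod (f k x) \<le> sqrt K * (sqrt (1/2)) ^ k" for k
    proof (rule power2_le_imp_le)
      have "(cmod (f k x))\<^sup>2 \<le> K * (1/2) ^ k"
        using K(2)[of k] by (simp add: field_simps)
      also have "\<dots> = (sqrt K * (sqrt (1/2)) ^ k)\<^sup>2"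
      proof -
        have "((sqrt (1/2)) ^ k)\<^sup>2 = ((sqrt (1/2))\<^sup>2) ^ k"
          by (simp only: power_mult[symmetric] mult.commute)
        then have "((sqrt (1/2)) ^ k)\<^sup>2 = (1/2 :: real) ^ k"
          by simp
        then show ?thesis using K(1) by (simp add: power_mult_distrib)
      qed
      finally show "(cmod (f k x))\<^sup>2 \<le> (sqrt K * (sqrt (1/2)) ^ k)\<^sup>2" .
    qed (use K(1) in simp)
    have "sqrt (1/2) < (1::real)" by (rule real_less_lsqrt) auto
    then have "summable (\<lambda>k. sqrt K * (sqrt (1/2)) ^ k)"
      by (intro summable_mult summable_geometric) simp
    then show "summable (\<lambda>k. f k x)"
      by (rule summable_comparison_test'[where N = 0]) (use b in simp)
  qed
qed

text \<open>The limit is taken pointwise; on the null set of divergence \<open>lim\<close> yields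
  some value. Fatou's lemma carries the estimate of finite tails over to the infinite tail.\<close>

lemma L2_complete_geometric:
  assumes f: "\<And>k. f k \<in> L2" "\<And>k. N2 (f k) \<le> B * (1/2) ^ k"
  obtains g where "g \<in> L2" "\<And>n. N2 (\<lambda>x. g x - (\<Sum>k<n. f k x)) \<le> 2 * B * (1/2) ^ n"
proof -
  define g where "g x = lim (\<lambda>n. \<Sum>k<n. f k x)" for x
  have mS: "(\<lambda>x. \<Sum>k<n. f k x) \<in> borel_measurable lebesgue" for n
    using L2_measurable[OF f(1)] by measurable
  have g: "g \<in> borel_measurable lebesgue"
    unfolding g_def[abs_def] using mS by (rule borel_measurable_lim_metric)
  have conv: "AE x in lebesgue. (\<lambda>n. \<Sum>k<n. f k x) \<longlonglongrightarrow> g x"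
    using L2_geometric_AE_summable[OF f]
  proof eventually_elim
    case (elim x)
    then show ?case
      unfolding g_def by (simp add: convergent_LIMSEQ_iff[symmetric] summable_iff_convergent)
  qed
  have key: "(\<lambda>x. g x - (\<Sum>k<n. f k x)) \<in> L2 \<and> N2 (\<lambda>x. g x - (\<Sum>k<n. f k x)) \<le> 2 * B * (1/2) ^ n" for n
  proof -
    define h where "h m x = (\<Sum>k=n..<n+m. f k x)" for m x
    have B: "0 \<le> B" using order_trans[OF L2_norm_nonneg f(2)[of 0]] by simp
    have 1: "h m \<in> L2" for m unfolding h_def[abs_def] by (rule L2_sum) (rule f)
    have 2: "N2 (h m) \<le> 2 * B * (1/2) ^ n" for m
    proof -
      have "N2 (h m) \<le> (\<Sum>k=n..<n+m. N2 (f k))"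
        unfolding h_def[abs_def] by (rule N2_sum_le) (rule f)
      also have "\<dots> \<le> (\<Sum>k=n..<n+m. B * (1/2) ^ k)" by (intro sum_mono f)
      also have "\<dots> = (\<Sum>k<m. B * (1/2) ^ (n + k))"
        using sum.shift_bounds_nat_ivl[of "\<lambda>k. B * (1/2) ^ k" 0 n m]
        by (simp add: lessThan_atLeast0 add.commute)
      also have "\<dots> = B * (1/2) ^ n * (\<Sum>k<m. (1/2) ^ k)"
        by (simp add: power_add sum_distrib_left mult.assoc)
      also have "\<dots> \<le> B * (1/2) ^ n * 2"
        by (intro mult_left_mono) (use B in \<open>auto simp: sum_gp_strict\<close>)
      finally show ?thesis by simp
    qed
    have 3: "AE x in lebesgue. (\<lambda>m. h m x) \<longlonglongrightarrow> g x - (\<Sum>k<n. f k x)"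
      using conv
    proof eventually_elim
      case (elim x)
      have "h m x = (\<Sum>k<m+n. f k x) - (\<Sum>k<n. f k x)" for m
        using sum.atLeastLessThan_concat[of 0 n "n+m" "\<lambda>k. f k x"]
        by (simp add: h_def lessThan_atLeast0 add.commute algebra_simps)
      then show ?case
        using tendsto_diff[OF LIMSEQ_ignore_initial_segment[OF elim, of n] tendsto_const] by simp
    qed
    have 4: "(\<lambda>x. g x - (\<Sum>k<n. f k x)) \<in> borel_measurable lebesgue" using g mS by measurable
    show ?thesis using L2_Fatou[OF 1 2 3 4] by blast
  qed
  show ?thesis using that[of g] key key[of 0] by simp
qed

section \<open>The Sobolev space on the line\<close>

text \<open>A function with its first and second derivative, related by genuine integrals. The first
  two components are continuous; the third is fixed only almost everywhere.\<close>

definition W22_repr :: "(real \<Rightarrow> complex) \<Rightarrow> (real \<Rightarrow> complex) \<Rightarrow> (real \<Rightarrow> complex) \<Rightarrow> bool" where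
  "W22_repr U V W \<longleftrightarrow> abs_cont U V \<and> abs_cont V W \<and> U \<in> L2 \<and> V \<in> L2 \<and> W \<in> L2"

lemma W22_reprD:
  assumes "W22_repr U V W"
  shows "abs_cont U V" "abs_cont V W" "U \<in> L2" "V \<in> L2" "W \<in> L2"
  using assms by (auto simp: W22_repr_def)

lemma W22_repr_lincomb:
  "W22_repr U V W \<Longrightarrow> W22_repr U' V' W' \<Longrightarrow>
    W22_repr (\<lambda>x. c * U x + d * U' x) (\<lambda>x. c * V x + d * V' x) (\<lambda>x. c * W x + d * W' x)"
  by (auto simp: W22_repr_def intro!: abs_cont_lincomb L2_add L2_scale)

definition repr_norm :: "(real \<Rightarrow> complex) \<Rightarrow> (real \<Rightarrow> complex) \<Rightarrow> (real \<Rightarrow> complex) \<Rightarrow> real" where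
  "repr_norm U V W = sqrt ((N2 U)\<^sup>2 + (N2 V)\<^sup>2 + (N2 W)\<^sup>2)"

abbreviation (input) W22R :: "(real \<Rightarrow> complex) set" where "W22R \<equiv> W22 UNIV"
abbreviation (input) Wnorm :: "(real \<Rightarrow> complex) \<Rightarrow> real" where "Wnorm \<equiv> W22_norm UNIV"

lemma W22_repr_imp_W22:
  assumes t: "W22_repr U V W" and u: "ae_eq UNIV u U"
  shows "u \<in> W22R" "ae_eq UNIV (weak_deriv UNIV u) V"
    "ae_eq UNIV (weak_deriv UNIV (weak_deriv UNIV u)) W" "Wnorm u = repr_norm U V W"
proof -
  note T = W22_reprD[OF t]
  have uL: "u \<in> L2" "N2 u = N2 U" using L2_cong[OF ae_eq_sym[OF u] T(3)] by auto
  have w1: "has_weak_deriv UNIV u V"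
    by (rule has_weak_deriv_cong[OF abs_cont_imp_weak_deriv[OF T(1) open_UNIV] ae_eq_sym[OF u]]) auto
  have w2: "has_weak_deriv UNIV V W" by (rule abs_cont_imp_weak_deriv[OF T(2) open_UNIV])
  show "u \<in> W22R" unfolding W22_def using uL w1 w2 T by blast
  show v: "ae_eq UNIV (weak_deriv UNIV u) V" by (rule weak_deriv_ae_eq(2)[OF w1 open_UNIV])
  have "has_weak_deriv UNIV (weak_deriv UNIV u) W"
    by (rule has_weak_deriv_cong[OF w2 ae_eq_sym[OF v]]) auto
  then show w: "ae_eq UNIV (weak_deriv UNIV (weak_deriv UNIV u)) W"
    by (rule weak_deriv_ae_eq(2)[OF _ open_UNIV])
  show "Wnorm u = repr_norm U V W"
    using uL(2) L2_cong(2)[OF ae_eq_sym[OF v] T(4)] L2_cong(2)[OF ae_eq_sym[OF w] T(5)]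
    by (simp add: W22_norm_def repr_norm_def)
qed

lemma W22_obtain_repr:
  assumes "u \<in> W22R"
  obtains U V W where "W22_repr U V W" "ae_eq UNIV u U"
proof -
  obtain v w where vw: "u \<in> L2" "v \<in> L2" "w \<in> L2" "has_weak_deriv UNIV u v" "has_weak_deriv UNIV v w"
    using assms by (auto simp: W22_def)
  \<comment> \<open>The derivative is regularised before the function, because \<open>U\<close>
    needs the continuous \<open>V\<close>, not just \<open>v\<close>, as its derivative.\<close>
  obtain V where V: "abs_cont V w" "ae_eq UNIV v V" by (rule weak_deriv_imp_abs_cont[OF vw(5)])
  have "has_weak_deriv UNIV u V" by (rule has_weak_deriv_cong[OF vw(4) _ V(2)]) auto
  then obtain U where U: "abs_cont U V" "ae_eq UNIV u U" by (rule weak_deriv_imp_abs_cont)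
  have "W22_repr U V w"
    using U V vw L2_cong(1)[OF U(2) vw(1)] L2_cong(1)[OF V(2) vw(2)] by (auto simp: W22_repr_def)
  then show ?thesis using that U(2) by blast
qed

lemma W22_lincomb:
  assumes "u \<in> W22R" "v \<in> W22R"
  shows "(\<lambda>x. c * u x + d * v x) \<in> W22R"
proof -
  obtain U V W where 1: "W22_repr U V W" "ae_eq UNIV u U" by (rule W22_obtain_repr[OF assms(1)])
  obtain U' V' W' where 2: "W22_repr U' V' W'" "ae_eq UNIV v U'" by (rule W22_obtain_repr[OF assms(2)])
  have "ae_eq UNIV (\<lambda>x. c * u x + d * v x) (\<lambda>x. c * U x + d * U' x)"
    using 1(2) 2(2) unfolding ae_eq_UNIV_iff by eventually_elim simp
  then show ?thesis using W22_repr_imp_W22(1)[OF W22_repr_lincomb[OF 1(1) 2(1)]] by blast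
qed

lemma W22_add: "u \<in> W22R \<Longrightarrow> v \<in> W22R \<Longrightarrow> (\<lambda>x. u x + v x) \<in> W22R"
  using W22_lincomb[of u v 1 1] by simp

lemma W22_diff: "u \<in> W22R \<Longrightarrow> v \<in> W22R \<Longrightarrow> (\<lambda>x. u x - v x) \<in> W22R"
  using W22_lincomb[of u v 1 "-1"] by simp

lemma W22_scale: "u \<in> W22R \<Longrightarrow> (\<lambda>x. c * u x) \<in> W22R"
  using W22_lincomb[of u u c 0] by simp

lemma W22_L2: "u \<in> W22R \<Longrightarrow> u \<in> L2"
  by (simp add: W22_def)

lemma W22_zero: "(\<lambda>x. 0) \<in> W22R"
proof -
  have "W22_repr (\<lambda>x. 0) (\<lambda>x. 0) (\<lambda>x. 0)"
    by (auto simp: W22_repr_def intro!: abs_cont_C1)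
  then show ?thesis by (rule W22_repr_imp_W22(1)) simp
qed

lemma W22_sum: "(\<And>i. i \<in> I \<Longrightarrow> f i \<in> W22R) \<Longrightarrow> (\<lambda>x. \<Sum>i\<in>I. f i x) \<in> W22R"
  by (induction I rule: infinite_finite_induct) (auto intro: W22_add W22_zero)

lemma Wnorm_nonneg [simp]: "0 \<le> Wnorm u"
  by (simp add: W22_norm_def)

lemma N2_le_Wnorm: "N2 u \<le> Wnorm u"
  unfolding W22_norm_def by (rule real_le_rsqrt) simp

section \<open>Linear operators and the method of continuity\<close>

abbreviation (input) lin_op :: "((real \<Rightarrow> complex) \<Rightarrow> (real \<Rightarrow> complex)) \<Rightarrow> bool" where
  "lin_op \<equiv> linear_W22_L2 UNIV"

lemma lin_opD:
  assumes "lin_op A" "u \<in> W22R"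
  shows "A u \<in> L2"
    and "v \<in> W22R \<Longrightarrow> ae_eq UNIV u v \<Longrightarrow> AE x in lebesgue. A u x = A v x"
    and "v \<in> W22R \<Longrightarrow> AE x in lebesgue. A (\<lambda>x. u x + v x) x = A u x + A v x"
    and "AE x in lebesgue. A (\<lambda>x. c * u x) x = c * A u x"
  using assms by (auto simp: linear_W22_L2_def ae_eq_UNIV_iff)

lemma lin_op_diff:
  assumes A: "lin_op A" and u: "u \<in> W22R" and v: "v \<in> W22R"
  shows "AE x in lebesgue. A (\<lambda>x. u x - v x) x = A u x - A v x"
proof -
  have "AE x in lebesgue. A (\<lambda>x. u x + (-1) * v x) x = A u x + A (\<lambda>x. (-1) * v x) x"
    by (rule lin_opD(3)[OF A u W22_scale[OF v]])
  then show ?thesis using lin_opD(4)[OF A v, of "-1"] by eventually_elim simp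
qed

lemma lin_op_sum:
  assumes A: "lin_op A" and u: "\<And>k. u k \<in> W22R"
  shows "AE x in lebesgue. A (\<lambda>x. \<Sum>k<n. u k x) x = (\<Sum>k<(n::nat). A (u k) x)"
proof (induction n)
  case 0
  show ?case using lin_opD(4)[OF A W22_zero, of 0] by simp
next
  case (Suc n)
  have "AE x in lebesgue. A (\<lambda>x. (\<Sum>k<n. u k x) + u n x) x = A (\<lambda>x. \<Sum>k<n. u k x) x + A (u n) x"
    by (rule lin_opD(3)[OF A W22_sum]) (use u in auto)
  then show ?case using Suc.IH by eventually_elim simp
qed

lemma lin_op_lincomb:
  assumes A: "lin_op A" and B: "lin_op B"
  shows "lin_op (\<lambda>u x. A u x + c * B u x)"
  unfolding linear_W22_L2_def
proof (intro conjI ballI impI allI)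
  fix u assume u: "u \<in> W22R"
  show "(\<lambda>x. A u x + c * B u x) \<in> L2"
    by (intro L2_add L2_scale lin_opD(1)[OF A u] lin_opD(1)[OF B u])
  show "ae_eq UNIV (\<lambda>x. A (\<lambda>x. d * u x) x + c * B (\<lambda>x. d * u x) x) (\<lambda>x. d * (A u x + c * B u x))" for d
    using lin_opD(4)[OF A u, of d] lin_opD(4)[OF B u, of d] unfolding ae_eq_UNIV_iff
    by eventually_elim (simp add: algebra_simps)
  fix v assume v: "v \<in> W22R"
  show "ae_eq UNIV (\<lambda>x. A (\<lambda>x. u x + v x) x + c * B (\<lambda>x. u x + v x) x)
      (\<lambda>x. (A u x + c * B u x) + (A v x + c * B v x))"
    using lin_opD(3)[OF A u v] lin_opD(3)[OF B u v] unfolding ae_eq_UNIV_iff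
    by eventually_elim (simp add: algebra_simps)
  assume "ae_eq UNIV u v"
  then show "ae_eq UNIV (\<lambda>x. A u x + c * B u x) (\<lambda>x. A v x + c * B v x)"
    using lin_opD(2)[OF A u v] lin_opD(2)[OF B u v] unfolding ae_eq_UNIV_iff
    by (auto elim: eventually_elim2)
qed

definition onto_op :: "((real \<Rightarrow> complex) \<Rightarrow> (real \<Rightarrow> complex)) \<Rightarrow> bool" where
  "onto_op A \<longleftrightarrow> (\<forall>f\<in>L2. \<exists>u\<in>W22R. ae_eq UNIV (A u) f)"

text \<open>The Neumann series is summed on the side of the right-hand sides, so that only the completeness
  of the Lebesgue space is needed.\<close>
lemma onto_op_perturb:
  assumes A: "lin_op A" and B: "lin_op B"
    and low: "\<And>u. u \<in> W22R \<Longrightarrow> c * Wnorm u \<le> N2 (A u)"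
    and small: "\<And>u. u \<in> W22R \<Longrightarrow> N2 (B u) \<le> c / 2 * Wnorm u"
    and onto: "onto_op A"
  shows "onto_op (\<lambda>u x. A u x + B u x)"
  unfolding onto_op_def
proof
  fix f :: "real \<Rightarrow> complex" assume f: "f \<in> L2"
  \<comment> \<open>A right inverse of \<open>A\<close> by choice. It need not be linear, so the
    identities below rest on the linearity of \<open>A\<close> and \<open>B\<close> only.\<close>
  define R where "R h = (SOME u. u \<in> W22R \<and> ae_eq UNIV (A u) h)" for h
  have R: "R h \<in> W22R" "ae_eq UNIV (A (R h)) h" if "h \<in> L2" for h
    using someI_ex[of "\<lambda>u. u \<in> W22R \<and> ae_eq UNIV (A u) h"] onto that
    by (auto simp: R_def onto_op_def)
  \<comment> \<open>The terms of the Neumann series, obtained by iterating - B R on f. The constant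
    c / 2 in the smallness hypothesis makes the ratio 1/2.\<close>
  define F where "F = rec_nat f (\<lambda>_ h x. - B (R h) x)"
  have F0: "F 0 = f" and FS: "\<And>k. F (Suc k) = (\<lambda>x. - B (R (F k)) x)" by (simp_all add: F_def)
  have FL: "F k \<in> L2" for k
    by (induction k) (auto simp: F0 FS f intro!: L2_uminus lin_opD(1)[OF B] R(1))
  have half: "N2 (B u) \<le> N2 (A u) / 2" if "u \<in> W22R" for u
    using low[OF that] small[OF that] by simp
  have NF: "N2 (F k) \<le> N2 f * (1/2) ^ k" for k
  proof (induction k)
    case (Suc k)
    have "N2 (F (Suc k)) = N2 (B (R (F k)))" by (simp add: FS N2_uminus)
    also have "\<dots> \<le> N2 (A (R (F k))) / 2" by (rule half[OF R(1)[OF FL]])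
    also have "N2 (A (R (F k))) = N2 (F k)" by (rule L2_cong(2)[OF ae_eq_sym[OF R(2)[OF FL]] FL])
    finally show ?case using Suc.IH by simp
  qed (simp add: F0)
  obtain g where g: "g \<in> L2" "\<And>n. N2 (\<lambda>x. g x - (\<Sum>k<n. F k x)) \<le> 2 * N2 f * (1/2) ^ n"
    using L2_complete_geometric[OF FL NF] by blast
  define u where "u = R g"
  have u: "u \<in> W22R" "ae_eq UNIV (A u) g" using R[OF g(1)] by (auto simp: u_def)
  define Sn where "Sn n x = (\<Sum>k<n. R (F k) x)" for n x
  have Sn: "Sn n \<in> W22R" for n unfolding Sn_def[abs_def] by (rule W22_sum) (rule R(1)[OF FL])
  \<comment> \<open>The residual does not depend on n, yet for every n it is bounded by a constant
    times 2^(-n). This avoids limits inside \<open>A\<close> and \<open>B\<close>.\<close>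
  define E where "E x = A u x + B u x - f x" for x
  have EL: "E \<in> L2" unfolding E_def[abs_def]
    by (intro L2_diff L2_add f lin_opD(1)[OF A u(1)] lin_opD(1)[OF B u(1)])
  have "N2 E \<le> 4 * N2 f * (1/2) ^ n" for n
  proof -
    define d where "d x = u x - Sn n x" for x
    have d: "d \<in> W22R" unfolding d_def[abs_def] by (rule W22_diff[OF u(1) Sn])
    have Ad: "AE x in lebesgue. A d x = g x - (\<Sum>k<n. F k x)"
    proof -
      have "AE x in lebesgue. \<forall>k\<in>{..<n}. A (R (F k)) x = F k x"
        using R(2)[OF FL] by (intro AE_finite_allI) (auto simp: ae_eq_UNIV_iff)
      moreover note lin_op_diff[OF A u(1) Sn[of n]] lin_op_sum[OF A, of "\<lambda>k. R (F k)" n, OF R(1)[OF FL]]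
      moreover have "AE x in lebesgue. A u x = g x" using u(2) by (simp add: ae_eq_UNIV_iff)
      ultimately show ?thesis
        by eventually_elim (simp add: d_def[abs_def] Sn_def[abs_def])
    qed
    have Bd: "AE x in lebesgue. B d x = B u x - (\<Sum>k<n. B (R (F k)) x)"
    proof -
      note lin_op_diff[OF B u(1) Sn[of n]] lin_op_sum[OF B, of "\<lambda>k. R (F k)" n, OF R(1)[OF FL]]
      then show ?thesis
        by eventually_elim (simp add: d_def[abs_def] Sn_def[abs_def])
    qed
    have "AE x in lebesgue. E x = (A d x + B d x) - F n x"
    proof -
      have "AE x in lebesgue. A u x = g x" using u(2) by (simp add: ae_eq_UNIV_iff)
      then show ?thesis using Ad Bd
      proof eventually_elim
        case (elim x)
        \<comment> \<open>Shifting the index by one turns all terms but \<open>F 0 = f\<close> into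
          values of \<open>B\<close>.\<close>
        have "(\<Sum>k<n. F k x) + F n x = f x - (\<Sum>k<n. B (R (F k)) x)"
          by (induction n) (simp_all add: F0 FS)
        then have c: "f x = (\<Sum>k<n. F k x) + F n x + (\<Sum>k<n. B (R (F k)) x)" by (simp add: algebra_simps)
        have a: "A u x = A d x + (\<Sum>k<n. F k x)" using elim by simp
        have b: "B u x = B d x + (\<Sum>k<n. B (R (F k)) x)" using elim by simp
        show ?case unfolding E_def a b c by simp
      qed
    qed
    then have "ae_eq UNIV E (\<lambda>x. (A d x + B d x) - F n x)" by (simp add: ae_eq_UNIV_iff)
    then have "N2 E = N2 (\<lambda>x. (A d x + B d x) - F n x)" by (rule L2_cong(2)[OF _ EL, symmetric])
    also have "\<dots> \<le> N2 (\<lambda>x. A d x + B d x) + N2 (F n)"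
      by (intro N2_triangle_diff L2_add lin_opD(1)[OF A d] lin_opD(1)[OF B d] FL)
    also have "N2 (\<lambda>x. A d x + B d x) \<le> N2 (A d) + N2 (B d)"
      by (intro N2_triangle lin_opD(1)[OF A d] lin_opD(1)[OF B d])
    also have "N2 (B d) \<le> N2 (A d) / 2" by (rule half[OF d])
    also have "N2 (A d) = N2 (\<lambda>x. g x - (\<Sum>k<n. F k x))"
      using Ad by (intro L2_cong(2)[symmetric] lin_opD(1)[OF A d]) (simp add: ae_eq_UNIV_iff)
    finally have "N2 E \<le> 3/2 * N2 (\<lambda>x. g x - (\<Sum>k<n. F k x)) + N2 (F n)" by simp
    then show ?thesis using g(2)[of n] NF[of n] by simp
  qed
  moreover have "(\<lambda>n. 4 * N2 f * (1/2) ^ n) \<longlonglongrightarrow> 4 * N2 f * 0"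
    by (intro tendsto_intros LIMSEQ_power_zero) simp
  ultimately have "N2 E \<le> 0"
    by (intro tendsto_lowerbound[of "\<lambda>n. 4 * N2 f * (1/2) ^ n" _ sequentially]) auto
  then have "N2 E = 0" using L2_norm_nonneg[of UNIV E] by linarith
  then have "ae_eq UNIV E (\<lambda>x. 0)" by (rule N2_eq_0_imp[OF EL])
  then have "ae_eq UNIV (\<lambda>x. A u x + B u x) f"
    unfolding ae_eq_UNIV_iff by eventually_elim (simp add: E_def)
  then show "\<exists>u\<in>W22R. ae_eq UNIV (\<lambda>x. A u x + B u x) f" using u(1) by blast
qed

text \<open>The lower bound has the same constant for all t, so perturbation steps of one fixed
  length carry surjectivity from t = 0 to t = 1.\<close>

lemma method_of_continuity:
  assumes A: "lin_op A" and B: "lin_op B" and c: "0 < c"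
    and low: "\<And>t u. 0 \<le> t \<Longrightarrow> t \<le> 1 \<Longrightarrow> u \<in> W22R \<Longrightarrow> c * Wnorm u \<le> N2 (\<lambda>x. A u x + of_real t * B u x)"
    and bdd: "\<And>u. u \<in> W22R \<Longrightarrow> N2 (B u) \<le> K * Wnorm u"
    and onto: "onto_op A"
  shows "onto_op (\<lambda>u x. A u x + B u x)"
proof -
  \<comment> \<open>A step of length 1 / N has K / N < c / 2, the smallness that
    \<open>onto_op_perturb\<close> asks for.\<close>
  obtain N :: nat where N: "real N > 2 * K / c" "N > 0"
    using reals_Archimedean2[of "max (2 * K / c) 0"] by (auto simp: of_nat_0_less_iff)
  have step: "onto_op (\<lambda>u x. A u x + of_real (real j / real N) * B u x)" if "j \<le> N" for j
    using that
  proof (induction j)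
    case 0
    then show ?case using onto by simp
  next
    case (Suc j)
    define A' where "A' u x = A u x + of_real (real j / real N) * B u x" for u x
    have linA': "lin_op A'" unfolding A'_def[abs_def] by (rule lin_op_lincomb[OF A B])
    \<comment> \<open>\<open>lin_op_lincomb\<close> always has a leading summand with coefficient
      one, so a multiple of \<open>B\<close> alone is reached by cancelling a copy of
      \<open>A\<close>.\<close>
    have linB': "lin_op (\<lambda>u x. 0 * A u x + of_real (1 / real N) * B u x)"
      using lin_op_lincomb[OF lin_op_lincomb[OF A A, of "-1"] B, of "of_real (1 / real N)"] by simp
    have "onto_op (\<lambda>u x. A' u x + (0 * A u x + of_real (1 / real N) * B u x))"
    proof (rule onto_op_perturb[OF linA' linB'])
      show "c * Wnorm u \<le> N2 (A' u)" if "u \<in> W22R" for u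
        unfolding A'_def[abs_def] using Suc.prems by (intro low that) auto
      show "N2 (\<lambda>x. 0 * A u x + complex_of_real (1 / real N) * B u x) \<le> c / 2 * Wnorm u" if "u \<in> W22R" for u
      proof -
        have "N2 (\<lambda>x. complex_of_real (1 / real N) * B u x) = 1 / real N * N2 (B u)"
          by (subst N2_scale) (simp add: norm_divide)
        also have "\<dots> \<le> 1 / real N * (K * Wnorm u)"
          by (intro mult_left_mono bdd that) simp
        also have "\<dots> = (K / real N) * Wnorm u" by simp
        also have "\<dots> \<le> c / 2 * Wnorm u"
          by (rule mult_right_mono) (use N c in \<open>simp_all add: field_simps\<close>)
        finally show ?thesis by simp
      qed
      show "onto_op A'" unfolding A'_def[abs_def] using Suc by simp
    qed
    moreover have "A' u x + (0 * A u x + of_real (1 / real N) * B u x)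
        = A u x + of_real (real (Suc j) / real N) * B u x" for u x
      by (simp add: A'_def add_divide_distrib distrib_right)
    ultimately show ?case by simp
  qed
  show ?thesis using step[of N] N by simp
qed

section \<open>Restriction of Sobolev functions and boundary terms at infinity\<close>

lemma W22_restrict:
  assumes "u \<in> W22R" "open X"
  shows "u \<in> W22 X" "W22_norm X u \<le> Wnorm u"
proof -
  have X: "X \<in> sets lebesgue" using assms(2) by simp
  have L2_sub: "f \<in> L2_space X" "(L2_norm X g)\<^sup>2 \<le> (N2 f)\<^sup>2" if f: "f \<in> L2" and fg: "ae_eq X g f" for f g
  proof -
    have ind: "integrable lebesgue (\<lambda>x. indicator X x *\<^sub>R (cmod (f x))\<^sup>2)"
      using L2_sq_integrable[OF f] X by (intro integrable_mult_indicator)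
    then show "f \<in> L2_space X"
      using L2_measurable[OF f] X
      by (simp add: L2_space_def integrable_restrict_space measurable_restrict_space1)
    have "(L2_norm X g)\<^sup>2 = integral\<^sup>L (lebesgue_on X) (\<lambda>x. (cmod (g x))\<^sup>2)"
      unfolding L2_norm_def by (rule real_sqrt_pow2) simp
    also have "\<dots> \<le> integral\<^sup>L (lebesgue_on X) (\<lambda>x. (cmod (f x))\<^sup>2)"
    \<comment> \<open>An integral that does not exist has the value 0, so the second case is
      trivial.\<close>
    proof (cases "integrable (lebesgue_on X) (\<lambda>x. (cmod (g x))\<^sup>2)")
      case True
      show ?thesis
      proof (rule integral_mono_AE[OF True])
        show "integrable (lebesgue_on X) (\<lambda>x. (cmod (f x))\<^sup>2)"
          using ind X by (simp add: integrable_restrict_space)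
        show "AE x in lebesgue_on X. (cmod (g x))\<^sup>2 \<le> (cmod (f x))\<^sup>2"
          using fg unfolding ae_eq_def by eventually_elim simp
      qed
    qed (simp add: not_integrable_integral_eq)
    also have "\<dots> = integral\<^sup>L lebesgue (\<lambda>x. indicator X x *\<^sub>R (cmod (f x))\<^sup>2)"
      by (rule integral_lebesgue_on_indicator[OF X])
    also have "\<dots> \<le> integral\<^sup>L lebesgue (\<lambda>x. (cmod (f x))\<^sup>2)"
      by (rule integral_mono[OF ind L2_sq_integrable[OF f]]) (simp add: indicator_def)
    finally show "(L2_norm X g)\<^sup>2 \<le> (N2 f)\<^sup>2" by (simp add: N2_sq)
  qed
  obtain U V W where t: "W22_repr U V W" "ae_eq UNIV u U" by (rule W22_obtain_repr[OF assms(1)])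
  note T = W22_reprD[OF t(1)]
  have uU: "ae_eq X u U" using t(2) X by (rule ae_eq_subset)
  have uL: "u \<in> L2" by (rule W22_L2[OF assms(1)])
  have w1: "has_weak_deriv X u V"
    by (rule has_weak_deriv_cong[OF abs_cont_imp_weak_deriv[OF T(1) assms(2)] ae_eq_sym[OF uU] _ assms(2)]) simp
  have w2: "has_weak_deriv X V W" by (rule abs_cont_imp_weak_deriv[OF T(2) assms(2)])
  show "u \<in> W22 X"
    unfolding W22_def using L2_sub(1) uL T w1 w2 ae_eq_refl by blast
  have v: "ae_eq X (weak_deriv X u) V" by (rule weak_deriv_ae_eq(2)[OF w1 assms(2)])
  have "has_weak_deriv X (weak_deriv X u) W"
    by (rule has_weak_deriv_cong[OF w2 ae_eq_sym[OF v] _ assms(2)]) simp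
  then have w: "ae_eq X (weak_deriv X (weak_deriv X u)) W"
    by (rule weak_deriv_ae_eq(2)[OF _ assms(2)])
  show "W22_norm X u \<le> Wnorm u"
    unfolding W22_repr_imp_W22(4)[OF t] unfolding W22_norm_def repr_norm_def
    by (intro real_sqrt_le_mono add_mono L2_sub(2)[OF T(3) uU] L2_sub(2)[OF T(4) v] L2_sub(2)[OF T(5) w])
qed

text \<open>If the integral of g were I \<noteq> 0, then w(T) - w(-T) would tend to I and could not
  be integrable. This disposes of the boundary terms in every integration by parts on the
  line.\<close>

lemma abs_cont_integral_zero:
  assumes abs_cont: "abs_cont w g" and w: "integrable lebesgue w" and g: "integrable lebesgue g"
  shows "integral\<^sup>L lebesgue g = 0"
proof (rule ccontr)
  define I where "I = integral\<^sup>L lebesgue g"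
  define c where "c T = w T - w (- T)" for T
  assume "integral\<^sup>L lebesgue g \<noteq> 0"
  then have I: "cmod I > 0" by (simp add: I_def)
  have "((\<lambda>T. \<integral>x. indicator {-T..T} x *\<^sub>R g x \<partial>lebesgue) \<longlongrightarrow> I) at_top"
    unfolding I_def
  proof (rule integral_dominated_convergence_at_top[where w = "\<lambda>x. cmod (g x)"])
    have gm: "g \<in> borel_measurable lebesgue" using g by simp
    show "(\<lambda>x. indicator {-T..T} x *\<^sub>R g x) \<in> borel_measurable lebesgue" for T :: real
      by (intro borel_measurable_scaleR borel_measurable_indicator gm) simp
    show "AE x in lebesgue. ((\<lambda>T. indicator {-T..T} x *\<^sub>R g x) \<longlongrightarrow> g x) at_top"
    proof (rule AE_I2, rule tendsto_eventually)
      fix x :: real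
      show "\<forall>\<^sub>F T in at_top. indicator {-T..T} x *\<^sub>R g x = g x"
        using eventually_ge_at_top[of "\<bar>x\<bar>"] by eventually_elim (auto simp: indicator_def)
    qed
    show "\<forall>\<^sub>F T in at_top. AE x in lebesgue. norm (indicator {-T..T} x *\<^sub>R g x) \<le> cmod (g x)"
      by (intro always_eventually allI AE_I2) (auto simp: indicator_def)
  qed (use g in auto)
  then have "(c \<longlongrightarrow> I) at_top"
  proof (rule Lim_transform_eventually)
    show "\<forall>\<^sub>F T in at_top. (\<integral>x. indicator {-T..T} x *\<^sub>R g x \<partial>lebesgue) = c T"
      using eventually_ge_at_top[of 0]
    proof eventually_elim
      case (elim T)
      then show ?case
        using set_lebesgue_integral_eq_integral(2)[OF acD(1)[OF abs_cont, of "-T" T]] acD(3)[OF abs_cont, of "-T" T]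
        by (simp add: set_lebesgue_integral_def c_def)
    qed
  qed
  then have "\<forall>\<^sub>F T in at_top. dist (c T) I < cmod I / 2"
    using I by (intro tendstoD) auto
  then obtain T0 where T0: "\<And>T. T \<ge> T0 \<Longrightarrow> dist (c T) I < cmod I / 2"
    by (auto simp: eventually_at_top_linorder)
  have low: "cmod I / 2 \<le> cmod (c T)" if "T \<ge> T0" for T
    using T0[OF that] norm_triangle_ineq2[of I "c T"] by (simp add: dist_norm norm_minus_commute)
  have ci: "integrable lebesgue (\<lambda>T. cmod (c T))"
  proof -
    have "integrable lebesgue (\<lambda>T. w (0 + (-1) * T))"
      using w by (subst lebesgue_integrable_real_affine_iff) auto
    then show ?thesis using w unfolding c_def by (intro integrable_norm Bochner_Integration.integrable_diff) auto
  qed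
  have bound: "M * (cmod I / 2) \<le> integral\<^sup>L lebesgue (\<lambda>T. cmod (c T))" if M: "M \<ge> 0" for M
  proof -
    have "M * (cmod I / 2) = integral\<^sup>L lebesgue (\<lambda>T. indicator {T0..T0 + M} T * (cmod I / 2))"
      using M by simp
    also have "\<dots> \<le> integral\<^sup>L lebesgue (\<lambda>T. cmod (c T))"
    proof (rule integral_mono[OF _ ci])
      show "integrable lebesgue (\<lambda>T. indicator {T0..T0 + M} T * (cmod I / 2))"
        by (intro integrable_mult_left integrable_real_indicator) (auto simp: emeasure_lborel_Icc_eq)
      show "indicator {T0..T0 + M} T * (cmod I / 2) \<le> cmod (c T)" for T
        using low[of T] by (auto simp: indicator_def)
    qed
    finally show ?thesis .
  qed
  \<comment> \<open>Chosen so that the lower bound exceeds the integral by exactly one.\<close>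
  define M where "M = (integral\<^sup>L lebesgue (\<lambda>T. cmod (c T)) + 1) / (cmod I / 2)"
  have "M \<ge> 0" unfolding M_def by (intro divide_nonneg_nonneg add_nonneg_nonneg) auto
  from bound[OF this] I show False by (simp add: M_def)
qed

section \<open>Sturm--Liouville expressions with bounded coefficients\<close>

lemma of_real_cmod_sq: "(complex_of_real (cmod z))\<^sup>2 = z * cnj z"
  by (simp add: complex_norm_square[symmetric])

text \<open>The three summands bound U, U' and U'' in turn, see \<open>repr_norm_bound\<close>. The
  constant depends on coefficient bounds only, so that one value serves a whole homotopy of
  coefficients.\<close>

definition W2_const :: "real \<Rightarrow> real \<Rightarrow> real \<Rightarrow> real" where
  "W2_const p0 p2 q1 = 1 + sqrt ((1 + q1) / p0) + (1 + p2 * sqrt ((1 + q1) / p0) + q1) / p0"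

text \<open>The derivative of P is a bounded measurable function tied to P by absolute continuity,
  which admits piecewise smooth coefficients. The bounds are parameters because the estimates must
  be uniform over families of coefficients.\<close>

locale bounded_coeffs =
  fixes P P' q :: "real \<Rightarrow> real" and p0 p1 p2 q1 :: real
  assumes p0: "0 < p0" and P_ge: "\<And>x. p0 \<le> P x" and P_le: "\<And>x. P x \<le> p1"
    and P'_le: "\<And>x. \<bar>P' x\<bar> \<le> p2" and P'_meas: "P' \<in> borel_measurable lebesgue"
    and acP: "abs_cont (\<lambda>x. of_real (P x)) (\<lambda>x. of_real (P' x))"
    and q_meas: "q \<in> borel_measurable lebesgue" and q_le: "\<And>x. \<bar>q x\<bar> \<le> q1"
begin

lemma nonneg: "0 \<le> p1" "0 \<le> p2" "0 \<le> q1"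
  using p0 P_ge[of 0] P_le[of 0] P'_le[of 0] q_le[of 0] by linarith+

lemma P_pos: "0 < P x"
  using p0 P_ge[of x] by linarith

lemma P_meas: "P \<in> borel_measurable lebesgue"
proof -
  have "continuous_on UNIV (\<lambda>x. Re (of_real (P x)))"
    by (intro continuous_intros abs_cont_continuous_on[OF acP])
  then have "P \<in> borel_measurable borel"
    by (simp add: borel_measurable_continuous_onI)
  then show ?thesis by (simp add: measurable_completion)
qed

lemma cmeas:
  "(\<lambda>x. complex_of_real (P x)) \<in> borel_measurable lebesgue"
  "(\<lambda>x. complex_of_real (P' x)) \<in> borel_measurable lebesgue"
  "(\<lambda>x. complex_of_real (q x)) \<in> borel_measurable lebesgue"
  using P_meas P'_meas q_meas by auto

lemma L2_PP'q:
  assumes "f \<in> L2"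
  shows "(\<lambda>x. of_real (P x) * f x) \<in> L2" "N2 (\<lambda>x. of_real (P x) * f x) \<le> p1 * N2 f"
    and "(\<lambda>x. of_real (P' x) * f x) \<in> L2" "N2 (\<lambda>x. of_real (P' x) * f x) \<le> p2 * N2 f"
    and "(\<lambda>x. of_real (q x) * f x) \<in> L2" "N2 (\<lambda>x. of_real (q x) * f x) \<le> q1 * N2 f"
proof -
  have "AE x in lebesgue. cmod (of_real (P x)) \<le> p1"
    using P_le P_pos by (auto simp: less_imp_le)
  from L2_mult_bounded[OF assms cmeas(1) this nonneg(1)]
  show "(\<lambda>x. of_real (P x) * f x) \<in> L2" "N2 (\<lambda>x. of_real (P x) * f x) \<le> p1 * N2 f" .
  have "AE x in lebesgue. cmod (of_real (P' x)) \<le> p2" using P'_le by auto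
  from L2_mult_bounded[OF assms cmeas(2) this nonneg(2)]
  show "(\<lambda>x. of_real (P' x) * f x) \<in> L2" "N2 (\<lambda>x. of_real (P' x) * f x) \<le> p2 * N2 f" .
  have "AE x in lebesgue. cmod (of_real (q x)) \<le> q1" using q_le by auto
  from L2_mult_bounded[OF assms cmeas(3) this nonneg(3)]
  show "(\<lambda>x. of_real (q x) * f x) \<in> L2" "N2 (\<lambda>x. of_real (q x) * f x) \<le> q1 * N2 f" .
qed

text \<open>The derivative of P V is written out by the product rule, which makes the expression
  explicit and linear at every point.\<close>

definition sl :: "(real \<Rightarrow> complex) \<Rightarrow> (real \<Rightarrow> complex) \<Rightarrow> (real \<Rightarrow> complex) \<Rightarrow> real \<Rightarrow> complex" where
  "sl U V W x = of_real (q x) * U x - (of_real (P' x) * V x + of_real (P x) * W x)"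

definition form :: "(real \<Rightarrow> complex) \<Rightarrow> (real \<Rightarrow> complex) \<Rightarrow> real" where
  "form U V = integral\<^sup>L lebesgue (\<lambda>x. P x * (cmod (V x))\<^sup>2 + q x * (cmod (U x))\<^sup>2)"

lemma abs_cont_PV:
  assumes "W22_repr U V W"
  shows "abs_cont (\<lambda>x. of_real (P x) * V x) (\<lambda>x. of_real (P' x) * V x + of_real (P x) * W x)"
  by (rule abs_cont_mult[OF acP W22_reprD(2)[OF assms]])

lemma sl_L2: "W22_repr U V W \<Longrightarrow> sl U V W \<in> L2"
  unfolding sl_def[abs_def] by (intro L2_diff L2_add L2_PP'q W22_reprD)

lemma sl_op_ae_eq:
  assumes t: "W22_repr U V W" and u: "ae_eq UNIV u U"
  shows "ae_eq UNIV (sl_op UNIV P q u) (sl U V W)"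
proof -
  note v = W22_repr_imp_W22(2)[OF t u]
  have pv: "ae_eq UNIV (\<lambda>x. of_real (P x) * weak_deriv UNIV u x) (\<lambda>x. of_real (P x) * V x)"
    using v unfolding ae_eq_UNIV_iff by eventually_elim simp
  have "has_weak_deriv UNIV (\<lambda>x. of_real (P x) * weak_deriv UNIV u x)
      (\<lambda>x. of_real (P' x) * V x + of_real (P x) * W x)"
    by (rule has_weak_deriv_cong[OF abs_cont_imp_weak_deriv[OF abs_cont_PV[OF t] open_UNIV] ae_eq_sym[OF pv]]) auto
  from weak_deriv_ae_eq(2)[OF this open_UNIV] u show ?thesis
    unfolding ae_eq_UNIV_iff by eventually_elim (simp add: sl_op_def sl_def)
qed

lemma sl_lincomb:
  "sl (\<lambda>x. c * U x + d * U' x) (\<lambda>x. c * V x + d * V' x) (\<lambda>x. c * W x + d * W' x) x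
    = c * sl U V W x + d * sl U' V' W' x"
  by (simp add: sl_def algebra_simps)

lemma sl_op_lincomb_ae:
  assumes "u \<in> W22R" "v \<in> W22R"
  shows "AE x in lebesgue. sl_op UNIV P q (\<lambda>x. c * u x + d * v x) x
    = c * sl_op UNIV P q u x + d * sl_op UNIV P q v x"
proof -
  obtain U V W where 1: "W22_repr U V W" "ae_eq UNIV u U" by (rule W22_obtain_repr[OF assms(1)])
  obtain U' V' W' where 2: "W22_repr U' V' W'" "ae_eq UNIV v U'" by (rule W22_obtain_repr[OF assms(2)])
  have "ae_eq UNIV (\<lambda>x. c * u x + d * v x) (\<lambda>x. c * U x + d * U' x)"
    using 1(2) 2(2) unfolding ae_eq_UNIV_iff by eventually_elim simp
  from sl_op_ae_eq[OF W22_repr_lincomb[OF 1(1) 2(1)] this] sl_op_ae_eq[OF 1] sl_op_ae_eq[OF 2]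
  show ?thesis unfolding ae_eq_UNIV_iff by eventually_elim (simp add: sl_lincomb)
qed

lemma lin_op_sl: "lin_op (sl_op UNIV P q)"
  unfolding linear_W22_L2_def
proof (intro conjI ballI impI allI)
  fix u assume u: "u \<in> W22R"
  then obtain U V W where 1: "W22_repr U V W" "ae_eq UNIV u U" by (rule W22_obtain_repr)
  show "sl_op UNIV P q u \<in> L2"
    by (rule L2_cong(1)[OF ae_eq_sym[OF sl_op_ae_eq[OF 1]] sl_L2[OF 1(1)]])
  show "ae_eq UNIV (sl_op UNIV P q (\<lambda>x. c * u x)) (\<lambda>x. c * sl_op UNIV P q u x)" for c
    using sl_op_lincomb_ae[OF u u, of c 0] by (simp add: ae_eq_UNIV_iff)
  fix v assume v: "v \<in> W22R"
  show "ae_eq UNIV (sl_op UNIV P q (\<lambda>x. u x + v x)) (\<lambda>x. sl_op UNIV P q u x + sl_op UNIV P q v x)"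
    using sl_op_lincomb_ae[OF u v, of 1 1] by (simp add: ae_eq_UNIV_iff)
  assume "ae_eq UNIV u v"
  then have "ae_eq UNIV v U" using 1(2) ae_eq_sym ae_eq_trans by blast
  from sl_op_ae_eq[OF 1(1) this] sl_op_ae_eq[OF 1]
  show "ae_eq UNIV (sl_op UNIV P q u) (sl_op UNIV P q v)" using ae_eq_sym ae_eq_trans by blast
qed

text \<open>The derivative of the product of \<open>cnj U\<close> and P V is integrable and has
  integral zero; its two parts give Green's formula. That the value is real is what drives the
  resolvent bounds.\<close>

lemma sl_form:
  assumes t: "W22_repr U V W"
  shows "integral\<^sup>L lebesgue (\<lambda>x. sl U V W x * cnj (U x)) = of_real (form U V)"
proof -
  note T = W22_reprD[OF t]
  note pv = L2_PP'q(1)[OF T(4)]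
  have fl: "(\<lambda>x. of_real (P' x) * V x + of_real (P x) * W x) \<in> L2"
    by (intro L2_add L2_PP'q T)
  have "integral\<^sup>L lebesgue (\<lambda>x. cnj (V x) * (of_real (P x) * V x)
      + cnj (U x) * (of_real (P' x) * V x + of_real (P x) * W x)) = 0"
  proof (rule abs_cont_integral_zero)
    show "abs_cont (\<lambda>x. cnj (U x) * (of_real (P x) * V x)) (\<lambda>x. cnj (V x) * (of_real (P x) * V x)
      + cnj (U x) * (of_real (P' x) * V x + of_real (P x) * W x))"
      by (rule abs_cont_mult[OF abs_cont_cnj[OF T(1)] abs_cont_PV[OF t]])
    show "integrable lebesgue (\<lambda>x. cnj (U x) * (of_real (P x) * V x))"
      by (intro L2_prod_integrable L2_cnj T pv)
    show "integrable lebesgue (\<lambda>x. cnj (V x) * (of_real (P x) * V x)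
      + cnj (U x) * (of_real (P' x) * V x + of_real (P x) * W x))"
      by (intro Bochner_Integration.integrable_add L2_prod_integrable L2_cnj T pv fl)
  qed
  then have z: "integral\<^sup>L lebesgue (\<lambda>x. cnj (V x) * (of_real (P x) * V x))
      + integral\<^sup>L lebesgue (\<lambda>x. cnj (U x) * (of_real (P' x) * V x + of_real (P x) * W x)) = 0"
    by (subst (asm) Bochner_Integration.integral_add) (intro L2_prod_integrable L2_cnj T pv fl)+
  have iq: "integrable lebesgue (\<lambda>x. of_real (q x) * U x * cnj (U x))"
    by (intro L2_prod_integrable L2_cnj T L2_PP'q)
  have L2_inner: "integrable lebesgue (\<lambda>x. cnj (V x) * (of_real (P x) * V x))"
    by (intro L2_prod_integrable L2_cnj T pv)
  have "integral\<^sup>L lebesgue (\<lambda>x. sl U V W x * cnj (U x))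
      = integral\<^sup>L lebesgue (\<lambda>x. of_real (q x) * U x * cnj (U x)
        - cnj (U x) * (of_real (P' x) * V x + of_real (P x) * W x))"
    by (simp add: sl_def algebra_simps)
  also have "\<dots> = integral\<^sup>L lebesgue (\<lambda>x. of_real (q x) * U x * cnj (U x))
      - integral\<^sup>L lebesgue (\<lambda>x. cnj (U x) * (of_real (P' x) * V x + of_real (P x) * W x))"
    by (intro Bochner_Integration.integral_diff iq L2_prod_integrable L2_cnj T fl)
  also have "\<dots> = integral\<^sup>L lebesgue (\<lambda>x. of_real (q x) * U x * cnj (U x))
      + integral\<^sup>L lebesgue (\<lambda>x. cnj (V x) * (of_real (P x) * V x))"
  proof -
    have "A + B = 0 \<Longrightarrow> C - B = C + A" for A B C :: complex by (simp add: add_eq_0_iff)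
    then show ?thesis using z by blast
  qed
  also have "\<dots> = integral\<^sup>L lebesgue (\<lambda>x. of_real (q x) * U x * cnj (U x) + cnj (V x) * (of_real (P x) * V x))"
    by (rule Bochner_Integration.integral_add[symmetric, OF iq L2_inner])
  also have "\<dots> = integral\<^sup>L lebesgue (\<lambda>x. of_real (P x * (cmod (V x))\<^sup>2 + q x * (cmod (U x))\<^sup>2))"
    by (intro Bochner_Integration.integral_cong) (auto simp: of_real_cmod_sq algebra_simps)
  also have "\<dots> = of_real (form U V)"
    unfolding form_def by (rule integral_complex_of_real)
  finally show ?thesis .
qed

lemma form_integrable:
  assumes "U \<in> L2" "V \<in> L2"
  shows "integrable lebesgue (\<lambda>x. P x * (cmod (V x))\<^sup>2)" "integrable lebesgue (\<lambda>x. q x * (cmod (U x))\<^sup>2)"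
proof -
  have "integrable lebesgue (\<lambda>x. of_real (P x) * V x * cnj (V x))"
    by (intro L2_prod_integrable L2_cnj assms L2_PP'q)
  then have "integrable lebesgue (\<lambda>x. complex_of_real (P x * (cmod (V x))\<^sup>2))"
    by (simp add: of_real_cmod_sq mult.assoc)
  then show "integrable lebesgue (\<lambda>x. P x * (cmod (V x))\<^sup>2)"
    by (simp only: complex_of_real_integrable_eq)
  have "integrable lebesgue (\<lambda>x. of_real (q x) * U x * cnj (U x))"
    by (intro L2_prod_integrable L2_cnj assms L2_PP'q)
  then have "integrable lebesgue (\<lambda>x. complex_of_real (q x * (cmod (U x))\<^sup>2))"
    by (simp add: of_real_cmod_sq mult.assoc)
  then show "integrable lebesgue (\<lambda>x. q x * (cmod (U x))\<^sup>2)"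
    by (simp only: complex_of_real_integrable_eq)
qed

lemma form_ge:
  assumes "U \<in> L2" "V \<in> L2"
  shows "p0 * (N2 V)\<^sup>2 - q1 * (N2 U)\<^sup>2 \<le> form U V"
proof -
  note i = form_integrable[OF assms] L2_sq_integrable[OF assms(1)] L2_sq_integrable[OF assms(2)]
  have "p0 * (N2 V)\<^sup>2 - q1 * (N2 U)\<^sup>2
      = integral\<^sup>L lebesgue (\<lambda>x. p0 * (cmod (V x))\<^sup>2 - q1 * (cmod (U x))\<^sup>2)"
    using i by (simp add: N2_sq)
  also have "\<dots> \<le> form U V"
    unfolding form_def
  proof (rule integral_mono)
    show "p0 * (cmod (V x))\<^sup>2 - q1 * (cmod (U x))\<^sup>2 \<le> P x * (cmod (V x))\<^sup>2 + q x * (cmod (U x))\<^sup>2" for x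
    proof -
      have "p0 * (cmod (V x))\<^sup>2 \<le> P x * (cmod (V x))\<^sup>2" by (intro mult_right_mono P_ge) simp
      moreover have "(- q1) * (cmod (U x))\<^sup>2 \<le> q x * (cmod (U x))\<^sup>2"
        using q_le[of x] by (intro mult_right_mono) auto
      ultimately show ?thesis by simp
    qed
  qed (use i in auto)
  finally show ?thesis .
qed

text \<open>The form controls the first derivative; the second is then solved for in the equation
  itself, at the cost of dividing by p0.\<close>

lemma repr_norm_bound:
  assumes t: "W22_repr U V W"
  shows "repr_norm U V W \<le> W2_const p0 p2 q1 * (N2 (sl U V W) + N2 U)"
proof -
  note T = W22_reprD[OF t] and S = sl_L2[OF t]
  define a where "a = N2 (sl U V W) + N2 U"
  define k where "k = sqrt ((1 + q1) / p0)"
  have a: "0 \<le> a" "N2 (sl U V W) \<le> a" "N2 U \<le> a" by (auto simp: a_def)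
  have k: "0 \<le> k" using nonneg p0 by (simp add: k_def)
  have "form U V \<le> N2 (sl U V W) * N2 U"
  proof -
    have "form U V \<le> cmod (of_real (form U V))" by simp
    also have "\<dots> \<le> N2 (sl U V W) * N2 (\<lambda>x. cnj (U x))"
      unfolding sl_form[OF t, symmetric] by (rule L2_Cauchy_Schwarz(2)[OF S L2_cnj[OF T(3)]])
    also have "N2 (\<lambda>x. cnj (U x)) = N2 U" by (simp add: N2_eq)
    finally show ?thesis .
  qed
  also have "\<dots> \<le> a * a" using a by (intro mult_mono) auto
  finally have "p0 * (N2 V)\<^sup>2 \<le> a * a + q1 * (N2 U)\<^sup>2" using form_ge[OF T(3,4)] by linarith
  also have "\<dots> \<le> a * a + q1 * (a * a)"
    using a nonneg by (intro add_left_mono mult_left_mono) (auto simp: power2_eq_square intro!: mult_mono)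
  finally have "(N2 V)\<^sup>2 \<le> (1 + q1) / p0 * a\<^sup>2"
    using p0 by (simp add: field_simps power2_eq_square)
  also have "\<dots> = (k * a)\<^sup>2" using nonneg p0 by (simp add: k_def power_mult_distrib)
  finally have V: "N2 V \<le> k * a" by (rule power2_le_imp_le) (use k a in simp)
  have "p0 * N2 W \<le> N2 (\<lambda>x. of_real (P x) * W x)"
  proof (rule power2_le_imp_le)
    have "(p0 * N2 W)\<^sup>2 = integral\<^sup>L lebesgue (\<lambda>x. p0\<^sup>2 * (cmod (W x))\<^sup>2)"
      by (simp add: power_mult_distrib N2_sq)
    also have "\<dots> \<le> integral\<^sup>L lebesgue (\<lambda>x. (cmod (of_real (P x) * W x))\<^sup>2)"
    proof (rule integral_mono)
      show "p0\<^sup>2 * (cmod (W x))\<^sup>2 \<le> (cmod (complex_of_real (P x) * W x))\<^sup>2" for x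
        using P_ge[of x] p0 by (simp add: norm_mult power_mult_distrib mult_right_mono power_mono)
    qed (use L2_sq_integrable[OF T(5)] L2_sq_integrable[OF L2_PP'q(1)[OF T(5)]] in auto)
    finally show "(p0 * N2 W)\<^sup>2 \<le> (N2 (\<lambda>x. of_real (P x) * W x))\<^sup>2" by (simp add: N2_sq)
  qed simp
  also have "(\<lambda>x. of_real (P x) * W x) = (\<lambda>x. (of_real (q x) * U x - of_real (P' x) * V x) - sl U V W x)"
    by (auto simp: sl_def)
  also have "N2 \<dots> \<le> N2 (\<lambda>x. of_real (q x) * U x - of_real (P' x) * V x) + N2 (sl U V W)"
    by (intro N2_triangle_diff L2_diff L2_PP'q T S)
  also have "N2 (\<lambda>x. of_real (q x) * U x - of_real (P' x) * V x)
      \<le> N2 (\<lambda>x. of_real (q x) * U x) + N2 (\<lambda>x. of_real (P' x) * V x)"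
    by (intro N2_triangle_diff L2_PP'q T)
  also have "N2 (\<lambda>x. of_real (q x) * U x) \<le> q1 * N2 U" by (intro L2_PP'q T)
  also have "N2 (\<lambda>x. of_real (P' x) * V x) \<le> p2 * N2 V" by (intro L2_PP'q T)
  finally have "p0 * N2 W \<le> q1 * N2 U + p2 * N2 V + N2 (sl U V W)" by simp
  also have "\<dots> \<le> q1 * a + p2 * (k * a) + a"
    using a V nonneg by (intro add_mono mult_left_mono) auto
  finally have W: "N2 W \<le> (1 + p2 * k + q1) / p0 * a"
    using p0 by (simp add: field_simps)
  have "repr_norm U V W \<le> N2 U + N2 V + N2 W"
    unfolding repr_norm_def
    by (rule real_le_lsqrt) (auto simp: power2_sum power2_eq_square algebra_simps intro!: add_nonneg_nonneg)
  also have "\<dots> \<le> W2_const p0 p2 q1 * a"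
    using a V W by (simp add: W2_const_def k_def[symmetric] distrib_right)
  finally show ?thesis by (simp add: a_def)
qed

text \<open>Pair the shifted operator with U. The form is real, so the imaginary and the real part
  of the pairing isolate Im z and m - Re z.\<close>

lemma sl_lower:
  assumes t: "W22_repr U V W" and m: "m * (N2 U)\<^sup>2 \<le> form U V"
  shows "\<bar>Im z\<bar> * N2 U \<le> N2 (\<lambda>x. sl U V W x - z * U x)"
    and "(m - Re z) * N2 U \<le> N2 (\<lambda>x. sl U V W x - z * U x)"
proof -
  note T = W22_reprD[OF t] and S = sl_L2[OF t]
  define G where "G x = sl U V W x - z * U x" for x
  have G: "G \<in> L2" unfolding G_def[abs_def] by (intro L2_diff S L2_scale T)
  have "integral\<^sup>L lebesgue (\<lambda>x. G x * cnj (U x))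
      = integral\<^sup>L lebesgue (\<lambda>x. sl U V W x * cnj (U x) - z * (U x * cnj (U x)))"
    by (simp add: G_def algebra_simps)
  also have "\<dots> = of_real (form U V) - z * integral\<^sup>L lebesgue (\<lambda>x. U x * cnj (U x))"
    using L2_prod_integrable(1)[OF S L2_cnj[OF T(3)]] L2_prod_integrable(1)[OF T(3) L2_cnj[OF T(3)]]
    by (simp add: sl_form[OF t])
  also have "integral\<^sup>L lebesgue (\<lambda>x. U x * cnj (U x)) = of_real ((N2 U)\<^sup>2)"
    unfolding N2_sq by (subst integral_complex_of_real[symmetric]) (simp add: of_real_cmod_sq)
  finally have eq: "integral\<^sup>L lebesgue (\<lambda>x. G x * cnj (U x)) = of_real (form U V) - z * of_real ((N2 U)\<^sup>2)" .
  have "cmod (integral\<^sup>L lebesgue (\<lambda>x. G x * cnj (U x))) \<le> N2 G * N2 (\<lambda>x. cnj (U x))"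
    by (rule L2_Cauchy_Schwarz(2)[OF G L2_cnj[OF T(3)]])
  also have "N2 (\<lambda>x. cnj (U x)) = N2 U" by (simp add: N2_eq)
  finally have le: "cmod (of_real (form U V) - z * of_real ((N2 U)\<^sup>2)) \<le> N2 G * N2 U" unfolding eq .
  have canc: "a * N2 U \<le> N2 G" if "a * (N2 U)\<^sup>2 \<le> N2 G * N2 U" for a
  proof (cases "N2 U = 0")
    case False
    then have "N2 U > 0" using L2_norm_nonneg[of UNIV U] by linarith
    moreover have "(a * N2 U) * N2 U \<le> N2 G * N2 U" using that by (simp add: power2_eq_square mult.assoc)
    ultimately show ?thesis by (rule mult_right_le_imp_le[rotated])
  qed simp
  have "\<bar>Im z\<bar> * (N2 U)\<^sup>2 = \<bar>Im (of_real (form U V) - z * of_real ((N2 U)\<^sup>2))\<bar>"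
    by (simp add: abs_mult)
  also have "\<dots> \<le> N2 G * N2 U" using abs_Im_le_cmod le by (rule order_trans)
  finally show "\<bar>Im z\<bar> * N2 U \<le> N2 (\<lambda>x. sl U V W x - z * U x)"
    using canc unfolding G_def by blast
  have "(m - Re z) * (N2 U)\<^sup>2 \<le> Re (of_real (form U V) - z * of_real ((N2 U)\<^sup>2))"
    using m by (simp add: left_diff_distrib)
  also have "\<dots> \<le> N2 G * N2 U" using complex_Re_le_cmod le by (rule order_trans)
  finally show "(m - Re z) * N2 U \<le> N2 (\<lambda>x. sl U V W x - z * U x)"
    using canc unfolding G_def by blast
qed

end

section \<open>A model resolvent\<close>

lemma abs_cont_reflect:
  assumes "abs_cont u g"
  shows "abs_cont (\<lambda>x. u (- x)) (\<lambda>x. - g (- x))"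
proof (rule acI)
  show "(\<lambda>x. - g (- x)) absolutely_integrable_on {a..b}" for a b
  proof -
    have "(\<lambda>x. g (- x)) absolutely_integrable_on {- (- a).. - (- b)}"
      using acD(1)[OF assms, of "-b" "-a"] by (subst absolutely_integrable_reflect_real) simp
    then have "(\<lambda>x. (-1) * g (- x)) absolutely_integrable_on {a..b}"
      by (intro set_integrable_mult_right) simp
    then show ?thesis by simp
  qed
  show "((\<lambda>x. - g (- x)) has_integral u (- b) - u (- a)) {a..b}" if "a \<le> b" for a b
  proof -
    have "(g has_integral (u (- a) - u (- b))) {-b..-a}" using that by (intro acD(4)[OF assms]) simp
    then have "((\<lambda>x. g (- x)) has_integral (u (- a) - u (- b))) {a..b}"
      using has_integral_reflect_real[of g "u (-a) - u (-b)" "-a" "-b"] by simp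
    from has_integral_neg[OF this] show ?thesis by simp
  qed
qed

lemma L2_reflect:
  assumes "f \<in> L2"
  shows "(\<lambda>x. f (- x)) \<in> L2"
  unfolding L2_iff
proof
  show "(\<lambda>x. f (- x)) \<in> borel_measurable lebesgue"
    using borel_measurable_affine[OF L2_measurable[OF assms], of "-1" 0] by simp
  show "integrable lebesgue (\<lambda>x. (cmod (f (- x)))\<^sup>2)"
    using lebesgue_integrable_real_affine[OF L2_sq_integrable[OF assms], of "-1" 0] by simp
qed

text \<open>The square root of the kernel of \<open>(d/dx + k)\<^sup>-\<^sup>1\<close>: splitting the kernel evenly between the two
  factors of the Cauchy--Schwarz inequality bounds the convolution.\<close>
definition half_exp :: "real \<Rightarrow> real \<Rightarrow> real \<Rightarrow> real" where
  "half_exp k x y = indicator {..x} y * exp (- (k / 2) * (x - y))"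

lemma half_exp_sq: "(half_exp k x y)\<^sup>2 = indicator {..x} y * exp (- k * (x - y))"
proof -
  have "(exp (- (k / 2) * (x - y)))\<^sup>2 = exp (- k * (x - y))"
    by (simp add: power2_eq_square mult_exp_exp)
  then show ?thesis by (simp add: half_exp_def power_mult_distrib indicator_def)
qed

lemma nn_integral_exp_half_line:
  assumes "k > 0"
  shows "(\<integral>\<^sup>+s. ennreal (indicator {0..} s * exp (- k * s)) \<partial>lebesgue) = ennreal (1 / k)"
proof -
  have "(\<integral>\<^sup>+s. ennreal (exp (- k * s)) * indicator {0..} s \<partial>lborel) = ennreal (0 - (- exp (- k * 0) / k))"
  proof (rule nn_integral_FTC_atLeast)
    show "((\<lambda>s. - exp (- k * s) / k) has_real_derivative exp (- k * x)) (at x)" for x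
      using assms by (auto intro!: derivative_eq_intros)
    have "((\<lambda>s. exp (- (k * s))) \<longlongrightarrow> 0) at_top"
      by (rule filterlim_compose[OF exp_at_bot])
        (intro filterlim_uminus_at_bot_at_top[THEN filterlim_compose] filterlim_tendsto_pos_mult_at_top[OF tendsto_const assms filterlim_ident])
    from tendsto_divide[OF tendsto_minus[OF this] tendsto_const[of k]] assms
    show "((\<lambda>s. - exp (- k * s) / k) \<longlongrightarrow> 0) at_top" by simp
  qed auto
  moreover have "ennreal (exp (- k * s)) * indicator {0..} s = ennreal (indicator {0..} s * exp (- k * s))" for s
    by (auto simp: indicator_def)
  ultimately show ?thesis by (simp add: nn_integral_completion)
qed

lemma nn_integral_half_exp:
  assumes k: "k > 0"
  shows "(\<integral>\<^sup>+y. ennreal ((half_exp k x y)\<^sup>2) \<partial>lebesgue) = ennreal (1 / k)"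
    and "(\<integral>\<^sup>+x. ennreal ((half_exp k x y)\<^sup>2) \<partial>lebesgue) = ennreal (1 / k)"
proof -
  have "(\<lambda>y. ennreal ((half_exp k x y)\<^sup>2)) \<in> borel_measurable borel"
    unfolding half_exp_sq by measurable
  then have m1: "(\<lambda>y. ennreal ((half_exp k x y)\<^sup>2)) \<in> borel_measurable lebesgue"
    by (intro measurable_completion) simp
  have "(\<integral>\<^sup>+y. ennreal ((half_exp k x y)\<^sup>2) \<partial>lebesgue)
      = ennreal \<bar>-1\<bar> * (\<integral>\<^sup>+s. ennreal ((half_exp k x (x + (-1) * s))\<^sup>2) \<partial>lebesgue)"
    by (rule nn_integral_real_affine_lebesgue[OF m1]) simp
  also have "(\<lambda>s. ennreal ((half_exp k x (x + (-1) * s))\<^sup>2)) = (\<lambda>s. ennreal (indicator {0..} s * exp (- k * s)))"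
    by (auto simp: half_exp_sq indicator_def)
  finally show "(\<integral>\<^sup>+y. ennreal ((half_exp k x y)\<^sup>2) \<partial>lebesgue) = ennreal (1 / k)"
    using nn_integral_exp_half_line[OF k] by simp
  have e: "(half_exp k x y)\<^sup>2 = indicator {y..} x * exp (- k * (x - y))" for x y
    by (auto simp: half_exp_sq indicator_def)
  have "(\<lambda>x. ennreal ((half_exp k x y)\<^sup>2)) \<in> borel_measurable borel"
    unfolding e by measurable
  then have m2: "(\<lambda>x. ennreal ((half_exp k x y)\<^sup>2)) \<in> borel_measurable lebesgue"
    by (intro measurable_completion) simp
  have "(\<integral>\<^sup>+x. ennreal ((half_exp k x y)\<^sup>2) \<partial>lebesgue)
      = ennreal \<bar>1\<bar> * (\<integral>\<^sup>+s. ennreal ((half_exp k (y + 1 * s) y)\<^sup>2) \<partial>lebesgue)"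
    by (rule nn_integral_real_affine_lebesgue[OF m2]) simp
  also have "(\<lambda>s. ennreal ((half_exp k (y + 1 * s) y)\<^sup>2)) = (\<lambda>s. ennreal (indicator {0..} s * exp (- k * s)))"
    by (auto simp: half_exp_sq indicator_def)
  finally show "(\<integral>\<^sup>+x. ennreal ((half_exp k x y)\<^sup>2) \<partial>lebesgue) = ennreal (1 / k)"
    using nn_integral_exp_half_line[OF k] by simp
qed

text \<open>The solution is the convolution of f with exp(-k s) on s \<ge> 0. The kernel integrates
  to 1/k in either variable, so Schur's test makes the convolution square-integrable.\<close>

lemma first_order_solution:
  assumes f: "f \<in> L2" and k: "k > 0"
  obtains v where "v \<in> L2" "abs_cont v (\<lambda>x. f x - of_real k * v x)"
proof -
  define h where "h x y = complex_of_real (half_exp k x y)" for x y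
  \<comment> \<open>The integrating factor: v is exp(-k x) times the primitive of g from minus
    infinity, which exhibits v as absolutely continuous.\<close>
  define g where "g y = complex_of_real (exp (k * y)) * f y" for y
  define G where "G x = set_lebesgue_integral lebesgue {..x} g" for x
  define v where "v x = complex_of_real (exp (- k * x)) * G x" for x
  have hm: "h x \<in> borel_measurable lebesgue" for x
  proof -
    have "h x \<in> borel_measurable borel" unfolding h_def[abs_def] half_exp_def by measurable
    then show ?thesis by (intro measurable_completion) simp
  qed
  have hL: "h x \<in> L2" and hN: "(N2 (h x))\<^sup>2 = 1 / k" for x
  proof -
    have fin: "(\<integral>\<^sup>+y. ennreal ((cmod (h x y))\<^sup>2) \<partial>lebesgue) = ennreal (1 / k)"
      using nn_integral_half_exp(1)[OF k] by (simp add: h_def)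
    then show hL: "h x \<in> L2"
      unfolding L2_iff using hm[of x] by (auto intro!: integrableI_nn_integral_finite)
    show "(N2 (h x))\<^sup>2 = 1 / k"
      using nn_integral_sq_N2[OF hL] fin k by simp
  qed
  have h1: "cmod (h x y) \<le> 1" for x y
  proof -
    have "exp (- (k / 2) * (x - y)) \<le> 1" if "y \<le> x"
      using k that by (simp add: mult_nonneg_nonneg)
    then show ?thesis by (auto simp: h_def half_exp_def indicator_def)
  qed
  have hfL: "(\<lambda>y. h x y * f y) \<in> L2" for x
    by (rule L2_mult_bounded(1)[OF f hm, of _ 1]) (auto simp: h1)
  have hhf: "h x y * (h x y * f y) = complex_of_real (exp (- k * x)) * (indicator {..x} y *\<^sub>R g y)" for x y
  proof -
    have "h x y * h x y = complex_of_real ((half_exp k x y)\<^sup>2)" by (simp add: h_def power2_eq_square)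
    also have "\<dots> = complex_of_real (exp (- k * x)) * (indicator {..x} y * complex_of_real (exp (k * y)))"
      by (simp add: half_exp_sq indicator_def right_diff_distrib exp_diff exp_minus field_simps
          flip: of_real_mult)
    finally show ?thesis by (simp add: g_def indicator_def mult.assoc[symmetric])
  qed
  have gint: "set_integrable lebesgue {..x} g" for x
  proof -
    have "integrable lebesgue (\<lambda>y. complex_of_real (exp (k * x)) * (h x y * (h x y * f y)))"
      by (intro integrable_mult_right L2_prod_integrable hL hfL)
    then show ?thesis
      unfolding hhf set_integrable_def
      by (simp add: mult.assoc[symmetric] exp_minus flip: of_real_mult)
  qed
  have v_eq: "v x = integral\<^sup>L lebesgue (\<lambda>y. h x y * (h x y * f y))" for x
    unfolding hhf v_def G_def set_lebesgue_integral_def by (simp only: integral_mult_right_zero)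
  have acG: "abs_cont G g"
  proof (rule acI)
    show gab: "g absolutely_integrable_on {a..b}" for a b
      by (rule set_integrable_subset[OF gint[of b]]) auto
    fix a b :: real assume ab: "a \<le> b"
    have i: "(g has_integral G x) {..x}" for x
      using set_lebesgue_integral_eq_integral[OF gint[of x]] by (simp add: G_def has_integral_integral)
    have "(g has_integral integral {a..b} g) {a..b}"
      using gab[of a b] by (auto simp: absolutely_integrable_on_def)
    moreover have "negligible ({..a} \<inter> {a..b})"
    proof -
      have "{..a} \<inter> {a..b} \<subseteq> {a}" by auto
      then show ?thesis using negligible_subset negligible_sing by blast
    qed
    ultimately have "(g has_integral (G a + integral {a..b} g)) ({..a} \<union> {a..b})"
      using i[of a] by (intro has_integral_Un)
    also have "{..a} \<union> {a..b} = {..b}" using ab by auto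
    finally have "G b = G a + integral {a..b} g" using i[of b] has_integral_unique by blast
    then show "(g has_integral G b - G a) {a..b}"
      using \<open>(g has_integral integral {a..b} g) {a..b}\<close> by simp
  qed
  have ace: "abs_cont (\<lambda>x. complex_of_real (exp (- k * x))) (\<lambda>x. complex_of_real (- k * exp (- k * x)))"
  proof (rule abs_cont_C1)
    show "((\<lambda>x. complex_of_real (exp (- k * x))) has_vector_derivative complex_of_real (- k * exp (- k * x))) (at x)" for x
      by (intro has_vector_derivative_of_real)
        (auto intro!: derivative_eq_intros simp: has_real_derivative_iff_has_vector_derivative[symmetric])
  qed (intro continuous_intros)
  have acv: "abs_cont v (\<lambda>x. f x - of_real k * v x)"
  proof (rule abs_cont_cong[OF abs_cont_mult[OF ace acG]])
    show "complex_of_real (exp (- k * x)) * G x = v x" for x by (simp add: v_def)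
    have "complex_of_real (exp (- k * x)) * g x = f x" for x
      by (simp add: g_def mult.assoc[symmetric] exp_minus flip: of_real_mult)
    then show "AE x in lebesgue. complex_of_real (- k * exp (- k * x)) * G x + complex_of_real (exp (- k * x)) * g x
        = f x - complex_of_real k * v x"
      by (simp add: v_def)
  qed
  have vm: "v \<in> borel_measurable lebesgue"
    by (intro measurable_completion) (simp add: borel_measurable_continuous_onI[OF abs_cont_continuous_on[OF acv]])
  define F where "F x y = ennreal ((half_exp k x y)\<^sup>2) * ennreal ((cmod (f y))\<^sup>2)" for x y
  have Fm: "case_prod F \<in> borel_measurable (lebesgue \<Otimes>\<^sub>M lebesgue)"
  proof -
    define T where "T = {p \<in> space (lebesgue \<Otimes>\<^sub>M lebesgue). snd p \<le> (fst p :: real)}"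
    have T: "T \<in> sets (lebesgue \<Otimes>\<^sub>M lebesgue)"
      unfolding T_def using pair_fst_snd_measurable by (intro borel_measurable_le)
    have fm: "(\<lambda>p. f (snd p)) \<in> borel_measurable (lebesgue \<Otimes>\<^sub>M lebesgue :: (real \<times> real) measure)"
      by (rule measurable_compose[OF measurable_snd L2_measurable[OF f]])
    have "(\<lambda>p. ennreal (indicator T p * exp (- k * (fst p - snd p))) * ennreal ((cmod (f (snd p)))\<^sup>2))
        \<in> borel_measurable (lebesgue \<Otimes>\<^sub>M lebesgue)"
      using T fm pair_fst_snd_measurable by measurable
    also have "(\<lambda>p. ennreal (indicator T p * exp (- k * (fst p - snd p))) * ennreal ((cmod (f (snd p)))\<^sup>2)) = case_prod F"
      by (auto simp: F_def half_exp_sq T_def indicator_def space_pair_measure fun_eq_iff)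
    finally show ?thesis .
  qed
  \<comment> \<open>One half of the kernel goes with f and the other stands alone; the latter
    contributes the factor 1/k.\<close>
  have vb: "ennreal ((cmod (v x))\<^sup>2) \<le> ennreal (1 / k) * (\<integral>\<^sup>+y. F x y \<partial>lebesgue)" for x
  proof -
    have "cmod (v x) \<le> N2 (h x) * N2 (\<lambda>y. h x y * f y)"
      unfolding v_eq by (rule L2_Cauchy_Schwarz(2)[OF hL hfL])
    then have "(cmod (v x))\<^sup>2 \<le> (N2 (h x) * N2 (\<lambda>y. h x y * f y))\<^sup>2"
      by (rule power_mono) simp
    also have "\<dots> = 1 / k * (N2 (\<lambda>y. h x y * f y))\<^sup>2" by (simp add: power_mult_distrib hN)
    finally have "ennreal ((cmod (v x))\<^sup>2) \<le> ennreal (1 / k) * ennreal ((N2 (\<lambda>y. h x y * f y))\<^sup>2)"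
      using k by (simp add: ennreal_leI flip: ennreal_mult)
    also have "ennreal ((N2 (\<lambda>y. h x y * f y))\<^sup>2) = (\<integral>\<^sup>+y. F x y \<partial>lebesgue)"
      unfolding nn_integral_sq_N2[OF hfL, symmetric] F_def
      by (intro nn_integral_cong) (simp add: h_def norm_mult power_mult_distrib ennreal_mult)
    finally show ?thesis .
  qed
  have "(\<integral>\<^sup>+x. ennreal ((cmod (v x))\<^sup>2) \<partial>lebesgue) \<le> (\<integral>\<^sup>+x. ennreal (1 / k) * (\<integral>\<^sup>+y. F x y \<partial>lebesgue) \<partial>lebesgue)"
    by (intro nn_integral_mono vb)
  also have "\<dots> = ennreal (1 / k) * (\<integral>\<^sup>+x. (\<integral>\<^sup>+y. F x y \<partial>lebesgue) \<partial>lebesgue)"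
    by (rule nn_integral_cmult) (rule lebesgue.borel_measurable_nn_integral[OF Fm])
  also have "(\<integral>\<^sup>+x. (\<integral>\<^sup>+y. F x y \<partial>lebesgue) \<partial>lebesgue) = (\<integral>\<^sup>+y. (\<integral>\<^sup>+x. F x y \<partial>lebesgue) \<partial>lebesgue)"
    by (rule lebesgue_pair.Fubini'[OF Fm, symmetric])
  also have "\<dots> = (\<integral>\<^sup>+y. ennreal (1 / k) * ennreal ((cmod (f y))\<^sup>2) \<partial>lebesgue)"
  proof (rule nn_integral_cong)
    fix y :: real
    have "(\<lambda>x. ennreal ((half_exp k x y)\<^sup>2)) \<in> borel_measurable borel"
    proof -
      have e: "(half_exp k x y)\<^sup>2 = indicator {y..} x * exp (- k * (x - y))" for x y
        by (auto simp: half_exp_sq indicator_def)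
      show ?thesis unfolding e by measurable
    qed
    then have "(\<lambda>x. ennreal ((half_exp k x y)\<^sup>2)) \<in> borel_measurable lebesgue"
      by (intro measurable_completion) simp
    then show "(\<integral>\<^sup>+x. F x y \<partial>lebesgue) = ennreal (1 / k) * ennreal ((cmod (f y))\<^sup>2)"
      unfolding F_def by (simp add: nn_integral_multc nn_integral_half_exp(2)[OF k])
  qed
  also have "\<dots> = ennreal (1 / k) * ennreal ((N2 f)\<^sup>2)"
    unfolding nn_integral_sq_N2[OF f, symmetric] using L2_measurable[OF f]
    by (intro nn_integral_cmult) measurable
  also have "ennreal (1 / k) * (ennreal (1 / k) * ennreal ((N2 f)\<^sup>2)) = ennreal (1 / k * (1 / k * (N2 f)\<^sup>2))"
    using k by (simp flip: ennreal_mult)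
  finally have "(\<integral>\<^sup>+x. ennreal ((cmod (v x))\<^sup>2) \<partial>lebesgue) < \<infinity>"
    by (rule le_less_trans) simp
  then have "integrable lebesgue (\<lambda>x. (cmod (v x))\<^sup>2)"
    using vm by (intro integrableI_bounded) auto
  then have "v \<in> L2" using vm by (simp add: L2_iff)
  with acv show ?thesis using that by blast
qed

lemma first_order_solution_reflected:
  assumes f: "f \<in> L2" and k: "k > 0"
  obtains v where "v \<in> L2" "abs_cont v (\<lambda>x. of_real k * v x - f x)"
proof -
  obtain w where w: "w \<in> L2" "abs_cont w (\<lambda>x. f (- x) - of_real k * w x)"
    using first_order_solution[OF L2_reflect[OF f] k] by blast
  show ?thesis
  proof (rule that)
    show "(\<lambda>x. w (- x)) \<in> L2" by (rule L2_reflect[OF w(1)])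
    show "abs_cont (\<lambda>x. w (- x)) (\<lambda>x. of_real k * w (- x) - f x)"
      using abs_cont_reflect[OF w(2)] by simp
  qed
qed

lemma abs_cont_const: "abs_cont (\<lambda>x. c) (\<lambda>x. 0)"
  by (rule abs_cont_C1) (auto intro!: derivative_eq_intros)

interpretation model: bounded_coeffs "\<lambda>_. 1" "\<lambda>_. 0" "\<lambda>_. 0" 1 1 0 0
  by standard (auto intro: abs_cont_const)

text \<open>The operator factors as (d/dx + k)(-d/dx + k). The first factor is inverted by
  \<open>first_order_solution\<close>, the second by its mirror image.\<close>

lemma model_onto:
  assumes "k > 0"
  shows "onto_op (\<lambda>u x. sl_op UNIV (\<lambda>_. 1) (\<lambda>_. 0) u x + of_real (k\<^sup>2) * u x)"
  unfolding onto_op_def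
proof
  fix f :: "real \<Rightarrow> complex" assume f: "f \<in> L2"
  obtain v where v: "v \<in> L2" "abs_cont v (\<lambda>x. f x - of_real k * v x)"
    by (rule first_order_solution[OF f assms])
  obtain u where u: "u \<in> L2" "abs_cont u (\<lambda>x. of_real k * u x - v x)"
    by (rule first_order_solution_reflected[OF v(1) assms])
  define V where "V x = of_real k * u x - v x" for x
  define W where "W x = of_real (k\<^sup>2) * u x - f x" for x
  have "abs_cont V (\<lambda>x. of_real k * (of_real k * u x - v x) - (f x - of_real k * v x))"
    unfolding V_def[abs_def] by (intro abs_cont_diff abs_cont_cmult u v)
  then have "abs_cont V W"
    by (rule abs_cont_cong) (auto simp: W_def algebra_simps power2_eq_square)
  then have t: "W22_repr u V W"
    using u v f unfolding W22_repr_def V_def[abs_def] W_def[abs_def] by (auto intro!: L2_diff L2_scale)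
  have "ae_eq UNIV (\<lambda>x. sl_op UNIV (\<lambda>_. 1) (\<lambda>_. 0) u x + of_real (k\<^sup>2) * u x) f"
    using model.sl_op_ae_eq[OF t ae_eq_refl] unfolding ae_eq_UNIV_iff
    by eventually_elim (simp add: model.sl_def W_def)
  moreover have "u \<in> W22R" by (rule W22_repr_imp_W22(1)[OF t ae_eq_refl])
  ultimately show "\<exists>u\<in>W22R. ae_eq UNIV (\<lambda>x. sl_op UNIV (\<lambda>_. 1) (\<lambda>_. 0) u x + of_real (k\<^sup>2) * u x) f"
    by blast
qed

section \<open>Surjectivity\<close>

lemma lin_op_id: "lin_op (\<lambda>u. u)"
  by (auto simp: linear_W22_L2_def W22_L2)

context bounded_coeffs
begin

lemma sl_N2_le:
  assumes "W22_repr U V W"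
  shows "N2 (sl U V W) \<le> (q1 + p2 + p1) * repr_norm U V W"
proof -
  note T = W22_reprD[OF assms]
  have le: "N2 U \<le> repr_norm U V W" "N2 V \<le> repr_norm U V W" "N2 W \<le> repr_norm U V W"
    unfolding repr_norm_def by (auto intro!: real_le_rsqrt)
  have "N2 (sl U V W) \<le> N2 (\<lambda>x. of_real (q x) * U x)
      + N2 (\<lambda>x. of_real (P' x) * V x + of_real (P x) * W x)"
    unfolding sl_def[abs_def] by (intro N2_triangle_diff L2_add L2_PP'q T)
  also have "N2 (\<lambda>x. of_real (P' x) * V x + of_real (P x) * W x)
      \<le> N2 (\<lambda>x. of_real (P' x) * V x) + N2 (\<lambda>x. of_real (P x) * W x)"
    by (intro N2_triangle L2_PP'q T)
  also have "N2 (\<lambda>x. of_real (q x) * U x) \<le> q1 * repr_norm U V W"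
    using L2_PP'q(6)[OF T(3)] mult_left_mono[OF le(1) nonneg(3)] by linarith
  also have "N2 (\<lambda>x. of_real (P' x) * V x) \<le> p2 * repr_norm U V W"
    using L2_PP'q(4)[OF T(4)] mult_left_mono[OF le(2) nonneg(2)] by linarith
  also have "N2 (\<lambda>x. of_real (P x) * W x) \<le> p1 * repr_norm U V W"
    using L2_PP'q(2)[OF T(5)] mult_left_mono[OF le(3) nonneg(1)] by linarith
  finally show ?thesis by (simp add: algebra_simps)
qed

lemma sl_op_N2_le:
  assumes "u \<in> W22R"
  shows "N2 (sl_op UNIV P q u) \<le> (q1 + p2 + p1) * Wnorm u"
proof -
  obtain U V W where t: "W22_repr U V W" "ae_eq UNIV u U" by (rule W22_obtain_repr[OF assms])
  have "N2 (sl_op UNIV P q u) = N2 (sl U V W)"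
    by (rule L2_cong(2)[OF ae_eq_sym[OF sl_op_ae_eq[OF t]] sl_L2[OF t(1)]])
  then show ?thesis using sl_N2_le[OF t(1)] W22_repr_imp_W22(4)[OF t] by simp
qed

abbreviation (input) "CW \<equiv> W2_const p0 p2 q1"

lemma CW_pos: "0 < CW"
  unfolding W2_const_def using p0 nonneg
  by (intro add_pos_nonneg add_nonneg_nonneg divide_nonneg_nonneg mult_nonneg_nonneg) auto

text \<open>Removing the shift costs |z| times \<open>N2 U\<close>, and the assumed lower bound pays
  for \<open>N2 U\<close>. This is the source of the factor 1 + (|z| + 1) / d.\<close>

lemma repr_norm_le_shifted:
  assumes t: "W22_repr U V W" and d: "0 < d" "d * N2 U \<le> N2 (\<lambda>x. sl U V W x - z * U x)"
  shows "repr_norm U V W \<le> CW * (1 + (cmod z + 1) / d) * N2 (\<lambda>x. sl U V W x - z * U x)"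
proof -
  note T = W22_reprD[OF t] and S = sl_L2[OF t]
  define g where "g = N2 (\<lambda>x. sl U V W x - z * U x)"
  have "N2 (sl U V W) = N2 (\<lambda>x. (sl U V W x - z * U x) + z * U x)" by simp
  also have "\<dots> \<le> g + N2 (\<lambda>x. z * U x)"
    unfolding g_def by (intro N2_triangle L2_diff S L2_scale T)
  finally have "N2 (sl U V W) + N2 U \<le> g + (cmod z + 1) * N2 U"
    by (simp add: N2_scale distrib_right)
  also have "\<dots> \<le> g + (cmod z + 1) * (g / d)"
    using d by (intro add_left_mono mult_left_mono) (auto simp: g_def field_simps)
  also have "\<dots> = (1 + (cmod z + 1) / d) * g" by (simp add: field_simps)
  finally have "CW * (N2 (sl U V W) + N2 U) \<le> CW * ((1 + (cmod z + 1) / d) * g)"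
    using CW_pos by (intro mult_left_mono) auto
  then show ?thesis using repr_norm_bound[OF t] by (simp add: g_def mult.assoc)
qed

text \<open>A homotopy from -u'' to the given expression. All intermediate forms are bounded below
  by -q1, so the spectral value -(q1 + 1) stays at distance one from that bound throughout.\<close>

lemma shifted_onto:
  defines "K \<equiv> q1 + 1"
  shows "onto_op (\<lambda>u x. sl_op UNIV P q u x + of_real K * u x)"
proof -
  define A where "A u x = sl_op UNIV (\<lambda>_. 1) (\<lambda>_. 0) u x + of_real K * u x" for u x
  define B where "B u x = sl_op UNIV P q u x + (-1) * sl_op UNIV (\<lambda>_. 1) (\<lambda>_. 0) u x" for u x
  have K: "K > 0" using nonneg by (simp add: K_def)
  define C where "C = W2_const (min 1 p0) p2 q1"
  have "onto_op (\<lambda>u x. A u x + B u x)"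
  proof (rule method_of_continuity)
    show "lin_op A" unfolding A_def[abs_def] by (rule lin_op_lincomb[OF model.lin_op_sl lin_op_id])
    show "lin_op B" unfolding B_def[abs_def] by (rule lin_op_lincomb[OF lin_op_sl model.lin_op_sl])
    have "sqrt K > 0" "(sqrt K)\<^sup>2 = K" using K by auto
    then show "onto_op A" unfolding A_def[abs_def] using model_onto[of "sqrt K"] by simp
    have Cpos: "0 < C"
      unfolding C_def W2_const_def using p0 nonneg
      by (intro add_pos_nonneg add_nonneg_nonneg divide_nonneg_nonneg mult_nonneg_nonneg) auto
    then show "0 < 1 / (C * (K + 2))" using K by simp
    show "N2 (B u) \<le> ((q1 + p2 + p1) + 1) * Wnorm u" if u: "u \<in> W22R" for u
    proof -
      have "N2 (B u) \<le> N2 (sl_op UNIV P q u) + N2 (\<lambda>x. (-1) * sl_op UNIV (\<lambda>_. 1) (\<lambda>_. 0) u x)"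
        unfolding B_def[abs_def]
        by (intro N2_triangle L2_scale lin_opD(1)[OF lin_op_sl u] lin_opD(1)[OF model.lin_op_sl u])
      also have "N2 (\<lambda>x. (-1) * sl_op UNIV (\<lambda>_. 1) (\<lambda>_. 0) u x) = N2 (sl_op UNIV (\<lambda>_. 1) (\<lambda>_. 0) u)"
        by (subst N2_scale) simp
      finally show ?thesis
        using sl_op_N2_le[OF u] model.sl_op_N2_le[OF u] by (simp add: algebra_simps)
    qed
    fix t :: real and u assume t: "0 \<le> t" "t \<le> 1" and u: "u \<in> W22R"
    define Pt where "Pt x = 1 + t * (P x - 1)" for x
    define qt where "qt x = t * q x" for x
    \<comment> \<open>Convex combinations with the model: \<open>min 1 p0\<close> and
      \<open>max 1 p1\<close> are bounds at both ends, hence in between, and no constant depends on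
      t.\<close>
    interpret T: bounded_coeffs Pt "\<lambda>x. t * P' x" qt "min 1 p0" "max 1 p1" p2 q1
    proof
      show "0 < min 1 p0" using p0 by simp
      show "min 1 p0 \<le> Pt x" for x
      proof -
        have "min 1 p0 = (1 - t) * min 1 p0 + t * min 1 p0" by (simp add: algebra_simps)
        also have "\<dots> \<le> (1 - t) * 1 + t * P x"
          using t P_ge[of x] by (intro add_mono mult_left_mono) auto
        finally show ?thesis by (simp add: Pt_def algebra_simps)
      qed
      show "Pt x \<le> max 1 p1" for x
      proof -
        have "Pt x = (1 - t) * 1 + t * P x" by (simp add: Pt_def algebra_simps)
        also have "\<dots> \<le> (1 - t) * max 1 p1 + t * max 1 p1"
          using t P_le[of x] by (intro add_mono mult_left_mono) auto
        finally show ?thesis by (simp add: algebra_simps)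
      qed
      have tle: "\<bar>t * y\<bar> \<le> b" if "\<bar>y\<bar> \<le> b" for y b :: real
      proof -
        have "\<bar>t\<bar> * \<bar>y\<bar> \<le> 1 * b" using t that by (intro mult_mono) auto
        then show ?thesis by (simp add: abs_mult)
      qed
      show "\<bar>t * P' x\<bar> \<le> p2" for x by (rule tle[OF P'_le])
      show "\<bar>qt x\<bar> \<le> q1" for x unfolding qt_def by (rule tle[OF q_le])
      show "(\<lambda>x. t * P' x) \<in> borel_measurable lebesgue" using P'_meas by simp
      show "qt \<in> borel_measurable lebesgue" unfolding qt_def[abs_def] using q_meas by simp
      have "abs_cont (\<lambda>x. of_real (1 - t) * 1 + of_real t * of_real (P x)) (\<lambda>x. of_real (1 - t) * 0 + of_real t * of_real (P' x))"
        by (rule abs_cont_lincomb[OF abs_cont_const acP])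
      then show "abs_cont (\<lambda>x. complex_of_real (Pt x)) (\<lambda>x. complex_of_real (t * P' x))"
        by (rule abs_cont_cong) (auto simp: Pt_def algebra_simps)
    qed
    obtain U V W where tr: "W22_repr U V W" "ae_eq UNIV u U" by (rule W22_obtain_repr[OF u])
    note TT = W22_reprD[OF tr(1)]
    have "- q1 * (N2 U)\<^sup>2 \<le> T.form U V"
    proof -
      have "0 \<le> min 1 p0 * (N2 V)\<^sup>2" using p0 by simp
      then show ?thesis using T.form_ge[OF TT(3,4)] by linarith
    qed
    from T.sl_lower(2)[OF tr(1) this, of "of_real (- K)"]
    have low: "1 * N2 U \<le> N2 (\<lambda>x. T.sl U V W x - of_real (- K) * U x)" by (simp add: K_def)
    have eq: "ae_eq UNIV (\<lambda>x. T.sl U V W x - of_real (- K) * U x) (\<lambda>x. A u x + of_real t * B u x)"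
      using model.sl_op_ae_eq[OF tr] sl_op_ae_eq[OF tr] tr(2) unfolding ae_eq_UNIV_iff
    proof eventually_elim
      case (elim x)
      show ?case
        unfolding A_def B_def elim T.sl_def sl_def model.sl_def Pt_def qt_def by (simp add: algebra_simps)
    qed
    have "N2 (\<lambda>x. A u x + of_real t * B u x) = N2 (\<lambda>x. T.sl U V W x - of_real (- K) * U x)"
      by (rule L2_cong(2)[OF eq]) (intro L2_diff T.sl_L2[OF tr(1)] L2_scale TT)
    \<comment> \<open>With d = 1 and |z| = K the factor 1 + (|z| + 1) / d becomes K + 2.\<close>
    moreover have "repr_norm U V W \<le> C * (K + 2) * N2 (\<lambda>x. T.sl U V W x - of_real (- K) * U x)"
      using T.repr_norm_le_shifted[OF tr(1) _ low] K by (simp add: C_def add.commute)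
    ultimately have "Wnorm u \<le> C * (K + 2) * N2 (\<lambda>x. A u x + of_real t * B u x)"
      using W22_repr_imp_W22(4)[OF tr] by simp
    then show "1 / (C * (K + 2)) * Wnorm u \<le> N2 (\<lambda>x. A u x + of_real t * B u x)"
      using Cpos K by (simp add: divide_le_eq mult.commute mult.left_commute)
  qed
  moreover have "(\<lambda>u x. A u x + B u x) = (\<lambda>u x. sl_op UNIV P q u x + of_real K * u x)"
    by (simp add: A_def B_def fun_eq_iff)
  ultimately show ?thesis by simp
qed

section \<open>Lower bounds of the quadratic form and the resolvent\<close>

definition form_bound :: "real \<Rightarrow> bool" where
  "form_bound m \<longleftrightarrow> (\<forall>U V W. W22_repr U V W \<longrightarrow> m * (N2 U)\<^sup>2 \<le> form U V)"

lemma form_bound_q1: "form_bound (- q1)"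
  unfolding form_bound_def
proof safe
  fix U V W assume "W22_repr U V W"
  note T = W22_reprD[OF this]
  have "0 \<le> p0 * (N2 V)\<^sup>2" using p0 by simp
  then show "- q1 * (N2 U)\<^sup>2 \<le> form U V" using form_ge[OF T(3,4)] by linarith
qed

text \<open>When positive, this is the distance of z from the half-line of reals \<ge> m, up to a
  factor of at most sqrt 2.\<close>

definition gap :: "real \<Rightarrow> complex \<Rightarrow> real" where
  "gap m z = max \<bar>Im z\<bar> (m - Re z)"

lemma gap_lower:
  assumes "form_bound m" "W22_repr U V W"
  shows "gap m z * N2 U \<le> N2 (\<lambda>x. sl U V W x - z * U x)"
proof -
  have "m * (N2 U)\<^sup>2 \<le> form U V" using assms by (auto simp: form_bound_def)
  from sl_lower[OF assms(2) this, of z] show ?thesis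
    by (auto simp: gap_def max_def)
qed

lemma resolvent_lower:
  assumes m: "form_bound m" and u: "u \<in> W22R" and d: "0 < d" "d \<le> gap m z"
  shows "d * N2 u \<le> N2 (\<lambda>x. sl_op UNIV P q u x - z * u x)"
    and "Wnorm u \<le> CW * (1 + (cmod z + 1) / d) * N2 (\<lambda>x. sl_op UNIV P q u x - z * u x)"
proof -
  obtain U V W where t: "W22_repr U V W" "ae_eq UNIV u U" by (rule W22_obtain_repr[OF u])
  note TT = W22_reprD[OF t(1)]
  have eq: "ae_eq UNIV (\<lambda>x. sl U V W x - z * U x) (\<lambda>x. sl_op UNIV P q u x - z * u x)"
    using sl_op_ae_eq[OF t] t(2) unfolding ae_eq_UNIV_iff by eventually_elim simp
  have N: "N2 (\<lambda>x. sl_op UNIV P q u x - z * u x) = N2 (\<lambda>x. sl U V W x - z * U x)"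
    by (rule L2_cong(2)[OF eq]) (intro L2_diff sl_L2[OF t(1)] L2_scale TT)
  have NU: "N2 u = N2 U" by (rule L2_cong(2)[OF ae_eq_sym[OF t(2)] TT(3)])
  have "d * N2 U \<le> gap m z * N2 U" by (rule mult_right_mono[OF d(2)]) simp
  with gap_lower[OF m t(1), of z] have low: "d * N2 U \<le> N2 (\<lambda>x. sl U V W x - z * U x)" by linarith
  then show "d * N2 u \<le> N2 (\<lambda>x. sl_op UNIV P q u x - z * u x)" by (simp add: N NU)
  show "Wnorm u \<le> CW * (1 + (cmod z + 1) / d) * N2 (\<lambda>x. sl_op UNIV P q u x - z * u x)"
    using repr_norm_le_shifted[OF t(1) d(1) low] by (simp add: N W22_repr_imp_W22(4)[OF t])
qed

text \<open>The spectral value moves along the segment from -K, which lies at least one unit to the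
  left of m, to z. The number \<open>d\<close> is a common positive lower bound for the gap on the
  segment.\<close>

lemma resolvent_onto:
  assumes m: "form_bound m" "- q1 \<le> m" and z: "0 < gap m z"
  shows "onto_op (\<lambda>u x. sl_op UNIV P q u x - z * u x)"
proof -
  define K where "K = q1 + 1"
  define A where "A u x = sl_op UNIV P q u x + of_real K * u x" for u x
  define B where "B u x = - (z + of_real K) * u x" for u :: "real \<Rightarrow> complex" and x
  define zt where "zt t = of_real (- K) + of_real t * (z + of_real K)" for t :: real
  obtain d where d: "0 < d" "\<And>t. 0 \<le> t \<Longrightarrow> t \<le> 1 \<Longrightarrow> d \<le> gap m (zt t)"
  proof -
    define a where "a = m + K"
    have a: "a \<ge> 1" using m(2) by (simp add: a_def K_def)
    have re: "m - Re (zt t) = (1 - t) * a + t * (m - Re z)" for t by (simp add: zt_def a_def algebra_simps)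
    have im: "\<bar>Im (zt t)\<bar> = \<bar>t\<bar> * \<bar>Im z\<bar>" for t by (simp add: zt_def abs_mult)
    show ?thesis
    proof (cases "m - Re z > 0")
      case True
      show ?thesis
      proof (rule that)
        show "0 < min a (m - Re z)" using a True by simp
        fix t :: real assume t: "0 \<le> t" "t \<le> 1"
        have "min a (m - Re z) = (1 - t) * min a (m - Re z) + t * min a (m - Re z)" by (simp add: algebra_simps)
        also have "\<dots> \<le> (1 - t) * a + t * (m - Re z)" using t by (intro add_mono mult_left_mono) auto
        finally show "min a (m - Re z) \<le> gap m (zt t)" unfolding gap_def re by simp
      qed
    next
      case False
      define r where "r = Re z - m"
      have r: "r \<ge> 0" using False by (simp add: r_def)
      have b: "\<bar>Im z\<bar> > 0" using z False by (auto simp: gap_def)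
      \<comment> \<open>The real part leaves a gap of at least a / 2 as long as t (a + r) \<le> a /
        2, which holds up to \<open>t0\<close>. From there on the imaginary part contributes at
        least t0 |Im z|.\<close>
      define t0 where "t0 = a / (2 * (a + r))"
      have t0: "t0 > 0" "t0 * (a + r) = a / 2" using a r by (auto simp: t0_def field_simps)
      show ?thesis
      proof (rule that)
        show "0 < min (a / 2) (t0 * \<bar>Im z\<bar>)" using a b t0 by simp
        fix t :: real assume t: "0 \<le> t" "t \<le> 1"
        show "min (a / 2) (t0 * \<bar>Im z\<bar>) \<le> gap m (zt t)"
        proof (cases "t \<le> t0")
          case True
          have "t * (a + r) \<le> t0 * (a + r)" using True a r by (intro mult_right_mono) auto
          then have "a / 2 \<le> (1 - t) * a + t * (m - Re z)"
            using t0(2) by (simp add: r_def algebra_simps)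
          then show ?thesis unfolding gap_def re by simp
        next
          case False
          then have "t0 * \<bar>Im z\<bar> \<le> \<bar>t\<bar> * \<bar>Im z\<bar>" by (intro mult_right_mono) auto
          then show ?thesis unfolding gap_def im by simp
        qed
      qed
    qed
  qed
  define M where "M = K + cmod (z + of_real K)"
  define c where "c = CW * (1 + (M + 1) / d)"
  have K: "K > 0" using nonneg by (simp add: K_def)
  have c: "c > 0" unfolding c_def M_def using CW_pos K d(1)
    by (intro mult_pos_pos add_pos_nonneg divide_nonneg_nonneg add_nonneg_nonneg) auto
  have "onto_op (\<lambda>u x. A u x + B u x)"
  proof (rule method_of_continuity)
    show "lin_op A" unfolding A_def[abs_def] by (rule lin_op_lincomb[OF lin_op_sl lin_op_id])
    have "lin_op (\<lambda>u x. u x + (- 1 - (z + of_real K)) * u x)" by (rule lin_op_lincomb[OF lin_op_id lin_op_id])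
    then show "lin_op B" unfolding B_def[abs_def] by (simp add: algebra_simps)
    show "onto_op A" unfolding A_def[abs_def] K_def by (rule shifted_onto)
    show "0 < 1 / c" using c by simp
    show "N2 (B u) \<le> cmod (- (z + of_real K)) * Wnorm u" for u
      unfolding B_def N2_scale by (intro mult_left_mono N2_le_Wnorm) simp
    fix t :: real and u assume t: "0 \<le> t" "t \<le> 1" and u: "u \<in> W22R"
    have eq: "(\<lambda>x. A u x + of_real t * B u x) = (\<lambda>x. sl_op UNIV P q u x - zt t * u x)"
      by (simp add: A_def B_def zt_def fun_eq_iff algebra_simps)
    have "cmod (zt t) \<le> cmod (of_real (- K)) + cmod (of_real t * (z + of_real K))"
      unfolding zt_def by (rule norm_triangle_ineq)
    also have "\<dots> \<le> M"
      using t K unfolding M_def norm_mult norm_of_real by (intro add_mono) (auto intro: mult_left_le_one_le)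
    finally have "CW * (1 + (cmod (zt t) + 1) / d) \<le> c"
      unfolding c_def using CW_pos d(1) by (intro mult_left_mono add_left_mono divide_right_mono) auto
    then have "Wnorm u \<le> c * N2 (\<lambda>x. sl_op UNIV P q u x - zt t * u x)"
      using resolvent_lower(2)[OF m(1) u d(1) d(2)[OF t]]
      by (meson L2_norm_nonneg mult_right_mono order_trans)
    then show "1 / c * Wnorm u \<le> N2 (\<lambda>x. A u x + of_real t * B u x)"
      unfolding eq using c by (simp add: divide_le_eq mult.commute)
  qed
  moreover have "(\<lambda>u x. A u x + B u x) = (\<lambda>u x. sl_op UNIV P q u x - z * u x)"
    by (simp add: A_def B_def fun_eq_iff algebra_simps)
  ultimately show ?thesis by simp
qed

end

section \<open>Linear systems with bounded measurable coefficients\<close>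

text \<open>In the norm weighted by exp(-L |x|), integration gains a factor 1 / L. With L twice the
  Lipschitz constant of the system, Picard iteration contracts by 1/2 on the whole line at
  once.\<close>

lemma abs_cont_exp_bound:
  assumes abs_cont: "abs_cont G g" and L: "L > 0" and g: "\<And>t. cmod (g t) \<le> c * exp (L * \<bar>t\<bar>)" and G0: "G 0 = 0"
  shows "cmod (G x) \<le> c / L * exp (L * \<bar>x\<bar>)"
proof -
  have c: "0 \<le> c" using order_trans[OF norm_ge_zero g[of 0]] by simp
  show ?thesis
  proof (cases "0 \<le> x")
    case True
    have i: "((\<lambda>t. c * exp (L * t)) has_integral (c / L * exp (L * x) - c / L * exp (L * 0))) {0..x}"
      by (rule fundamental_theorem_of_calculus[OF True])
        (use L in \<open>auto intro!: derivative_eq_intros simp: has_real_derivative_iff_has_vector_derivative[symmetric]\<close>)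
    have "cmod (integral {0..x} g) \<le> integral {0..x} (\<lambda>t. c * exp (L * t))"
      using g by (intro Henstock_Kurzweil_Integration.integral_norm_bound_integral acD(2)[OF abs_cont] has_integral_integrable[OF i])
        (metis abs_of_nonneg atLeastAtMost_iff)
    also have "\<dots> = c / L * exp (L * x) - c / L" using integral_unique[OF i] by simp
    also have "\<dots> \<le> c / L * exp (L * \<bar>x\<bar>)" using True c L by simp
    finally show ?thesis using acD(3)[OF abs_cont True] G0 by simp
  next
    case False
    then have x: "x \<le> 0" by simp
    have i: "((\<lambda>t. c * exp (- (L * t))) has_integral (- (c / L) * exp (- (L * 0)) - (- (c / L) * exp (- (L * x))))) {x..0}"
      by (rule fundamental_theorem_of_calculus[OF x])
        (use L in \<open>auto intro!: derivative_eq_intros simp: has_real_derivative_iff_has_vector_derivative[symmetric]\<close>)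
    have "cmod (integral {x..0} g) \<le> integral {x..0} (\<lambda>t. c * exp (- (L * t)))"
    proof (intro Henstock_Kurzweil_Integration.integral_norm_bound_integral acD(2)[OF abs_cont] has_integral_integrable[OF i])
      fix t assume "t \<in> {x..0}"
      then have "\<bar>t\<bar> = - t" by simp
      then show "cmod (g t) \<le> c * exp (- (L * t))" using g[of t] by simp
    qed
    also have "\<dots> = c / L * exp (- (L * x)) - c / L" using integral_unique[OF i] by simp
    also have "\<dots> \<le> c / L * exp (L * \<bar>x\<bar>)" using x c L by simp
    finally have "cmod (integral {x..0} g) \<le> c / L * exp (L * \<bar>x\<bar>)" .
    moreover have "G x = - integral {x..0} g" using acD(3)[OF abs_cont x] G0 by (metis diff_0 minus_minus)
    ultimately show ?thesis by simp
  qed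
qed

lemma abs_cont_eq_of_eq_at_0:
  assumes "abs_cont G g" "abs_cont H g" "G 0 = H 0"
  shows "G x = H x"
  using acD(3)[OF assms(1), of 0 x] acD(3)[OF assms(2), of 0 x]
    acD(3)[OF assms(1), of x 0] acD(3)[OF assms(2), of x 0] assms(3)
  by (cases "0 \<le> x") (auto simp: algebra_simps)

lemma abs_cont_shift: "abs_cont u g \<Longrightarrow> abs_cont (\<lambda>x. u (x + c)) (\<lambda>x. g (x + c))"
proof (rule acI)
  assume abs_cont: "abs_cont u g"
  have "(\<lambda>x. g (x + c)) integrable_on {a..b} \<longleftrightarrow> g integrable_on {a + c..b + c}"
    "(\<lambda>x. norm (g (x + c))) integrable_on {a..b} \<longleftrightarrow> (\<lambda>x. norm (g x)) integrable_on {a + c..b + c}" for a b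
    using integrable_on_shift_Icc_real[of g c a b] integrable_on_shift_Icc_real[of "\<lambda>x. norm (g x)" c a b]
    by (simp_all add: o_def add.commute)
  then show "(\<lambda>x. g (x + c)) absolutely_integrable_on {a..b}" for a b
    using acD(1)[OF abs_cont, of "a + c" "b + c"] by (simp add: absolutely_integrable_on_def)
  show "((\<lambda>x. g (x + c)) has_integral u (b + c) - u (a + c)) {a..b}" if "a \<le> b" for a b
    using acD(4)[OF abs_cont, of "a + c" "b + c"] that
      has_integral_shift_Icc_real[of g c "u (b + c) - u (a + c)" a b] by (simp add: add.commute o_def)
qed

lemma locally_integrable_exp_bound:
  assumes "g \<in> borel_measurable lebesgue" "\<And>t. cmod (g t) \<le> c * exp (L * \<bar>t\<bar>)"
  shows "locally_integrable UNIV g"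
  unfolding locally_integrable_UNIV_iff
proof safe
  fix a b
  show "g absolutely_integrable_on {a..b}"
  proof (rule measurable_bounded_by_integrable_imp_absolutely_integrable)
    show "g \<in> borel_measurable (lebesgue_on {a..b})" using assms(1) by (rule measurable_restrict_space1)
    show "(\<lambda>t. c * exp (L * \<bar>t\<bar>)) integrable_on {a..b}" by (intro integrable_continuous_real continuous_intros)
  qed (use assms(2) in auto)
qed

lemma continuous_imp_lebesgue_measurable:
  fixes f :: "real \<Rightarrow> 'a::euclidean_space"
  shows "continuous_on UNIV f \<Longrightarrow> f \<in> borel_measurable lebesgue"
  by (intro measurable_completion) (simp add: borel_measurable_continuous_onI)

definition sys_rhs :: "(real \<Rightarrow> real) \<Rightarrow> (real \<Rightarrow> real) \<Rightarrow> (real \<Rightarrow> complex) \<Rightarrow> real \<Rightarrow> complex" where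
  "sys_rhs a b f t = of_real (a t * Im (f t)) + \<i> * of_real (b t * Re (f t))"

lemma sys_rhs_add: "sys_rhs a b (\<lambda>x. f x + g x) t = sys_rhs a b f t + sys_rhs a b g t"
  and sys_rhs_diff: "sys_rhs a b (\<lambda>x. f x - g x) t = sys_rhs a b f t - sys_rhs a b g t"
  and sys_rhs_0: "sys_rhs a b (\<lambda>x. 0) t = 0"
  by (simp_all add: sys_rhs_def algebra_simps)

lemma sys_rhs_bound:
  assumes "\<bar>a t\<bar> \<le> K" "\<bar>b t\<bar> \<le> K"
  shows "cmod (sys_rhs a b f t) \<le> K * cmod (f t)"
proof (rule power2_le_imp_le)
  have "(cmod (sys_rhs a b f t))\<^sup>2 = (a t)\<^sup>2 * (Im (f t))\<^sup>2 + (b t)\<^sup>2 * (Re (f t))\<^sup>2"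
    by (simp add: sys_rhs_def cmod_power2 power_mult_distrib)
  also have "\<dots> \<le> K\<^sup>2 * (Im (f t))\<^sup>2 + K\<^sup>2 * (Re (f t))\<^sup>2"
    using assms by (intro add_mono mult_right_mono) (auto intro: abs_le_square_iff[THEN iffD1] simp: abs_le_square_iff[symmetric])
  also have "\<dots> = (K * cmod (f t))\<^sup>2"
    by (simp add: power_mult_distrib cmod_power2 algebra_simps)
  finally show "(cmod (sys_rhs a b f t))\<^sup>2 \<le> (K * cmod (f t))\<^sup>2" .
qed (use assms in auto)

text \<open>A pair of real unknowns is encoded as real and imaginary part of one complex function.\<close>
lemma complex_system_solution:
  assumes a: "a \<in> borel_measurable lebesgue" "\<And>t. \<bar>a t\<bar> \<le> K"
    and b: "b \<in> borel_measurable lebesgue" "\<And>t. \<bar>b t\<bar> \<le> K" and K: "K > 0"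
  obtains f where "abs_cont f (sys_rhs a b f)" "f 0 = f0" "\<And>x. cmod (f x) \<le> 2 * cmod f0 * exp (2 * K * \<bar>x\<bar>)"
proof -
  define prim where "prim g = (SOME G. abs_cont G g \<and> G 0 = 0)" for g
  have prim: "abs_cont (prim g) g" "prim g 0 = 0" if loc: "locally_integrable UNIV g" for g
  proof -
    obtain G where "abs_cont G g \<and> G 0 = 0" using abs_cont_primitive[OF loc] by metis
    from someI[of "\<lambda>G. abs_cont G g \<and> G 0 = 0", OF this]
    show "abs_cont (prim g) g" "prim g 0 = 0" by (simp_all add: prim_def)
  qed
  have meas: "sys_rhs a b f \<in> borel_measurable lebesgue" if "f \<in> borel_measurable lebesgue" for f
    unfolding sys_rhs_def[abs_def] using a(1) b(1) that by measurable
  have bnd: "cmod (sys_rhs a b f t) \<le> K * cmod (f t)" for f t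
    using sys_rhs_bound[of a t K b f] a(2) b(2) by blast
  \<comment> \<open>\<open>e n\<close> bounds the n-th Picard increment \<open>d n\<close> in the
    weighted norm; the ratio 1/2 is K divided by 2 K.\<close>
  define e where "e n = cmod f0 * (1/2) ^ n" for n :: nat
  define d where "d = rec_nat (\<lambda>_. f0) (\<lambda>_ f. prim (sys_rhs a b f))"
  have d0: "d 0 = (\<lambda>_. f0)" and dS: "\<And>n. d (Suc n) = prim (sys_rhs a b (d n))" by (simp_all add: d_def)
  have step: "locally_integrable UNIV (sys_rhs a b f) \<and> cmod (prim (sys_rhs a b f) x) \<le> c / 2 * exp (2 * K * \<bar>x\<bar>)"
    if "f \<in> borel_measurable lebesgue" "\<And>x. cmod (f x) \<le> c * exp (2 * K * \<bar>x\<bar>)" for f c x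
  proof
    have b: "cmod (sys_rhs a b f t) \<le> (K * c) * exp (2 * K * \<bar>t\<bar>)" for t
    proof -
      have "K * cmod (f t) \<le> K * (c * exp (2 * K * \<bar>t\<bar>))"
        using that(2)[of t] K by (intro mult_left_mono) auto
      then show ?thesis using bnd[of f t] by (simp add: mult.assoc)
    qed
    show loc: "locally_integrable UNIV (sys_rhs a b f)"
      by (rule locally_integrable_exp_bound[OF meas[OF that(1)] b])
    show "cmod (prim (sys_rhs a b f) x) \<le> c / 2 * exp (2 * K * \<bar>x\<bar>)"
      using abs_cont_exp_bound[OF prim(1)[OF loc] _ b prim(2)[OF loc], of x] K by simp
  qed
  have d: "d n \<in> borel_measurable lebesgue \<and> (\<forall>x. cmod (d n x) \<le> e n * exp (2 * K * \<bar>x\<bar>))" for n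
  proof (induction n)
    case 0
    have "cmod f0 * 1 \<le> cmod f0 * exp (2 * K * \<bar>x\<bar>)" for x
      using K by (intro mult_left_mono) auto
    then show ?case by (simp add: d0 e_def)
  next
    case (Suc n)
    have m: "d n \<in> borel_measurable lebesgue" and l: "\<And>x. cmod (d n x) \<le> e n * exp (2 * K * \<bar>x\<bar>)"
      using Suc by auto
    have s: "locally_integrable UNIV (sys_rhs a b (d n))" "\<And>x. cmod (d (Suc n) x) \<le> e n / 2 * exp (2 * K * \<bar>x\<bar>)"
      using step[OF m l] by (auto simp: dS)
    have "continuous_on UNIV (d (Suc n))" unfolding dS by (rule abs_cont_continuous_on[OF prim(1)[OF s(1)]])
    then show ?case using s(2) by (auto simp: e_def intro: continuous_imp_lebesgue_measurable)
  qed
  have dm: "d n \<in> borel_measurable lebesgue" and dl: "cmod (d n x) \<le> e n * exp (2 * K * \<bar>x\<bar>)" for n x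
    using d by auto
  have loc: "locally_integrable UNIV (sys_rhs a b (d n))" for n using step[OF dm dl] by blast
  have e_sum: "summable e" "(\<Sum>n. e n) = 2 * cmod f0"
    unfolding e_def using suminf_geometric[of "1/2::real"]
    by (auto intro!: summable_mult summable_geometric simp: suminf_mult)
  define f where "f x = (\<Sum>n. d n x)" for x
  define S where "S n x = (\<Sum>k<n. d k x)" for n x
  have sm: "summable (\<lambda>n. d n x)" for x
    by (rule summable_comparison_test'[where N = 0 and g = "\<lambda>n. e n * exp (2 * K * \<bar>x\<bar>)"])
      (auto intro: dl summable_mult2 e_sum)
  have Sm: "S n \<in> borel_measurable lebesgue" for n unfolding S_def[abs_def] using dm by measurable
  have lim: "(\<lambda>n. S n x) \<longlonglongrightarrow> f x" for x
    unfolding S_def f_def using summable_LIMSEQ[OF sm] by simp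
  have fm: "f \<in> borel_measurable lebesgue"
    by (rule borel_measurable_LIMSEQ_metric[of S]) (use Sm lim in auto)
  have tail: "cmod (f x - S n x) \<le> 2 * e n * exp (2 * K * \<bar>x\<bar>)" for n x
  proof -
    have en: "(\<lambda>k. e (k + n)) = (\<lambda>k. (1/2) ^ n * e k)" by (auto simp: e_def power_add)
    have se0: "summable (\<lambda>k. e (k + n))" using e_sum(1) by (simp add: summable_iff_shift)
    have se: "summable (\<lambda>k. e (k + n) * exp (2 * K * \<bar>x\<bar>))" by (intro summable_mult2 se0)
    have "f x - S n x = (\<Sum>k. d (k + n) x)"
      unfolding f_def S_def using suminf_split_initial_segment[OF sm, of x n] by simp
    also have "cmod \<dots> \<le> (\<Sum>k. e (k + n) * exp (2 * K * \<bar>x\<bar>))"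
      by (rule norm_suminf_le) (auto intro: se dl)
    also have "\<dots> = (\<Sum>k. e (k + n)) * exp (2 * K * \<bar>x\<bar>)"
      by (rule suminf_mult2[OF se0, symmetric])
    also have "(\<Sum>k. e (k + n)) = (1/2) ^ n * (2 * cmod f0)"
      unfolding en suminf_mult[OF e_sum(1)] e_sum(2) ..
    finally show ?thesis by (simp add: e_def mult.commute mult.left_commute)
  qed
  have fl: "cmod (f x) \<le> 2 * cmod f0 * exp (2 * K * \<bar>x\<bar>)" for x
    using tail[of x 0] by (simp add: S_def e_def)
  have locf: "locally_integrable UNIV (sys_rhs a b f)" using step[OF fm fl] by blast
  \<comment> \<open>The partial sums solve the system with a lag of one index. \<open>G\<close>, the
    image of the limit under the Picard map, is compared with them and turns out to be the limit
    itself.\<close>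
  have acS: "abs_cont (S (Suc n)) (sys_rhs a b (S n))" for n
  proof (induction n)
    case 0
    show ?case
      using abs_cont_const[of f0] by (simp add: S_def[abs_def] d0 sys_rhs_0[abs_def] sys_rhs_def)
  next
    case (Suc n)
    have "abs_cont (\<lambda>x. S (Suc n) x + d (Suc n) x) (\<lambda>x. sys_rhs a b (S n) x + sys_rhs a b (d n) x)"
      using Suc prim(1)[OF loc[of n]] by (intro abs_cont_add) (auto simp: dS)
    then show ?case
      by (rule abs_cont_cong) (auto simp: S_def[abs_def] sys_rhs_add)
  qed
  have S0: "S (Suc n) 0 = f0" for n
  proof -
    have "S (Suc n) 0 = d 0 0 + (\<Sum>k<n. d (Suc k) 0)"
      unfolding S_def by (rule sum.lessThan_Suc_shift)
    then show ?thesis using prim(2)[OF loc] by (simp add: d0 dS)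
  qed
  define G where "G x = f0 + prim (sys_rhs a b f) x" for x
  have acG: "abs_cont G (sys_rhs a b f)"
    using abs_cont_add[OF abs_cont_const[of f0] prim(1)[OF locf]] by (simp add: G_def[abs_def])
  have "(\<lambda>n. S (Suc n) x) \<longlonglongrightarrow> G x" for x
  proof -
    have est: "cmod (G x - S (Suc n) x) \<le> e n * exp (2 * K * \<bar>x\<bar>)" for n
    proof -
      have abs_cont: "abs_cont (\<lambda>x. G x - S (Suc n) x) (\<lambda>x. sys_rhs a b f x - sys_rhs a b (S n) x)"
        by (rule abs_cont_diff[OF acG acS])
      have "cmod (sys_rhs a b f t - sys_rhs a b (S n) t) \<le> (K * (2 * e n)) * exp (2 * K * \<bar>t\<bar>)" for t
      proof -
        have "K * cmod (f t - S n t) \<le> K * (2 * e n * exp (2 * K * \<bar>t\<bar>))"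
          using tail[of t n] K by (intro mult_left_mono) auto
        then show ?thesis using bnd[of "\<lambda>x. f x - S n x" t] by (simp add: sys_rhs_diff mult.assoc)
      qed
      from abs_cont_exp_bound[OF abs_cont _ this, of x] show ?thesis
        using K S0 prim(2)[OF locf] by (simp add: G_def)
    qed
    have lim0: "(\<lambda>n. e n * exp (2 * K * \<bar>x\<bar>)) \<longlonglongrightarrow> 0"
      using tendsto_mult[OF summable_LIMSEQ_zero[OF e_sum(1)] tendsto_const[of "exp (2 * K * \<bar>x\<bar>)"]] by simp
    have "\<forall>n. cmod (G x - S (Suc n) x) \<le> e n * exp (2 * K * \<bar>x\<bar>)" using est by blast
    from Lim_null_comparison[OF always_eventually[OF this] lim0]
    have "(\<lambda>n. G x - S (Suc n) x) \<longlonglongrightarrow> 0" .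
    then have "(\<lambda>n. G x - (G x - S (Suc n) x)) \<longlonglongrightarrow> G x - 0" by (intro tendsto_diff tendsto_const)
    then show ?thesis by simp
  qed
  moreover have "(\<lambda>n. S (Suc n) x) \<longlonglongrightarrow> f x" for x by (rule LIMSEQ_Suc[OF lim])
  ultimately have "G x = f x" for x using LIMSEQ_unique by blast
  then have Gf: "G = f" by auto
  show ?thesis
  proof (rule that)
    show "abs_cont f (sys_rhs a b f)" using acG by (simp add: Gf)
    show "f 0 = f0" using prim(2)[OF locf] by (simp add: Gf[symmetric] G_def)
  qed (rule fl)
qed

section \<open>Real first-order systems and their Wronskians\<close>

definition sys_sol :: "(real \<Rightarrow> real) \<Rightarrow> (real \<Rightarrow> real) \<Rightarrow> (real \<Rightarrow> real) \<Rightarrow> (real \<Rightarrow> real) \<Rightarrow> bool" where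
  "sys_sol a b y z \<longleftrightarrow> abs_cont (\<lambda>x. of_real (y x)) (\<lambda>x. of_real (a x * z x)) \<and>
     abs_cont (\<lambda>x. of_real (z x)) (\<lambda>x. of_real (b x * y x))"

lemma abs_cont_Re_Im:
  assumes "abs_cont f g"
  shows "abs_cont (\<lambda>x. of_real (Re (f x))) (\<lambda>x. of_real (Re (g x)))"
    and "abs_cont (\<lambda>x. of_real (Im (f x))) (\<lambda>x. of_real (Im (g x)))"
proof -
  have 1: "complex_of_real (Re w) = (1/2) * w + (1/2) * cnj w" for w by (simp add: complex_eq_iff)
  have 2: "complex_of_real (Im w) = (- \<i>/2) * w + (\<i>/2) * cnj w" for w by (simp add: complex_eq_iff)
  show "abs_cont (\<lambda>x. of_real (Re (f x))) (\<lambda>x. of_real (Re (g x)))"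
    unfolding 1 by (rule abs_cont_lincomb[OF assms abs_cont_cnj[OF assms]])
  show "abs_cont (\<lambda>x. of_real (Im (f x))) (\<lambda>x. of_real (Im (g x)))"
    unfolding 2 by (rule abs_cont_lincomb[OF assms abs_cont_cnj[OF assms]])
qed

lemma sys_sol_exists:
  assumes a: "a \<in> borel_measurable lebesgue" "\<And>t. \<bar>a t\<bar> \<le> K"
    and b: "b \<in> borel_measurable lebesgue" "\<And>t. \<bar>b t\<bar> \<le> K" and K: "K > 0"
  obtains y z where "sys_sol a b y z" "y 0 = y0" "z 0 = z0"
    "\<And>x. \<bar>y x\<bar> \<le> 2 * (\<bar>y0\<bar> + \<bar>z0\<bar>) * exp (2 * K * \<bar>x\<bar>)"
proof -
  obtain f where f: "abs_cont f (sys_rhs a b f)" "f 0 = Complex y0 z0"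
      "\<And>x. cmod (f x) \<le> 2 * cmod (Complex y0 z0) * exp (2 * K * \<bar>x\<bar>)"
    using complex_system_solution[OF assms] by blast
  show ?thesis
  proof (rule that[of "\<lambda>x. Re (f x)" "\<lambda>x. Im (f x)"])
    show "sys_sol a b (\<lambda>x. Re (f x)) (\<lambda>x. Im (f x))"
      using abs_cont_Re_Im[OF f(1)] by (simp add: sys_sol_def sys_rhs_def)
    fix x
    have "\<bar>Re (f x)\<bar> \<le> cmod (f x)" by (rule abs_Re_le_cmod)
    also have "\<dots> \<le> 2 * cmod (Complex y0 z0) * exp (2 * K * \<bar>x\<bar>)" by (rule f)
    also have "\<dots> \<le> 2 * (\<bar>y0\<bar> + \<bar>z0\<bar>) * exp (2 * K * \<bar>x\<bar>)"
      using cmod_le[of "Complex y0 z0"] by simp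
    finally show "\<bar>Re (f x)\<bar> \<le> 2 * (\<bar>y0\<bar> + \<bar>z0\<bar>) * exp (2 * K * \<bar>x\<bar>)" .
  qed (simp_all add: f)
qed

lemma sys_sol_continuous:
  assumes "sys_sol a b y z"
  shows "continuous_on A y" "continuous_on A z"
proof -
  have "continuous_on A (\<lambda>x. complex_of_real (y x))" "continuous_on A (\<lambda>x. complex_of_real (z x))"
    using assms unfolding sys_sol_def by (blast intro: abs_cont_continuous_on)+
  from this[THEN continuous_on_Re] show "continuous_on A y" "continuous_on A z" by simp_all
qed

lemma sys_sol_lincomb:
  assumes "sys_sol a b y z" "sys_sol a b y' z'"
  shows "sys_sol a b (\<lambda>x. c * y x + d * y' x) (\<lambda>x. c * z x + d * z' x)"
  unfolding sys_sol_def
proof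
  have 1: "abs_cont (\<lambda>x. of_real (y x)) (\<lambda>x. of_real (a x * z x))" "abs_cont (\<lambda>x. of_real (z x)) (\<lambda>x. of_real (b x * y x))"
    "abs_cont (\<lambda>x. of_real (y' x)) (\<lambda>x. of_real (a x * z' x))" "abs_cont (\<lambda>x. of_real (z' x)) (\<lambda>x. of_real (b x * y' x))"
    using assms by (auto simp: sys_sol_def)
  show "abs_cont (\<lambda>x. complex_of_real (c * y x + d * y' x)) (\<lambda>x. complex_of_real (a x * (c * z x + d * z' x)))"
    by (rule abs_cont_cong[OF abs_cont_lincomb[OF 1(1,3), of "of_real c" "of_real d"]]) (auto simp: algebra_simps)
  show "abs_cont (\<lambda>x. complex_of_real (c * z x + d * z' x)) (\<lambda>x. complex_of_real (b x * (c * y x + d * y' x)))"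
    by (rule abs_cont_cong[OF abs_cont_lincomb[OF 1(2,4), of "of_real c" "of_real d"]]) (auto simp: algebra_simps)
qed

text \<open>The two systems may differ in b: equal b makes the Wronskian constant, while different
  spectral parameters give the continuity estimate for the discriminant.\<close>

lemma sys_sol_Wronskian:
  assumes "sys_sol a b y z" "sys_sol a b' y' z'"
  shows "abs_cont (\<lambda>x. of_real (y x * z' x - z x * y' x)) (\<lambda>x. of_real ((b' x - b x) * (y x * y' x)))"
proof -
  have 1: "abs_cont (\<lambda>x. of_real (y x)) (\<lambda>x. of_real (a x * z x))" "abs_cont (\<lambda>x. of_real (z x)) (\<lambda>x. of_real (b x * y x))"
    "abs_cont (\<lambda>x. of_real (y' x)) (\<lambda>x. of_real (a x * z' x))" "abs_cont (\<lambda>x. of_real (z' x)) (\<lambda>x. of_real (b' x * y' x))"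
    using assms by (auto simp: sys_sol_def)
  show ?thesis
    by (rule abs_cont_cong[OF abs_cont_diff[OF abs_cont_mult[OF 1(1,4)] abs_cont_mult[OF 1(2,3)]]]) (auto simp: algebra_simps)
qed

lemma sys_sol_Wronskian_const:
  assumes "sys_sol a b y z" "sys_sol a b y' z'"
  shows "y x * z' x - z x * y' x = y 0 * z' 0 - z 0 * y' 0"
proof -
  have "abs_cont (\<lambda>x. of_real (y x * z' x - z x * y' x)) (\<lambda>x. 0)"
    using sys_sol_Wronskian[OF assms] by simp
  from abs_cont_eq_of_eq_at_0[OF this abs_cont_const[of "of_real (y 0 * z' 0 - z 0 * y' 0)"], of x]
  show ?thesis by (simp only: of_real_eq_iff)
qed

lemma sys_sol_product:
  assumes "sys_sol a b y z"
  shows "abs_cont (\<lambda>x. of_real (y x * z x)) (\<lambda>x. of_real (a x * (z x)\<^sup>2 + b x * (y x)\<^sup>2))"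
    and "abs_cont (\<lambda>x. of_real ((y x)\<^sup>2)) (\<lambda>x. of_real (2 * a x * (y x * z x)))"
    and "abs_cont (\<lambda>x. of_real ((z x)\<^sup>2)) (\<lambda>x. of_real (2 * b x * (y x * z x)))"
proof -
  have 1: "abs_cont (\<lambda>x. of_real (y x)) (\<lambda>x. of_real (a x * z x))" "abs_cont (\<lambda>x. of_real (z x)) (\<lambda>x. of_real (b x * y x))"
    using assms by (auto simp: sys_sol_def)
  show "abs_cont (\<lambda>x. of_real (y x * z x)) (\<lambda>x. of_real (a x * (z x)\<^sup>2 + b x * (y x)\<^sup>2))"
    by (rule abs_cont_cong[OF abs_cont_mult[OF 1]]) (auto simp: algebra_simps power2_eq_square)
  show "abs_cont (\<lambda>x. of_real ((y x)\<^sup>2)) (\<lambda>x. of_real (2 * a x * (y x * z x)))"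
    by (rule abs_cont_cong[OF abs_cont_mult[OF 1(1,1)]]) (auto simp: algebra_simps power2_eq_square)
  show "abs_cont (\<lambda>x. of_real ((z x)\<^sup>2)) (\<lambda>x. of_real (2 * b x * (y x * z x)))"
    by (rule abs_cont_cong[OF abs_cont_mult[OF 1(2,2)]]) (auto simp: algebra_simps power2_eq_square)
qed

lemma abs_cont_real_mono:
  assumes abs_cont: "abs_cont (\<lambda>x. of_real (u x)) (\<lambda>x. of_real (g x))" and g: "\<And>t. a \<le> t \<Longrightarrow> t \<le> b \<Longrightarrow> 0 \<le> g t" and ab: "a \<le> b"
  shows "u a \<le> u b"
proof -
  have "((\<lambda>x. Re (of_real (g x))) has_integral Re (of_real (u b) - of_real (u a))) {a..b}"
    using has_integral_linear[OF acD(4)[OF abs_cont ab] bounded_linear_Re] by (simp add: o_def)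
  then have "(g has_integral (u b - u a)) {a..b}" by simp
  then have "0 \<le> u b - u a" by (rule has_integral_nonneg) (use g in auto)
  then show ?thesis by simp
qed

text \<open>For nonnegative a and b the product y z is nondecreasing; being nonnegative at 0, it
  makes both squares nondecreasing.\<close>

lemma sys_sol_nonneg_growth:
  assumes sol: "sys_sol a b y z" and a: "\<And>t. 0 \<le> a t" and b: "\<And>t. 0 \<le> b t" and 0: "0 \<le> y 0 * z 0" and x: "0 \<le> x"
  shows "(y 0)\<^sup>2 \<le> (y x)\<^sup>2" "(z 0)\<^sup>2 \<le> (z x)\<^sup>2"
proof -
  have yz: "0 \<le> y t * z t" if "0 \<le> t" for t
    using abs_cont_real_mono[OF sys_sol_product(1)[OF sol], of 0 t] that a b 0
    by (smt (verit) mult_nonneg_nonneg zero_le_power2)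
  show "(y 0)\<^sup>2 \<le> (y x)\<^sup>2"
    by (rule abs_cont_real_mono[OF sys_sol_product(2)[OF sol] _ x]) (use yz a in simp)
  show "(z 0)\<^sup>2 \<le> (z x)\<^sup>2"
    by (rule abs_cont_real_mono[OF sys_sol_product(3)[OF sol] _ x]) (use yz b in simp)
qed

lemma continuous_ge_1_of_sq:
  fixes y :: "real \<Rightarrow> real"
  assumes "continuous_on {0..1} y" "y 0 = 1" "\<And>x. 0 \<le> x \<Longrightarrow> 1 \<le> (y x)\<^sup>2"
  shows "1 \<le> y 1"
proof (rule ccontr)
  assume n: "\<not> 1 \<le> y 1"
  have "y 1 \<le> 0"
  proof (rule ccontr)
    assume "\<not> y 1 \<le> 0"
    then have "(y 1)\<^sup>2 < 1" using n by (simp add: abs_square_less_1)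
    then show False using assms(3)[of 1] by simp
  qed
  then obtain x where "0 \<le> x" "x \<le> 1" "y x = 0"
    using IVT2'[of y 1 0 0] assms(1,2) by auto
  then show False using assms(3)[of x] by simp
qed

text \<open>Up to sign, (m12, r - m11) and (r - m22, m21) are the columns of the adjugate of the
  singular matrix M - r. Either is an eigenvector unless it is zero, and if both are zero the matrix
  is r times the identity.\<close>

lemma real_eigenvector_2:
  fixes m11 m12 m21 m22 r :: real
  assumes det: "m11 * m22 - m12 * m21 = 1" and r: "r\<^sup>2 - (m11 + m22) * r + 1 = 0"
  obtains v1 v2 where "v1 \<noteq> 0 \<or> v2 \<noteq> 0" "m11 * v1 + m12 * v2 = r * v1" "m21 * v1 + m22 * v2 = r * v2"
proof -
  have ch: "(m11 - r) * (m22 - r) = m12 * m21"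
    using det r by (simp add: algebra_simps power2_eq_square)
  consider "m12 \<noteq> 0 \<or> r - m11 \<noteq> 0" | "m12 = 0" "r = m11" "r - m22 \<noteq> 0 \<or> m21 \<noteq> 0" | "m12 = 0" "r = m11" "r = m22" "m21 = 0"
    by auto
  then show ?thesis
  proof cases
    case 1
    show ?thesis by (rule that[of m12 "r - m11"]) (use 1 ch in \<open>auto simp: algebra_simps\<close>)
  next
    case 2
    show ?thesis by (rule that[of "r - m22" m21]) (use 2 in \<open>auto simp: algebra_simps\<close>)
  next
    case 3
    show ?thesis by (rule that[of 1 0]) (use 3 in auto)
  qed
qed

section \<open>Floquet theory\<close>

lemma periodic_frac:
  fixes f :: "real \<Rightarrow> 'a"
  assumes "\<And>x. f (x + 1) = f x"
  shows "f x = f (frac x)"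
proof -
  have shift: "f (x + of_int n) = f x" for x n
  proof (induction n rule: int_induct[where k = 0])
    case (step1 i)
    then show ?case using assms[of "x + of_int i"] by (simp add: add.assoc)
  next
    case (step2 i)
    then show ?case using assms[of "x + of_int (i - 1)"] by (simp add: add.assoc)
  qed simp
  show ?thesis using shift[of "frac x" "\<lfloor>x\<rfloor>"] by (simp add: frac_def)
qed

lemma frac_in_unit_interval: "frac x \<in> {0..1 :: real}"
  using frac_lt_1[of x] by (simp add: less_imp_le)

lemma periodic_continuous_bounded:
  fixes f :: "real \<Rightarrow> real"
  assumes "continuous_on UNIV f" "\<And>x. f (x + 1) = f x"
  obtains B where "1 \<le> B" "\<And>x. \<bar>f x\<bar> \<le> B"
proof -
  have "compact (f ` {0..1})"
    using assms(1) by (intro compact_continuous_image) (auto intro: continuous_on_subset)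
  then have "bounded (f ` {0..1})" by (rule compact_imp_bounded)
  then obtain B where B: "\<forall>y\<in>f ` {0..1}. \<bar>y\<bar> \<le> B"
    unfolding bounded_real by blast
  show ?thesis
  proof (rule that[of "max 1 B"])
    fix x
    have "f x = f (frac x)" by (rule periodic_frac[of f, OF assms(2)])
    moreover note frac_in_unit_interval[of x]
    ultimately show "\<bar>f x\<bar> \<le> max 1 B" using B by (metis image_eqI le_max_iff_disj)
  qed simp
qed

lemma abs_cont_has_vector_derivative:
  assumes abs_cont: "abs_cont u g" and g: "continuous_on UNIV g"
  shows "(u has_vector_derivative g x) (at x)"
proof -
  have "((\<lambda>y. integral {x - 1..y} g) has_vector_derivative g x) (at x within {x - 1..x + 1})"
    by (rule integral_has_vector_derivative) (auto intro: continuous_on_subset[OF g])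
  then have "((\<lambda>y. u (x - 1) + integral {x - 1..y} g) has_vector_derivative g x) (at x within {x - 1..x + 1})"
    by (auto intro!: derivative_eq_intros)
  then have "(u has_vector_derivative g x) (at x within {x - 1..x + 1})"
  proof (rule has_vector_derivative_transform[rotated 2])
    show "u y = u (x - 1) + integral {x - 1..y} g" if "y \<in> {x - 1..x + 1}" for y
      using acD(3)[OF abs_cont, of "x - 1" y] that by (simp add: algebra_simps)
  qed simp
  moreover have "at x within {x - 1..x + 1} = at x"
    by (intro at_within_interior) (auto simp: interior_atLeastAtMost_real)
  ultimately show ?thesis by simp
qed

lemma bounded_measurable_L2_unit_interval:
  assumes "f \<in> borel_measurable lebesgue" "\<And>x. x \<in> {0<..<1} \<Longrightarrow> cmod (f x) \<le> B"
  shows "f \<in> L2_space {0<..<1}"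
proof -
  have m: "f \<in> borel_measurable (lebesgue_on {0<..<1})" using assms(1) by (rule measurable_restrict_space1)
  have "integrable (lebesgue_on {0<..<1::real}) (\<lambda>x. (cmod (f x))\<^sup>2)"
  proof (rule measurable_bounded_by_integrable_imp_lebesgue_integrable)
    show "(\<lambda>x. (cmod (f x))\<^sup>2) \<in> borel_measurable (lebesgue_on {0<..<1})" using m by measurable
    have "finite_measure (lebesgue_on {0<..<1::real})" by (rule finite_measure_lebesgue_on) simp
    then show "integrable (lebesgue_on {0<..<1::real}) (\<lambda>x. B\<^sup>2)" by (rule finite_measure.integrable_const)
    show "norm ((cmod (f x))\<^sup>2) \<le> B\<^sup>2" if "x \<in> {0<..<1}" for x
      using assms(2)[OF that] by (simp add: power_mono)
  qed simp
  then show ?thesis using m by (simp add: L2_space_def)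
qed

text \<open>The derivative of |g|^2 is -2 k |g|^2 - 2 Re (G cnj g), and its integral is zero. The
  argument is the same for either sign of k, so growing and decaying weights are treated
  alike.\<close>

lemma abs_cont_damped_energy:
  assumes abs_cont: "abs_cont g (\<lambda>x. - (of_real k * g x) - G x)" and g: "g \<in> L2" and G: "G \<in> L2"
  shows "\<bar>k\<bar> * N2 g \<le> N2 G"
proof -
  define h where "h x = - (of_real k * g x) - G x" for x
  have h: "h \<in> L2" unfolding h_def[abs_def] by (intro L2_diff L2_uminus L2_scale g G)
  have gi: "integrable lebesgue (\<lambda>x. g x * cnj (g x))" "integrable lebesgue (\<lambda>x. G x * cnj (g x))"
    "integrable lebesgue (\<lambda>x. h x * cnj (g x))" "integrable lebesgue (\<lambda>x. g x * cnj (h x))"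
    by (intro L2_prod_integrable L2_cnj g G h)+
  have "integral\<^sup>L lebesgue (\<lambda>x. h x * cnj (g x) + g x * cnj (h x)) = 0"
  proof (rule abs_cont_integral_zero)
    show "abs_cont (\<lambda>x. g x * cnj (g x)) (\<lambda>x. h x * cnj (g x) + g x * cnj (h x))"
      using abs_cont abs_cont_cnj[OF abs_cont] unfolding h_def[symmetric] by (rule abs_cont_mult)
  qed (use gi in auto)
  then have "integral\<^sup>L lebesgue (\<lambda>x. h x * cnj (g x)) + cnj (integral\<^sup>L lebesgue (\<lambda>x. h x * cnj (g x))) = 0"
  proof -
    have "integral\<^sup>L lebesgue (\<lambda>x. g x * cnj (h x)) = cnj (integral\<^sup>L lebesgue (\<lambda>x. h x * cnj (g x)))"
    proof -
      have "integral\<^sup>L lebesgue (\<lambda>x. g x * cnj (h x)) = integral\<^sup>L lebesgue (\<lambda>x. cnj (h x * cnj (g x)))"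
        by (intro Bochner_Integration.integral_cong) (auto simp: mult.commute)
      also have "\<dots> = cnj (integral\<^sup>L lebesgue (\<lambda>x. h x * cnj (g x)))"
        by (rule integral_bounded_linear[OF bounded_linear_cnj gi(3)])
      finally show ?thesis .
    qed
    then show ?thesis
      using \<open>integral\<^sup>L lebesgue (\<lambda>x. h x * cnj (g x) + g x * cnj (h x)) = 0\<close>
        Bochner_Integration.integral_add[OF gi(3,4)] by simp
  qed
  then have re: "Re (integral\<^sup>L lebesgue (\<lambda>x. h x * cnj (g x))) = 0"
    by (simp add: complex_eq_iff)
  have "(\<lambda>x. h x * cnj (g x)) = (\<lambda>x. (- of_real k) * (g x * cnj (g x)) - G x * cnj (g x))"
    by (auto simp: h_def algebra_simps)
  then have "integral\<^sup>L lebesgue (\<lambda>x. h x * cnj (g x))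
      = integral\<^sup>L lebesgue (\<lambda>x. (- of_real k) * (g x * cnj (g x)) - G x * cnj (g x))" by simp
  also have "\<dots> = (- of_real k) * integral\<^sup>L lebesgue (\<lambda>x. g x * cnj (g x)) - integral\<^sup>L lebesgue (\<lambda>x. G x * cnj (g x))"
    using gi(1,2) by (subst Bochner_Integration.integral_diff) (auto intro: integrable_mult_right)
  also have "integral\<^sup>L lebesgue (\<lambda>x. g x * cnj (g x)) = of_real ((N2 g)\<^sup>2)"
    unfolding N2_sq by (subst integral_complex_of_real[symmetric]) (simp add: of_real_cmod_sq)
  finally have "k * (N2 g)\<^sup>2 = - Re (integral\<^sup>L lebesgue (\<lambda>x. G x * cnj (g x)))"
    using re by simp
  then have "\<bar>k\<bar> * (N2 g)\<^sup>2 \<le> cmod (integral\<^sup>L lebesgue (\<lambda>x. G x * cnj (g x)))"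
    using abs_Re_le_cmod[of "integral\<^sup>L lebesgue (\<lambda>x. G x * cnj (g x))"] by (simp add: abs_mult_pos' flip: abs_mult_pos)
  also have "\<dots> \<le> N2 G * N2 (\<lambda>x. cnj (g x))" by (rule L2_Cauchy_Schwarz(2)[OF G L2_cnj[OF g]])
  also have "N2 (\<lambda>x. cnj (g x)) = N2 g" by (simp add: N2_eq)
  finally have le: "\<bar>k\<bar> * N2 g * N2 g \<le> N2 G * N2 g" by (simp add: power2_eq_square mult.assoc)
  show ?thesis
  proof (cases "N2 g = 0")
    case False
    then have "N2 g > 0" using L2_norm_nonneg[of UNIV g] by linarith
    then show ?thesis using le by simp
  qed simp
qed

text \<open>Absolute continuity of 1 / P makes y' = z / P absolutely continuous for a solution with
  z = P y', which puts periodic solutions into \<open>W22\<close>.\<close>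

locale periodic_coeffs = bounded_coeffs +
  assumes abs_cont_inverse_P: "abs_cont (\<lambda>x. of_real (1 / P x)) (\<lambda>x. of_real (- P' x / (P x)\<^sup>2))"
    and P_periodic: "\<And>x. P (x + 1) = P x" and q_periodic: "\<And>x. q (x + 1) = q x"
begin

text \<open>Coefficients of the first-order system for -(P y')' + q y = l y in the unknowns y and z
  = P y'. In this form the derivative of P does not occur.\<close>

definition a :: "real \<Rightarrow> real" where "a x = 1 / P x"
definition b :: "real \<Rightarrow> real \<Rightarrow> real" where "b l x = q x - l"
definition K :: "real \<Rightarrow> real" where "K l = 1 / p0 + q1 + \<bar>l\<bar> + 1"

lemma a_pos: "0 < a x" and a_le: "a x \<le> 1 / p0"
  using P_pos[of x] P_ge[of x] p0 by (auto simp: a_def frac_le)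

lemma ab_meas: "a \<in> borel_measurable lebesgue" "b l \<in> borel_measurable lebesgue"
  unfolding a_def[abs_def] b_def[abs_def] using P_meas q_meas by measurable

lemma ab_bounds: "\<bar>a x\<bar> \<le> K l" "\<bar>b l x\<bar> \<le> K l" "0 < K l"
proof -
  have "0 < 1 / p0" using p0 by simp
  then show "0 < K l" using nonneg by (simp add: K_def add_pos_nonneg)
  show "\<bar>a x\<bar> \<le> K l" using a_pos[of x] a_le[of x] nonneg by (simp add: K_def)
  show "\<bar>b l x\<bar> \<le> K l" using q_le[of x] \<open>0 < 1 / p0\<close> unfolding K_def b_def by linarith
qed

section \<open>Fundamental solutions, multipliers and the discriminant\<close>

definition fund_sol :: "real \<Rightarrow> real \<Rightarrow> real \<Rightarrow> (real \<Rightarrow> real) \<times> (real \<Rightarrow> real)" where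
  "fund_sol l y0 z0 = (SOME s. sys_sol a (b l) (fst s) (snd s) \<and> fst s 0 = y0 \<and> snd s 0 = z0 \<and>
     (\<forall>x. \<bar>fst s x\<bar> \<le> 2 * (\<bar>y0\<bar> + \<bar>z0\<bar>) * exp (2 * K l * \<bar>x\<bar>)))"

lemma fund_sol: "sys_sol a (b l) (fst (fund_sol l y0 z0)) (snd (fund_sol l y0 z0))" "fst (fund_sol l y0 z0) 0 = y0" "snd (fund_sol l y0 z0) 0 = z0"
    "\<bar>fst (fund_sol l y0 z0) x\<bar> \<le> 2 * (\<bar>y0\<bar> + \<bar>z0\<bar>) * exp (2 * K l * \<bar>x\<bar>)"
proof -
  obtain y z where "sys_sol a (b l) y z" "y 0 = y0" "z 0 = z0"
    "\<And>x. \<bar>y x\<bar> \<le> 2 * (\<bar>y0\<bar> + \<bar>z0\<bar>) * exp (2 * K l * \<bar>x\<bar>)"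
    using sys_sol_exists[OF ab_meas(1) ab_bounds(1) ab_meas(2) ab_bounds(2) ab_bounds(3)] by metis
  then have "\<exists>s. sys_sol a (b l) (fst s) (snd s) \<and> fst s 0 = y0 \<and> snd s 0 = z0 \<and>
     (\<forall>x. \<bar>fst s x\<bar> \<le> 2 * (\<bar>y0\<bar> + \<bar>z0\<bar>) * exp (2 * K l * \<bar>x\<bar>))"
    by (intro exI[of _ "(y, z)"]) auto
  from someI_ex[OF this]
  show "sys_sol a (b l) (fst (fund_sol l y0 z0)) (snd (fund_sol l y0 z0))" "fst (fund_sol l y0 z0) 0 = y0" "snd (fund_sol l y0 z0) 0 = z0"
    "\<bar>fst (fund_sol l y0 z0) x\<bar> \<le> 2 * (\<bar>y0\<bar> + \<bar>z0\<bar>) * exp (2 * K l * \<bar>x\<bar>)"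
    unfolding fund_sol_def[symmetric] by auto
qed

text \<open>Solutions of cosine and sine type; \<open>C1\<close> and \<open>S1\<close> are their
  quasi-derivatives. \<open>discr\<close> is Hill's discriminant.\<close>

definition "C l = fst (fund_sol l 1 0)"
definition "C1 l = snd (fund_sol l 1 0)"
definition "S l = fst (fund_sol l 0 1)"
definition "S1 l = snd (fund_sol l 0 1)"
definition "discr l = C l 1 + S1 l 1"

lemma CS_sol: "sys_sol a (b l) (C l) (C1 l)" "sys_sol a (b l) (S l) (S1 l)"
  and CS_0: "C l 0 = 1" "C1 l 0 = 0" "S l 0 = 0" "S1 l 0 = 1"
  using fund_sol by (auto simp: C_def C1_def S_def S1_def)

lemma CS_bound: "\<bar>C l x\<bar> \<le> 2 * exp (2 * K l * \<bar>x\<bar>)" "\<bar>S l x\<bar> \<le> 2 * exp (2 * K l * \<bar>x\<bar>)"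
  using fund_sol(4)[of l 1 0 x] fund_sol(4)[of l 0 1 x] by (auto simp: C_def S_def)

lemma CS_Wronskian: "C l x * S1 l x - C1 l x * S l x = 1"
  using sys_sol_Wronskian_const[OF CS_sol(1)[of l] CS_sol(2)[of l], of x] by (simp add: CS_0)

lemma Wronskian_expand:
  "y = C l x * (y * S1 l x - z * S l x) - S l x * (y * C1 l x - z * C l x)"
  "z = C1 l x * (y * S1 l x - z * S l x) - S1 l x * (y * C1 l x - z * C l x)"
proof -
  have "y = y * (C l x * S1 l x - C1 l x * S l x)" "z = z * (C l x * S1 l x - C1 l x * S l x)"
    by (simp_all add: CS_Wronskian)
  then show "y = C l x * (y * S1 l x - z * S l x) - S l x * (y * C1 l x - z * C l x)"
    "z = C1 l x * (y * S1 l x - z * S l x) - S1 l x * (y * C1 l x - z * C l x)"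
    by (auto simp: algebra_simps)
qed

text \<open>The Wronskians of a solution with \<open>S l\<close> and \<open>C l\<close> are the
  constants y 0 and - z 0, and \<open>Wronskian_expand\<close> recovers the solution from them. This
  includes uniqueness for the initial value problem.\<close>

lemma sol_rep:
  assumes "sys_sol a (b l) y z"
  shows "y x = y 0 * C l x + z 0 * S l x" "z x = y 0 * C1 l x + z 0 * S1 l x"
proof -
  have w: "y x * S1 l x - z x * S l x = y 0" "y x * C1 l x - z x * C l x = - z 0"
    using sys_sol_Wronskian_const[OF assms CS_sol(2), of x] sys_sol_Wronskian_const[OF assms CS_sol(1), of x]
    by (simp_all add: CS_0)
  show "y x = y 0 * C l x + z 0 * S l x"
    using Wronskian_expand(1)[of "y x" l x "z x"] unfolding w by (simp add: algebra_simps)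
  show "z x = y 0 * C1 l x + z 0 * S1 l x"
    using Wronskian_expand(2)[of "z x" l x "y x"] unfolding w by (simp add: algebra_simps)
qed

lemma sol_shift:
  assumes "sys_sol a (b l) y z"
  shows "sys_sol a (b l) (\<lambda>x. y (x + 1)) (\<lambda>x. z (x + 1))"
proof -
  have per: "a (x + 1) = a x" "b l (x + 1) = b l x" for x by (simp_all add: a_def b_def P_periodic q_periodic)
  have "abs_cont (\<lambda>x. of_real (y (x + 1))) (\<lambda>x. of_real (a (x + 1) * z (x + 1)))"
    "abs_cont (\<lambda>x. of_real (z (x + 1))) (\<lambda>x. of_real (b l (x + 1) * y (x + 1)))"
  proof -
    have 1: "abs_cont (\<lambda>x. of_real (y x)) (\<lambda>x. of_real (a x * z x))" and 2: "abs_cont (\<lambda>x. of_real (z x)) (\<lambda>x. of_real (b l x * y x))"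
      using assms unfolding sys_sol_def by blast+
    show "abs_cont (\<lambda>x. of_real (y (x + 1))) (\<lambda>x. of_real (a (x + 1) * z (x + 1)))" by (rule abs_cont_shift[OF 1])
    show "abs_cont (\<lambda>x. of_real (z (x + 1))) (\<lambda>x. of_real (b l (x + 1) * y (x + 1)))" by (rule abs_cont_shift[OF 2])
  qed
  then show ?thesis unfolding sys_sol_def per by blast
qed

text \<open>The monodromy matrix has determinant one, so the hypothesis is its characteristic
  equation. By periodicity the shifted solution is a solution again, determined by its values at
  0.\<close>

lemma Floquet_solution:
  assumes "r\<^sup>2 - discr l * r + 1 = 0"
  obtains y z where "sys_sol a (b l) y z" "y 0 \<noteq> 0 \<or> z 0 \<noteq> 0" "\<And>x. y (x + 1) = r * y x" "\<And>x. z (x + 1) = r * z x"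
proof -
  obtain v1 v2 where v: "v1 \<noteq> 0 \<or> v2 \<noteq> 0" "C l 1 * v1 + S l 1 * v2 = r * v1" "C1 l 1 * v1 + S1 l 1 * v2 = r * v2"
    using real_eigenvector_2[of "C l 1" "S1 l 1" "S l 1" "C1 l 1" r] CS_Wronskian[of l 1] assms
    by (metis discr_def mult.commute)
  define y where "y x = v1 * C l x + v2 * S l x" for x
  define z where "z x = v1 * C1 l x + v2 * S1 l x" for x
  have sol: "sys_sol a (b l) y z"
    unfolding y_def[abs_def] z_def[abs_def] by (rule sys_sol_lincomb[OF CS_sol])
  have 0: "y 0 = v1" "z 0 = v2" by (simp_all add: y_def z_def CS_0)
  have 1: "y 1 = r * v1" "z 1 = r * v2" using v by (simp_all add: y_def z_def mult.commute)
  show ?thesis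
  proof (rule that[OF sol])
    show "y 0 \<noteq> 0 \<or> z 0 \<noteq> 0" using v 0 by simp
    fix x
    have "y (x + 1) = (r * v1) * C l x + (r * v2) * S l x" "z (x + 1) = (r * v1) * C1 l x + (r * v2) * S1 l x"
      using sol_rep[OF sol_shift[OF sol], of x] 1 by simp_all
    then show "y (x + 1) = r * y x" "z (x + 1) = r * z x"
      by (simp_all add: y_def[of x] z_def[of x] algebra_simps)
  qed
qed

lemma Wronskian_deviation:
  assumes "sys_sol a (b l) y z" "sys_sol a (b m) y' z'"
    and "\<And>t. 0 \<le> t \<Longrightarrow> t \<le> 1 \<Longrightarrow> \<bar>y t\<bar> \<le> B" "\<And>t. 0 \<le> t \<Longrightarrow> t \<le> 1 \<Longrightarrow> \<bar>y' t\<bar> \<le> B"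
  shows "\<bar>(y 1 * z' 1 - z 1 * y' 1) - (y 0 * z' 0 - z 0 * y' 0)\<bar> \<le> \<bar>l - m\<bar> * (B * B)"
proof -
  have B: "0 \<le> B" using assms(3)[of 0] by simp
  have "((\<lambda>x. of_real ((b m x - b l x) * (y x * y' x))) has_integral
      complex_of_real (y 1 * z' 1 - z 1 * y' 1) - of_real (y 0 * z' 0 - z 0 * y' 0)) (cbox 0 1)"
    using acD(4)[OF sys_sol_Wronskian[OF assms(1,2)], of 0 1] by simp
  then have "cmod (complex_of_real (y 1 * z' 1 - z 1 * y' 1) - of_real (y 0 * z' 0 - z 0 * y' 0))
      \<le> (\<bar>l - m\<bar> * (B * B)) * measure lborel (cbox 0 (1::real))"
  proof (rule has_integral_bound[rotated])
    fix x :: real assume "x \<in> cbox 0 1"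
    then have "\<bar>y x\<bar> * \<bar>y' x\<bar> \<le> B * B" using assms(3)[of x] assms(4)[of x] by (intro mult_mono) auto
    then have "\<bar>l - m\<bar> * (\<bar>y x\<bar> * \<bar>y' x\<bar>) \<le> \<bar>l - m\<bar> * (B * B)" by (rule mult_left_mono) simp
    then show "cmod (of_real ((b m x - b l x) * (y x * y' x))) \<le> \<bar>l - m\<bar> * (B * B)"
      unfolding norm_of_real abs_mult by (simp add: b_def)
  qed (use B in simp)
  then show ?thesis by (simp flip: of_real_diff)
qed

text \<open>Local Lipschitz continuity: when solutions for m are paired with solutions for l, the
  Wronskians at 1 and at 0 differ by at most |m - l| times a local constant.\<close>

lemma discr_continuous: "isCont discr l"
proof -
  \<comment> \<open>For |m - l| \<le> 1 the growth rate \<open>K m\<close> exceeds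
    \<open>K l\<close> by at most one, so this bound is uniform near l.\<close>
  define B where "B = 2 * exp (2 * (K l + 1))"
  have bound: "\<bar>C m t\<bar> \<le> B" "\<bar>S m t\<bar> \<le> B" if "\<bar>m - l\<bar> \<le> 1" "0 \<le> t" "t \<le> 1" for m t
  proof -
    have "K m \<le> K l + 1" using that(1) unfolding K_def by linarith
    then have "2 * K m * \<bar>t\<bar> \<le> 2 * (K l + 1) * 1"
      using that ab_bounds(3)[of m] by (intro mult_mono) auto
    then have "2 * exp (2 * K m * \<bar>t\<bar>) \<le> B" by (simp add: B_def)
    then show "\<bar>C m t\<bar> \<le> B" "\<bar>S m t\<bar> \<le> B" using CS_bound[of m t] by linarith+
  qed
  define M where "M = B * B * (\<bar>C l 1\<bar> + \<bar>S l 1\<bar> + \<bar>C1 l 1\<bar> + \<bar>S1 l 1\<bar>)"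
  have lip: "\<bar>discr m - discr l\<bar> \<le> \<bar>m - l\<bar> * M" if m: "\<bar>m - l\<bar> \<le> 1" for m
  proof -
    define e where "e = \<bar>m - l\<bar> * (B * B)"
    have bl: "\<bar>C l t\<bar> \<le> B" "\<bar>S l t\<bar> \<le> B" if "0 \<le> t" "t \<le> 1" for t using bound[of l t] that by auto
    have w: "\<bar>(C m 1 * S1 l 1 - C1 m 1 * S l 1) - 1\<bar> \<le> e" "\<bar>C m 1 * C1 l 1 - C1 m 1 * C l 1\<bar> \<le> e"
      "\<bar>S m 1 * S1 l 1 - S1 m 1 * S l 1\<bar> \<le> e" "\<bar>(S m 1 * C1 l 1 - S1 m 1 * C l 1) + 1\<bar> \<le> e"
      using Wronskian_deviation[OF CS_sol(1)[of m] CS_sol(2)[of l] bound(1)[OF m] bl(2)]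
        Wronskian_deviation[OF CS_sol(1)[of m] CS_sol(1)[of l] bound(1)[OF m] bl(1)]
        Wronskian_deviation[OF CS_sol(2)[of m] CS_sol(2)[of l] bound(2)[OF m] bl(2)]
        Wronskian_deviation[OF CS_sol(2)[of m] CS_sol(1)[of l] bound(2)[OF m] bl(1)]
      by (simp_all add: CS_0 e_def)
    \<comment> \<open>Expand the solutions for m in those for l at the point 1. The summands -1 and
      +1 account for subtracting the diagonal of the monodromy matrix for l.\<close>
    have eq: "discr m - discr l = C l 1 * ((C m 1 * S1 l 1 - C1 m 1 * S l 1) - 1) - S l 1 * (C m 1 * C1 l 1 - C1 m 1 * C l 1)
        + C1 l 1 * (S m 1 * S1 l 1 - S1 m 1 * S l 1) - S1 l 1 * ((S m 1 * C1 l 1 - S1 m 1 * C l 1) + 1)"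
      using Wronskian_expand(1)[of "C m 1" l 1 "C1 m 1"] Wronskian_expand(2)[of "S1 m 1" l 1 "S m 1"]
      unfolding discr_def by (simp add: right_diff_distrib distrib_left)
    have tri: "\<bar>x - y + z - t\<bar> \<le> \<bar>x\<bar> + \<bar>y\<bar> + \<bar>z\<bar> + \<bar>t\<bar>" for x y z t :: real by linarith
    have "\<bar>discr m - discr l\<bar> \<le> \<bar>C l 1\<bar> * e + \<bar>S l 1\<bar> * e + \<bar>C1 l 1\<bar> * e + \<bar>S1 l 1\<bar> * e"
      unfolding eq
      by (rule order_trans[OF tri]) (unfold abs_mult, intro add_mono mult_left_mono w abs_ge_zero)
    also have "\<dots> = e * (\<bar>C l 1\<bar> + \<bar>S l 1\<bar> + \<bar>C1 l 1\<bar> + \<bar>S1 l 1\<bar>)"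
      by (simp add: distrib_left mult.commute)
    also have "\<dots> = \<bar>m - l\<bar> * M" unfolding e_def M_def by (simp only: mult.assoc)
    finally show ?thesis .
  qed
  have ev: "\<forall>\<^sub>F m in at l. norm (discr m - discr l) \<le> \<bar>m - l\<bar> * M"
    unfolding eventually_at using lip by (intro exI[of _ 1]) (auto simp: dist_real_def)
  have "((\<lambda>m. \<bar>m - l\<bar> * M) \<longlongrightarrow> \<bar>l - l\<bar> * M) (at l)" by (intro tendsto_intros)
  then have "((\<lambda>m. \<bar>m - l\<bar> * M) \<longlongrightarrow> 0) (at l)" by simp
  from Lim_null_comparison[OF ev this] have "((\<lambda>m. discr m - discr l) \<longlongrightarrow> 0) (at l)" .
  then show ?thesis unfolding isCont_def by (rule LIM_zero_cancel)
qed

text \<open>For such l the coefficient b is nonnegative, so \<open>C l\<close> and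
  \<open>S1 l\<close> start at 1 and their squares never fall below 1; by continuity neither changes
  sign.\<close>

lemma discr_ge_2:
  assumes "l \<le> - q1"
  shows "2 \<le> discr l"
proof -
  have bp: "0 \<le> b l t" for t using q_le[of t] assms unfolding b_def by linarith
  have ap: "0 \<le> a t" for t using a_pos[of t] by simp
  have "1 \<le> C l 1"
  proof (rule continuous_ge_1_of_sq)
    show "1 \<le> (C l x)\<^sup>2" if "0 \<le> x" for x
      using sys_sol_nonneg_growth(1)[OF CS_sol(1) ap bp _ that] by (simp add: CS_0)
  qed (simp_all add: CS_0 sys_sol_continuous(1)[OF CS_sol(1)])
  moreover have "1 \<le> S1 l 1"
  proof (rule continuous_ge_1_of_sq)
    show "1 \<le> (S1 l x)\<^sup>2" if "0 \<le> x" for x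
      using sys_sol_nonneg_growth(2)[OF CS_sol(2) ap bp _ that] by (simp add: CS_0)
  qed (simp_all add: CS_0 sys_sol_continuous(2)[OF CS_sol(2)])
  ultimately show ?thesis by (simp add: discr_def)
qed

text \<open>Trace two and determinant one make 1 a multiplier, which yields a periodic solution. The
  work lies in its Sobolev regularity and in showing that it is not the zero class.\<close>

lemma discr_eq_2_imp_periodic_eigenvalue:
  assumes "discr l = 2"
  shows "periodic_eigenvalue P q l"
proof -
  define X where "X = {0<..<1::real}"
  have X: "open X" "X \<in> sets lebesgue" by (auto simp: X_def)
  obtain y z where sol: "sys_sol a (b l) y z" and n0: "y 0 \<noteq> 0 \<or> z 0 \<noteq> 0"
    and per: "\<And>x. y (x + 1) = 1 * y x" "\<And>x. z (x + 1) = 1 * z x"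
    using Floquet_solution[of 1 l] assms by auto
  have acy: "abs_cont (\<lambda>x. of_real (y x)) (\<lambda>x. of_real (a x * z x))"
    and acz: "abs_cont (\<lambda>x. of_real (z x)) (\<lambda>x. of_real (b l x * y x))"
    using sol by (auto simp: sys_sol_def)
  have acaz: "abs_cont (\<lambda>x. of_real (a x * z x)) (\<lambda>x. of_real (- P' x / (P x)\<^sup>2 * z x + a x * (b l x * y x)))"
    by (rule abs_cont_cong[OF abs_cont_mult[OF abs_cont_inverse_P acz]]) (auto simp: a_def)
  note yc = sys_sol_continuous(1)[OF sol] and zc = sys_sol_continuous(2)[OF sol]
  have azc: "continuous_on A (\<lambda>x. a x * z x)" for A
  proof -
    have "continuous_on A (\<lambda>x. Re (complex_of_real (a x * z x)))" by (intro continuous_on_Re abs_cont_continuous_on[OF acaz])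
    then show ?thesis by simp
  qed
  have py: "y (x + 1) = y x" and pz: "z (x + 1) = z x" and paz: "a (x + 1) * z (x + 1) = a x * z x" for x
    using per[of x] by (simp_all add: a_def P_periodic)
  obtain By where By: "1 \<le> By" "\<And>x. \<bar>y x\<bar> \<le> By" using periodic_continuous_bounded[OF yc py] by blast
  obtain Bz where Bz: "1 \<le> Bz" "\<And>x. \<bar>z x\<bar> \<le> Bz" using periodic_continuous_bounded[OF zc pz] by blast
  obtain Baz where Baz: "1 \<le> Baz" "\<And>x. \<bar>a x * z x\<bar> \<le> Baz" using periodic_continuous_bounded[OF azc paz] by blast
  define \<phi> where "\<phi> x = complex_of_real (y x)" for x
  define \<phi>' where "\<phi>' x = complex_of_real (a x * z x)" for x
  define \<phi>'' where "\<phi>'' x = complex_of_real (- P' x / (P x)\<^sup>2 * z x + a x * (b l x * y x))" for x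
  have w1: "has_weak_deriv X \<phi> \<phi>'"
    unfolding \<phi>_def[abs_def] \<phi>'_def[abs_def] by (rule abs_cont_imp_weak_deriv[OF acy X(1)])
  have w2: "has_weak_deriv X \<phi>' \<phi>''"
    unfolding \<phi>''_def[abs_def] \<phi>'_def[abs_def] by (rule abs_cont_imp_weak_deriv[OF acaz X(1)])
  have W: "\<phi> \<in> W22 X"
  proof -
    have "\<phi> \<in> L2_space X" unfolding X_def
      by (rule bounded_measurable_L2_unit_interval[where B = By])
        (auto simp: \<phi>_def[abs_def] By(2) intro!: continuous_imp_lebesgue_measurable continuous_intros yc)
    moreover have "\<phi>' \<in> L2_space X" unfolding X_def
      by (rule bounded_measurable_L2_unit_interval[where B = Baz])
        (use Baz(2) in \<open>auto simp: \<phi>'_def[abs_def] simp del: of_real_mult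
          intro!: continuous_imp_lebesgue_measurable continuous_on_of_real azc\<close>)
    moreover have "\<phi>'' \<in> L2_space X" unfolding X_def
    proof (rule bounded_measurable_L2_unit_interval)
      have "y \<in> borel_measurable lebesgue" "z \<in> borel_measurable lebesgue"
        by (intro continuous_imp_lebesgue_measurable yc zc)+
      then show "\<phi>'' \<in> borel_measurable lebesgue"
        unfolding \<phi>''_def[abs_def] using P_meas P'_meas ab_meas by measurable
      fix x :: real
      have "\<bar>- P' x / (P x)\<^sup>2 * z x\<bar> \<le> p2 / p0\<^sup>2 * Bz"
        unfolding abs_mult abs_divide abs_minus_cancel
        using P'_le[of x] Bz(2)[of x] P_ge[of x] p0 nonneg
        by (intro mult_mono frac_le) (auto intro: power_mono)
      moreover have "\<bar>a x * (b l x * y x)\<bar> \<le> 1 / p0 * (K l * By)"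
        unfolding abs_mult using a_le[of x] a_pos[of x] ab_bounds(2)[of l x] ab_bounds(3)[of l] By(2)[of x] p0
        by (intro mult_mono) auto
      ultimately show "cmod (\<phi>'' x) \<le> p2 / p0\<^sup>2 * Bz + 1 / p0 * (K l * By)"
        unfolding \<phi>''_def norm_of_real by linarith
    qed
    ultimately show ?thesis unfolding W22_def using w1 w2 by blast
  qed
  have sl: "ae_eq X (sl_op X P q \<phi>) (\<lambda>x. of_real l * \<phi> x)"
  proof -
    have v: "ae_eq X (weak_deriv X \<phi>) \<phi>'" by (rule weak_deriv_ae_eq(2)[OF w1 X(1)])
    have pv: "ae_eq X (\<lambda>x. of_real (P x) * weak_deriv X \<phi> x) (\<lambda>x. of_real (z x))"
      using v unfolding ae_eq_def
    proof eventually_elim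
      case (elim x)
      then show ?case using P_pos[of x] by (simp add: \<phi>'_def a_def)
    qed
    have "has_weak_deriv X (\<lambda>x. of_real (P x) * weak_deriv X \<phi> x) (\<lambda>x. of_real (b l x * y x))"
      by (rule has_weak_deriv_cong[OF abs_cont_imp_weak_deriv[OF acz X(1)] ae_eq_sym[OF pv] _ X(1)]) simp
    from weak_deriv_ae_eq(2)[OF this X(1)] show ?thesis
      unfolding ae_eq_def
    proof eventually_elim
      case (elim x)
      show ?case unfolding sl_op_def elim by (simp add: b_def \<phi>_def algebra_simps)
    qed
  qed
  have der: "(\<phi> has_vector_derivative \<phi>' x) (at x)" for x
    unfolding \<phi>_def[abs_def] \<phi>'_def
    by (rule abs_cont_has_vector_derivative[OF acy]) (intro continuous_on_of_real azc)
  \<comment> \<open>If the class were zero, y would vanish on the interval by continuity; then z is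
    constant there, and z = P y' is zero at an interior point, against the initial values.\<close>
  have nz: "\<not> ae_eq X \<phi> (\<lambda>x. 0)"
  proof
    assume "ae_eq X \<phi> (\<lambda>x. 0)"
    then have "AE x in lebesgue. x \<in> X \<longrightarrow> y x = 0"
      unfolding ae_eq_iff[OF X(2)] by eventually_elim (simp add: \<phi>_def)
    then obtain N where N: "negligible N" "{x. \<not> (x \<in> X \<longrightarrow> y x = 0)} \<subseteq> N"
      unfolding eventually_ae_filter_negligible by blast
    have "negligible (N \<union> {0, 1})" using N(1) by (intro negligible_Un) auto
    then have "integral {0..1} (\<lambda>x. (y x)\<^sup>2) = integral {0..1::real} (\<lambda>x. 0)"
    proof (rule integral_spike)
      fix x :: real assume x: "x \<in> {0..1} - (N \<union> {0, 1})"
      then have "x \<in> X" by (auto simp: X_def)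
      moreover have "x \<notin> {x. \<not> (x \<in> X \<longrightarrow> y x = 0)}" using N(2) x by blast
      ultimately show "0 = (y x)\<^sup>2" by simp
    qed
    then have "integral {0..1} (\<lambda>x. (y x)\<^sup>2) = 0" by simp
    then have y0: "y x = 0" if "0 \<le> x" "x \<le> 1" for x
    proof -
      have "continuous_on {0..1} (\<lambda>x. (y x)\<^sup>2)" by (intro continuous_intros yc)
      from integral_eq_0_iff[OF this] have "\<forall>x\<in>{0..1}. (y x)\<^sup>2 = 0"
        using \<open>integral {0..1} (\<lambda>x. (y x)\<^sup>2) = 0\<close> by simp
      then show ?thesis using that by simp
    qed
    have z0: "z x = z 0" if "0 \<le> x" "x \<le> 1" for x
    proof -
      have "((\<lambda>t. of_real (b l t * y t)) has_integral (complex_of_real (z x) - of_real (z 0))) {0..x}"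
        by (rule acD(4)[OF acz that(1)])
      then have "((\<lambda>t. 0) has_integral (complex_of_real (z x) - of_real (z 0))) {0..x}"
        by (rule has_integral_eq[rotated]) (use y0 that in auto)
      then have "complex_of_real (z x) - of_real (z 0) = 0" by (rule has_integral_unique[OF _ has_integral_0])
      then show ?thesis by (metis eq_iff_diff_eq_0 of_real_eq_iff)
    qed
    have "((\<lambda>x. 0) has_vector_derivative 0) (at (1/2::real))" by simp
    then have "(\<phi> has_vector_derivative 0) (at (1/2))"
      by (rule has_vector_derivative_transform_within_open[where S = "{0<..<1}"]) (auto simp: \<phi>_def y0)
    with der[of "1/2"] have "\<phi>' (1/2) = 0" by (rule vector_derivative_unique_at)
    then have "z (1/2) = 0" using a_pos[of "1/2"] by (simp add: \<phi>'_def)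
    then show False using n0 y0[of 0] z0[of "1/2"] by simp
  qed
  show ?thesis
    unfolding periodic_eigenvalue_def X_def[symmetric]
  proof (rule exI[of _ \<phi>], rule exI[of _ \<phi>'], intro conjI)
    show "\<forall>x\<in>{0..1}. (\<phi> has_vector_derivative \<phi>' x) (at x within {0..1})"
      using der by (auto intro: has_vector_derivative_at_within)
    show "continuous_on {0..1} \<phi>'" unfolding \<phi>'_def[abs_def] by (intro continuous_on_of_real azc)
    show "\<phi> 0 = \<phi> 1" using per(1)[of 0] by (simp add: \<phi>_def)
    show "\<phi>' 0 = \<phi>' 1" using per(2)[of 0] P_periodic[of 0] by (simp add: \<phi>'_def a_def)
  qed (use W sl nz in auto)
qed

lemma discr_gt_2:
  assumes "\<And>m. periodic_eigenvalue P q m \<Longrightarrow> m0 \<le> m" "l < m0"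
  shows "2 < discr l"
proof (rule ccontr)
  assume n: "\<not> 2 < discr l"
  \<comment> \<open>Far enough to the left for \<open>discr_ge_2\<close>; the minimum covers an l
    that already lies below -q1.\<close>
  define l' where "l' = min l (- q1)"
  have "\<exists>x\<ge>l'. x \<le> l \<and> discr x = 2"
    using n discr_ge_2[of l'] discr_continuous by (intro IVT2') (auto simp: l'_def intro: continuous_at_imp_continuous_on)
  then obtain x where "x \<le> l" "discr x = 2" by blast
  then show False using discr_eq_2_imp_periodic_eigenvalue[of x] assms by fastforce
qed

text \<open>The mixed Wronskian P U' y - U z has derivative -y times (H - l) U. The weight exp(-k x)
  makes y periodic, hence bounded, and turns the identity into the damped equation of
  \<open>abs_cont_damped_energy\<close>.\<close>

lemma Floquet_one_sided:
  assumes sol: "sys_sol a (b l) y z" and per: "\<And>x. y (x + 1) = exp k * y x" "\<And>x. z (x + 1) = exp k * z x"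
  defines "E \<equiv> \<lambda>x. complex_of_real (exp (- k * x))"
  obtains B where "1 \<le> B" "\<And>x. \<bar>exp (- k * x) * y x\<bar> \<le> B"
    "\<And>U V W. W22_repr U V W \<Longrightarrow> (\<lambda>x. E x * (of_real (P x) * V x * of_real (y x) - U x * of_real (z x))) \<in> L2 \<and>
      \<bar>k\<bar> * N2 (\<lambda>x. E x * (of_real (P x) * V x * of_real (y x) - U x * of_real (z x)))
        \<le> B * N2 (\<lambda>x. sl U V W x - of_real l * U x)"
proof -
  note yc = sys_sol_continuous(1)[OF sol] and zc = sys_sol_continuous(2)[OF sol]
  have e1: "exp (- k * (x + 1)) * (exp k * t) = exp (- k * x) * t" for x t
  proof -
    have "exp (- k * (x + 1)) * exp k = exp (- k * x)" by (simp add: mult_exp_exp algebra_simps)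
    then show ?thesis by (simp add: mult.assoc[symmetric])
  qed
  have yE: "continuous_on UNIV (\<lambda>x. exp (- k * x) * y x)" and zE: "continuous_on UNIV (\<lambda>x. exp (- k * x) * z x)"
    by (intro continuous_intros yc zc)+
  obtain B where B: "1 \<le> B" "\<And>x. \<bar>exp (- k * x) * y x\<bar> \<le> B"
    using periodic_continuous_bounded[OF yE] per(1) e1 by metis
  obtain B' where B': "1 \<le> B'" "\<And>x. \<bar>exp (- k * x) * z x\<bar> \<le> B'"
    using periodic_continuous_bounded[OF zE] per(2) e1 by metis
  have acE: "abs_cont E (\<lambda>x. of_real (- k * exp (- k * x)))"
    unfolding E_def
  proof (rule abs_cont_C1)
    show "((\<lambda>x. complex_of_real (exp (- k * x))) has_vector_derivative complex_of_real (- k * exp (- k * x))) (at x)" for x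
      by (intro has_vector_derivative_of_real)
        (auto intro!: derivative_eq_intros simp: has_real_derivative_iff_has_vector_derivative[symmetric])
  qed (intro continuous_intros)
  have acy: "abs_cont (\<lambda>x. of_real (y x)) (\<lambda>x. of_real (a x * z x))"
    and acz: "abs_cont (\<lambda>x. of_real (z x)) (\<lambda>x. of_real (b l x * y x))"
    using sol by (auto simp: sys_sol_def)
  have mE: "(\<lambda>x. E x * of_real (y x)) \<in> borel_measurable lebesgue" "(\<lambda>x. E x * of_real (z x)) \<in> borel_measurable lebesgue"
    unfolding E_def by (intro continuous_imp_lebesgue_measurable continuous_intros yc zc)+
  have bE: "AE x in lebesgue. cmod (E x * of_real (y x)) \<le> B" "AE x in lebesgue. cmod (E x * of_real (z x)) \<le> B'"
    using B(2) B'(2) by (auto simp: E_def norm_mult abs_mult)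
  have BB: "0 \<le> B" "0 \<le> B'" using B B' by auto
  show ?thesis
  proof (rule that[OF B])
    fix U V W assume t: "W22_repr U V W"
    note T = W22_reprD[OF t]
    define g where "g x = E x * (of_real (P x) * V x * of_real (y x) - U x * of_real (z x))" for x
    define F where "F x = sl U V W x - of_real l * U x" for x
    have F: "F \<in> L2" unfolding F_def[abs_def] by (intro L2_diff sl_L2[OF t] L2_scale T)
    have "g = (\<lambda>x. (E x * of_real (y x)) * (of_real (P x) * V x) - (E x * of_real (z x)) * U x)"
      by (auto simp: g_def algebra_simps)
    then have gL: "g \<in> L2"
      using L2_mult_bounded(1)[OF L2_PP'q(1)[OF T(4)] mE(1) bE(1) BB(1)] L2_mult_bounded(1)[OF T(3) mE(2) bE(2) BB(2)]
      by (simp add: L2_diff)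
    have GL: "(\<lambda>x. (E x * of_real (y x)) * F x) \<in> L2" "N2 (\<lambda>x. (E x * of_real (y x)) * F x) \<le> B * N2 F"
      by (rule L2_mult_bounded[OF F mE(1) bE(1) BB(1)])+
    have "abs_cont g (\<lambda>x. - (of_real k * g x) - (E x * of_real (y x)) * F x)"
    proof (rule abs_cont_cong[OF abs_cont_mult[OF acE abs_cont_diff[OF abs_cont_mult[OF abs_cont_PV[OF t] acy] abs_cont_mult[OF T(1) acz]]]])
      show "AE x in lebesgue. complex_of_real (- k * exp (- k * x)) * (of_real (P x) * V x * of_real (y x) - U x * of_real (z x))
          + E x * (((of_real (P' x) * V x + of_real (P x) * W x) * of_real (y x) + of_real (P x) * V x * of_real (a x * z x))
            - (V x * of_real (z x) + U x * of_real (b l x * y x)))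
          = - (of_real k * g x) - E x * of_real (y x) * F x"
      proof (rule AE_I2)
        fix x
        have pa: "complex_of_real (P x) * V x * of_real (a x * z x) = V x * of_real (z x)"
          using P_pos[of x] by (simp add: a_def)
        show "complex_of_real (- k * exp (- k * x)) * (of_real (P x) * V x * of_real (y x) - U x * of_real (z x))
          + E x * (((of_real (P' x) * V x + of_real (P x) * W x) * of_real (y x) + of_real (P x) * V x * of_real (a x * z x))
            - (V x * of_real (z x) + U x * of_real (b l x * y x)))
          = - (of_real k * g x) - E x * of_real (y x) * F x"
          unfolding pa by (simp add: g_def F_def sl_def b_def E_def algebra_simps)
      qed
    qed (simp add: g_def)
    from abs_cont_damped_energy[OF this gL GL(1)] GL(2)
    show "(\<lambda>x. E x * (of_real (P x) * V x * of_real (y x) - U x * of_real (z x))) \<in> L2 \<and>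
      \<bar>k\<bar> * N2 (\<lambda>x. E x * (of_real (P x) * V x * of_real (y x) - U x * of_real (z x)))
        \<le> B * N2 (\<lambda>x. sl U V W x - of_real l * U x)"
      using gL unfolding g_def[abs_def] F_def[abs_def] by simp
  qed
qed

text \<open>The multipliers r and 1/r belong to independent solutions. Each weighted mixed Wronskian
  is bounded by (H - l) U, and U is recovered from the two algebraically because the opposite
  exponential weights cancel.\<close>

lemma hyperbolic_lower:
  assumes discr: "2 < discr l"
  obtains c where "0 < c" "\<And>U V W. W22_repr U V W \<Longrightarrow> c * N2 U \<le> N2 (\<lambda>x. sl U V W x - of_real l * U x)"
proof -
  define s where "s = sqrt ((discr l)\<^sup>2 - 4)"
  have D4: "(discr l)\<^sup>2 > 4" using discr power_strict_mono[of 2 "discr l" 2] by simp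
  then have s: "s > 0" "s\<^sup>2 = (discr l)\<^sup>2 - 4" by (simp_all add: s_def)
  define r where "r = (discr l + s) / 2"
  have r1: "r > 1" using discr s by (simp add: r_def)
  have rr: "r\<^sup>2 - discr l * r + 1 = 0" using s(2) by (simp add: r_def power2_eq_square field_simps)
  have ri: "(inverse r)\<^sup>2 - discr l * inverse r + 1 = 0"
  proof -
    have "(inverse r)\<^sup>2 - discr l * inverse r + 1 = (r\<^sup>2 - discr l * r + 1) / r\<^sup>2"
      using r1 by (simp add: field_simps power2_eq_square)
    then show ?thesis using rr by simp
  qed
  define k where "k = ln r"
  have k: "k > 0" "exp k = r" "exp (- k) = inverse r" using r1 by (auto simp: k_def exp_minus)
  obtain y z where yz: "sys_sol a (b l) y z" "y 0 \<noteq> 0 \<or> z 0 \<noteq> 0" "\<And>x. y (x + 1) = exp k * y x" "\<And>x. z (x + 1) = exp k * z x"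
    using Floquet_solution[OF rr] unfolding k(2) by blast
  obtain y' z' where yz': "sys_sol a (b l) y' z'" "y' 0 \<noteq> 0 \<or> z' 0 \<noteq> 0"
      "\<And>x. y' (x + 1) = exp (- k) * y' x" "\<And>x. z' (x + 1) = exp (- k) * z' x"
    using Floquet_solution[OF ri] unfolding k(3) by blast
  define w where "w = y 0 * z' 0 - z 0 * y' 0"
  have wx: "y x * z' x - z x * y' x = w" for x
    unfolding w_def by (rule sys_sol_Wronskian_const[OF yz(1) yz'(1)])
  \<comment> \<open>Proportional initial values would make the two solutions proportional
    everywhere, but their multipliers differ.\<close>
  have w: "w \<noteq> 0"
  proof
    assume "w = 0"
    then have 0: "y 0 * z' 0 = z 0 * y' 0" by (simp add: w_def)
    obtain t where t: "y' 0 = t * y 0" "z' 0 = t * z 0"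
    proof (cases "y 0 = 0")
      case True
      then have "z 0 \<noteq> 0" using yz(2) by simp
      moreover from this have "y' 0 = 0" using 0 True by simp
      ultimately show ?thesis using True by (intro that[of "z' 0 / z 0"]) auto
    next
      case False
      then show ?thesis using 0 by (intro that[of "y' 0 / y 0"]) (auto simp: field_simps)
    qed
    have "y' x = t * y x" "z' x = t * z x" for x
      using sol_rep[OF yz'(1), of x] sol_rep[OF yz(1), of x] t by (simp_all add: algebra_simps)
    from this(1)[of 1] this(2)[of 1] have "exp (- k) * y' 0 = exp k * y' 0" "exp (- k) * z' 0 = exp k * z' 0"
      using yz(3,4)[of 0] yz'(3,4)[of 0] t by simp_all
    moreover have "exp (- k) \<noteq> exp k" using k(1) by simp
    ultimately show False using yz'(2) by auto
  qed
  obtain B where B: "1 \<le> B" "\<And>x. \<bar>exp (- k * x) * y x\<bar> \<le> B"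
    "\<And>U V W. W22_repr U V W \<Longrightarrow> (\<lambda>x. complex_of_real (exp (- k * x)) * (of_real (P x) * V x * of_real (y x) - U x * of_real (z x))) \<in> L2 \<and>
      \<bar>k\<bar> * N2 (\<lambda>x. complex_of_real (exp (- k * x)) * (of_real (P x) * V x * of_real (y x) - U x * of_real (z x)))
        \<le> B * N2 (\<lambda>x. sl U V W x - of_real l * U x)"
    using Floquet_one_sided[OF yz(1,3,4)] by blast
  obtain B' where B': "1 \<le> B'" "\<And>x. \<bar>exp (- (- k) * x) * y' x\<bar> \<le> B'"
    "\<And>U V W. W22_repr U V W \<Longrightarrow> (\<lambda>x. complex_of_real (exp (- (- k) * x)) * (of_real (P x) * V x * of_real (y' x) - U x * of_real (z' x))) \<in> L2 \<and>
      \<bar>- k\<bar> * N2 (\<lambda>x. complex_of_real (exp (- (- k) * x)) * (of_real (P x) * V x * of_real (y' x) - U x * of_real (z' x)))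
        \<le> B' * N2 (\<lambda>x. sl U V W x - of_real l * U x)"
    using Floquet_one_sided[OF yz'(1,3,4)] by blast
  show ?thesis
  \<comment> \<open>Each of the two terms that recover w U is bounded by B B' / k times the norm of
    (H - l) U.\<close>
  proof (rule that[of "\<bar>w\<bar> * k / (2 * B * B')"])
    show "0 < \<bar>w\<bar> * k / (2 * B * B')" using w k B(1) B'(1) by simp
    fix U V W assume t: "W22_repr U V W"
    define F where "F = N2 (\<lambda>x. sl U V W x - of_real l * U x)"
    define g where "g x = complex_of_real (exp (- k * x)) * (of_real (P x) * V x * of_real (y x) - U x * of_real (z x))" for x
    define g' where "g' x = complex_of_real (exp (- (- k) * x)) * (of_real (P x) * V x * of_real (y' x) - U x * of_real (z' x))" for x
    have g: "g \<in> L2" "k * N2 g \<le> B * F" and g': "g' \<in> L2" "k * N2 g' \<le> B' * F"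
      using B(3)[OF t] B'(3)[OF t] k(1) by (auto simp: g_def[abs_def] g'_def[abs_def] F_def)
    define m where "m x = complex_of_real (exp (- (- k) * x) * y' x)" for x
    define m' where "m' x = complex_of_real (exp (- k * x) * y x)" for x
    have mm: "m \<in> borel_measurable lebesgue" "m' \<in> borel_measurable lebesgue"
      unfolding m_def[abs_def] m'_def[abs_def]
      by (intro continuous_imp_lebesgue_measurable continuous_intros sys_sol_continuous[OF yz(1)] sys_sol_continuous[OF yz'(1)])+
    have mb: "AE x in lebesgue. cmod (m x) \<le> B'" "AE x in lebesgue. cmod (m' x) \<le> B"
      unfolding m_def m'_def norm_of_real using B(2) B'(2) by auto
    \<comment> \<open>Eliminating P V from the two mixed Wronskians leaves U times the Wronskian of
      the Floquet solutions.\<close>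
    have U: "of_real w * U x = m x * g x - m' x * g' x" for x
    proof -
      have e: "complex_of_real (exp (- (- k) * x)) * complex_of_real (exp (- k * x)) = 1"
        by (simp flip: of_real_mult exp_add)
      have "m x * g x - m' x * g' x = (complex_of_real (exp (- (- k) * x)) * complex_of_real (exp (- k * x)))
          * (U x * of_real (y x * z' x - z x * y' x))"
        by (simp add: m_def m'_def g_def g'_def algebra_simps)
      then show ?thesis unfolding e wx by simp
    qed
    have B0: "0 \<le> B" "0 \<le> B'" using B(1) B'(1) by auto
    have "\<bar>w\<bar> * N2 U = N2 (\<lambda>x. of_real w * U x)" by (simp add: N2_scale)
    also have "\<dots> = N2 (\<lambda>x. m x * g x - m' x * g' x)" by (simp add: U)
    also have "\<dots> \<le> N2 (\<lambda>x. m x * g x) + N2 (\<lambda>x. m' x * g' x)"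
      by (intro N2_triangle_diff L2_mult_bounded(1)[OF g(1) mm(1) mb(1) B0(2)] L2_mult_bounded(1)[OF g'(1) mm(2) mb(2) B0(1)])
    also have "\<dots> \<le> B' * N2 g + B * N2 g'"
      by (intro add_mono L2_mult_bounded(2)[OF g(1) mm(1) mb(1) B0(2)] L2_mult_bounded(2)[OF g'(1) mm(2) mb(2) B0(1)])
    finally have "k * (\<bar>w\<bar> * N2 U) \<le> k * (B' * N2 g + B * N2 g')" using k(1) by simp
    also have "\<dots> = B' * (k * N2 g) + B * (k * N2 g')" by (simp add: algebra_simps)
    also have "\<dots> \<le> B' * (B * F) + B * (B' * F)"
      using g(2) g'(2) B0 by (intro add_mono mult_left_mono)
    finally have "\<bar>w\<bar> * k * N2 U \<le> F * (2 * B * B')" by (simp add: algebra_simps)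
    then have "\<bar>w\<bar> * k / (2 * B * B') * N2 U \<le> F"
      using B(1) B'(1) by (simp add: divide_le_eq)
    then show "\<bar>w\<bar> * k / (2 * B * B') * N2 U \<le> N2 (\<lambda>x. sl U V W x - of_real l * U x)" by (simp add: F_def)
  qed
qed

end

section \<open>The bottom of the spectrum\<close>

definition L2_inner :: "(real \<Rightarrow> complex) \<Rightarrow> (real \<Rightarrow> complex) \<Rightarrow> complex" where
  "L2_inner f g = integral\<^sup>L lebesgue (\<lambda>x. f x * cnj (g x))"

lemma L2_inner_integrable: "f \<in> L2 \<Longrightarrow> g \<in> L2 \<Longrightarrow> integrable lebesgue (\<lambda>x. f x * cnj (g x))"
  by (intro L2_prod_integrable L2_cnj)

lemma L2_inner_diff_left:
  assumes "f \<in> L2" "g \<in> L2" "h \<in> L2"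
  shows "L2_inner (\<lambda>x. f x - c * g x) h = L2_inner f h - c * L2_inner g h"
  using Bochner_Integration.integral_diff[OF L2_inner_integrable[OF assms(1,3)] integrable_mult_right[OF L2_inner_integrable[OF assms(2,3)], of c]]
  by (simp add: L2_inner_def left_diff_distrib mult.assoc)

lemma L2_inner_cnj: "cnj (L2_inner f g) = L2_inner g f"
proof -
  have "cnj (L2_inner f g) = integral\<^sup>L lebesgue (\<lambda>x. cnj (f x * cnj (g x)))"
    unfolding L2_inner_def by (rule Bochner_Integration.integral_cnj[symmetric])
  then show ?thesis by (simp add: L2_inner_def mult.commute)
qed

lemma L2_inner_diff_right:
  assumes "f \<in> L2" "g \<in> L2" "h \<in> L2"
  shows "L2_inner h (\<lambda>x. f x - c * g x) = L2_inner h f - cnj c * L2_inner h g"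
  using arg_cong[OF L2_inner_diff_left[OF assms, of c], of cnj] by (simp add: L2_inner_cnj)

lemma L2_inner_self: "L2_inner f f = of_real ((N2 f)\<^sup>2)"
  unfolding L2_inner_def N2_sq by (subst integral_complex_of_real[symmetric]) (simp add: of_real_cmod_sq)

lemma L2_inner_le: "f \<in> L2 \<Longrightarrow> g \<in> L2 \<Longrightarrow> cmod (L2_inner f g) \<le> N2 f * N2 g"
  using L2_Cauchy_Schwarz(2)[of f "\<lambda>x. cnj (g x)"] L2_cnj[of g] by (simp add: L2_inner_def N2_eq)

lemma L2_inner_cong_left:
  assumes "ae_eq UNIV f g" "f \<in> L2" "h \<in> L2"
  shows "L2_inner f h = L2_inner g h"
  unfolding L2_inner_def
proof (rule integral_cong_AE)
  show "AE x in lebesgue. f x * cnj (h x) = g x * cnj (h x)"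
    using assms(1) unfolding ae_eq_UNIV_iff by eventually_elim simp
qed (use L2_inner_integrable[OF assms(2,3)] L2_inner_integrable[OF L2_cong(1)[OF assms(1,2)] assms(3)] in auto)

context bounded_coeffs
begin

text \<open>Lagrange's identity: the difference of the two sides is, up to sign, the integral of the
  derivative of a Wronskian that is integrable over the line.\<close>

lemma sl_symmetric:
  assumes t: "W22_repr U V W" and t': "W22_repr U' V' W'"
  shows "L2_inner (sl U V W) U' = cnj (L2_inner (sl U' V' W') U)"
proof -
  note T = W22_reprD[OF t] and T' = W22_reprD[OF t'] and S = sl_L2[OF t] and S' = sl_L2[OF t']
  have i: "integrable lebesgue (\<lambda>x. U x * cnj (sl U' V' W' x))" "integrable lebesgue (\<lambda>x. sl U V W x * cnj (U' x))"
    by (intro L2_inner_integrable T T' S S')+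
  have "integral\<^sup>L lebesgue (\<lambda>x. U x * cnj (sl U' V' W' x) - sl U V W x * cnj (U' x)) = 0"
  proof (rule abs_cont_integral_zero)
    show "abs_cont (\<lambda>x. of_real (P x) * V x * cnj (U' x) - U x * cnj (of_real (P x) * V' x))
        (\<lambda>x. U x * cnj (sl U' V' W' x) - sl U V W x * cnj (U' x))"
      by (rule abs_cont_cong[OF abs_cont_diff[OF abs_cont_mult[OF abs_cont_PV[OF t] abs_cont_cnj[OF T'(1)]] abs_cont_mult[OF T(1) abs_cont_cnj[OF abs_cont_PV[OF t']]]]])
        (auto simp: sl_def algebra_simps)
    show "integrable lebesgue (\<lambda>x. of_real (P x) * V x * cnj (U' x) - U x * cnj (of_real (P x) * V' x))"
      by (intro Bochner_Integration.integrable_diff L2_inner_integrable L2_PP'q T T')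
  qed (use i in auto)
  then have "L2_inner U (sl U' V' W') - L2_inner (sl U V W) U' = 0"
    using Bochner_Integration.integral_diff[OF i] by (simp add: L2_inner_def)
  then show ?thesis by (simp add: L2_inner_cnj)
qed

lemma form_eq_ip: "W22_repr U V W \<Longrightarrow> of_real (form U V) = L2_inner (sl U V W) U"
  using sl_form by (simp add: L2_inner_def)

lemma form_scale: "form (\<lambda>x. c * U x) (\<lambda>x. c * V x) = (cmod c)\<^sup>2 * form U V"
proof -
  have "(\<lambda>x. P x * (cmod (c * V x))\<^sup>2 + q x * (cmod (c * U x))\<^sup>2)
      = (\<lambda>x. (cmod c)\<^sup>2 * (P x * (cmod (V x))\<^sup>2 + q x * (cmod (U x))\<^sup>2))"
    by (auto simp: norm_mult power_mult_distrib algebra_simps)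
  then show ?thesis by (simp add: form_def)
qed

lemma form_zero: "W22_repr U V W \<Longrightarrow> N2 U = 0 \<Longrightarrow> form U V = 0"
  using L2_inner_le[OF sl_L2 W22_reprD(3), of U V W U V W] form_eq_ip[of U V W]
  by (metis mult_zero_right norm_le_zero_iff of_real_eq_0_iff)

text \<open>At the infimum of the quadratic form the operator is not bounded below: apply the resolvent at
  distance one to an almost minimiser of the form.\<close>
lemma form_bottom:
  assumes low: "\<And>l. l < m0 \<Longrightarrow> \<exists>c>0. \<forall>U V W. W22_repr U V W \<longrightarrow> c * N2 U \<le> N2 (\<lambda>x. sl U V W x - of_real l * U x)"
  shows "form_bound m0"
proof (rule ccontr)
  define R where "R = {form U V / (N2 U)\<^sup>2 | U V W. W22_repr U V W \<and> N2 U \<noteq> 0}"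
  define m where "m = Inf R"
  assume "\<not> form_bound m0"
  then obtain U V W where UVW: "W22_repr U V W" "form U V < m0 * (N2 U)\<^sup>2" by (auto simp: form_bound_def not_le)
  have n0: "N2 U \<noteq> 0" using UVW form_zero by fastforce
  have inR: "form U V / (N2 U)\<^sup>2 \<in> R" using UVW(1) n0 unfolding R_def by blast
  have Rlow: "- q1 \<le> r" if r: "r \<in> R" for r
  proof -
    obtain U V W where UVW: "r = form U V / (N2 U)\<^sup>2" "W22_repr U V W" "N2 U \<noteq> 0" using r by (auto simp: R_def)
    then have "- q1 * (N2 U)\<^sup>2 \<le> form U V" using form_bound_q1 unfolding form_bound_def by blast
    then show ?thesis using UVW by (simp add: le_divide_eq)
  qed
  have bdd: "bdd_below R" using Rlow by (rule bdd_belowI)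
  have "m \<le> form U V / (N2 U)\<^sup>2" unfolding m_def by (rule cInf_lower[OF inR bdd])
  also have "\<dots> < m0" using UVW(2) n0 by (simp add: divide_less_eq)
  finally have mm0: "m < m0" .
  have mq: "- q1 \<le> m" unfolding m_def using inR Rlow by (intro cInf_greatest) auto
  have fb: "form_bound m"
    unfolding form_bound_def
  proof safe
    fix U V W assume t: "W22_repr U V W"
    show "m * (N2 U)\<^sup>2 \<le> form U V"
    proof (cases "N2 U = 0")
      case True
      then show ?thesis using form_zero[OF t] by simp
    next
      case False
      then have "form U V / (N2 U)\<^sup>2 \<in> R" using t unfolding R_def by blast
      then have "m \<le> form U V / (N2 U)\<^sup>2" unfolding m_def using bdd by (intro cInf_lower)
      then show ?thesis using False by (simp add: le_divide_eq)
    qed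
  qed
  obtain c where c: "c > 0" "\<And>U V W. W22_repr U V W \<Longrightarrow> c * N2 U \<le> N2 (\<lambda>x. sl U V W x - of_real m * U x)"
    using low[OF mm0] by blast
  \<comment> \<open>The value c^2 / 16 makes the final chain c^2 / 4 \<le> 2 \<theta> \<le> c^2 / 8
    contradictory, and 1/2 keeps the norm of \<open>X\<close> at least 1/2. The minimiser is taken
    within \<theta>^2 of the infimum, so that its defect has the size of the second-order term
    below.\<close>
  define \<theta> where "\<theta> = min (1 / 2) (c\<^sup>2 / 16)"
  have \<theta>: "0 < \<theta>" "\<theta> \<le> 1 / 2" "\<theta> \<le> c\<^sup>2 / 16" using c(1) by (auto simp: \<theta>_def)
  have "Inf R < m + \<theta>\<^sup>2" using \<theta>(1) by (simp add: m_def)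
  then obtain r where "r \<in> R" "r < m + \<theta>\<^sup>2" using cInf_lessD[of R "m + \<theta>\<^sup>2"] inR by auto
  then obtain U0 V0 W0 where t0: "W22_repr U0 V0 W0" "N2 U0 \<noteq> 0" "form U0 V0 / (N2 U0)\<^sup>2 < m + \<theta>\<^sup>2"
    unfolding R_def by blast
  define n where "n = complex_of_real (1 / N2 U0)"
  define U where "U x = n * U0 x" for x
  define V where "V x = n * V0 x" for x
  define W where "W x = n * W0 x" for x
  have t: "W22_repr U V W"
    using W22_repr_lincomb[OF t0(1) t0(1), of n 0] unfolding U_def[abs_def] V_def[abs_def] W_def[abs_def] by simp
  have cn: "cmod n = 1 / N2 U0" by (simp add: n_def norm_divide)
  have N1: "N2 U = 1" unfolding U_def N2_scale cn using t0(2) by simp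
  have fU: "form U V < m + \<theta>\<^sup>2"
    using t0(3) unfolding U_def V_def form_scale cn by (simp add: power_divide)
  note T = W22_reprD[OF t] and S = sl_L2[OF t]
  \<comment> \<open>\<open>X\<close> will be the resolvent at m - 1 applied to \<open>U\<close>. The
    gap being one, its norm is at most that of \<open>U\<close>, and (H - m) X = U - X.\<close>
  have gap1: "gap m (of_real (m - 1)) = 1" by (simp add: gap_def)
  obtain v where v: "v \<in> W22R" "ae_eq UNIV (\<lambda>x. sl_op UNIV P q v x - of_real (m - 1) * v x) U"
    using resolvent_onto[OF fb mq, of "of_real (m - 1)"] T(3) gap1 by (auto simp: onto_op_def)
  obtain X Y Z where X: "W22_repr X Y Z" "ae_eq UNIV v X" by (rule W22_obtain_repr[OF v(1)])
  note TX = W22_reprD[OF X(1)] and SX = sl_L2[OF X(1)]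
  have eqU: "ae_eq UNIV (\<lambda>x. sl X Y Z x - of_real (m - 1) * X x) U"
    using v(2) sl_op_ae_eq[OF X] X(2) unfolding ae_eq_UNIV_iff by eventually_elim simp
  define B where "B x = sl X Y Z x - of_real m * X x" for x
  define h where "h x = U x - 1 * X x" for x
  have BL: "B \<in> L2" unfolding B_def[abs_def] by (intro L2_diff SX L2_scale TX)
  have hL: "h \<in> L2" unfolding h_def[abs_def] by (intro L2_diff T L2_scale TX)
  have Bh: "ae_eq UNIV B h"
    using eqU unfolding ae_eq_UNIV_iff by eventually_elim (simp add: B_def h_def algebra_simps)
  have NX: "N2 X \<le> 1"
  proof -
    have "gap m (of_real (m - 1)) * N2 X \<le> N2 (\<lambda>x. sl X Y Z x - of_real (m - 1) * X x)"
      by (rule gap_lower[OF fb X(1)])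
    also have "\<dots> = N2 U"
      by (rule L2_cong(2)[OF eqU, symmetric]) (intro L2_diff SX L2_scale TX)
    finally show ?thesis using N1 gap1 by simp
  qed
  define s where "s = Re (L2_inner X U)"
  have s: "s \<le> N2 X"
    using complex_Re_le_cmod[of "L2_inner X U"] L2_inner_le[OF TX(3) T(3)] N1 by (simp add: s_def)
  define A where "A x = sl U V W x - of_real m * U x" for x
  have AL: "A \<in> L2" unfolding A_def[abs_def] by (intro L2_diff S L2_scale T)
  have AU: "L2_inner A U = of_real (form U V - m)"
    unfolding A_def[abs_def] using L2_inner_diff_left[OF S T(3) T(3), of "of_real m"] form_eq_ip[OF t] N1
    by (simp add: L2_inner_self)
  have AX: "L2_inner A X = cnj (L2_inner B U)"
    unfolding A_def[abs_def] B_def[abs_def]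
    using L2_inner_diff_left[OF S T(3) TX(3), of "of_real m"] L2_inner_diff_left[OF SX TX(3) T(3), of "of_real m"]
    by (simp add: sl_symmetric[OF t X(1)] L2_inner_cnj)
  have BU: "L2_inner B U = 1 - L2_inner X U"
    unfolding L2_inner_cong_left[OF Bh BL T(3)] h_def[abs_def]
    using L2_inner_diff_left[OF T(3) TX(3) T(3), of 1] N1 by (simp add: L2_inner_self)
  have BX: "L2_inner B X = cnj (L2_inner X U) - of_real ((N2 X)\<^sup>2)"
    unfolding L2_inner_cong_left[OF Bh BL TX(3)] h_def[abs_def]
    using L2_inner_diff_left[OF T(3) TX(3) TX(3), of 1] by (simp add: L2_inner_self L2_inner_cnj)
  \<comment> \<open>The trial function U - \<theta> X. To first order in \<theta> the shifted form
    drops by 2 \<theta> (1 - s); since it cannot become negative, s is close to 1 and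
    \<open>X\<close> is close to \<open>U\<close>.\<close>
  define U' where "U' x = 1 * U x + (- of_real \<theta>) * X x" for x
  define V' where "V' x = 1 * V x + (- of_real \<theta>) * Y x" for x
  define W' where "W' x = 1 * W x + (- of_real \<theta>) * Z x" for x
  have t': "W22_repr U' V' W'"
    unfolding U'_def[abs_def] V'_def[abs_def] W'_def[abs_def] by (rule W22_repr_lincomb[OF t X(1)])
  have U'e: "U' = (\<lambda>x. U x - of_real \<theta> * X x)" by (auto simp: U'_def)
  have A'e: "(\<lambda>x. sl U' V' W' x - of_real m * U' x) = (\<lambda>x. A x - of_real \<theta> * B x)"
    unfolding U'_def[abs_def] V'_def[abs_def] W'_def[abs_def] sl_lincomb A_def B_def by (auto simp: algebra_simps)
  have "of_real (form U' V' - m * (N2 U')\<^sup>2) = L2_inner (\<lambda>x. sl U' V' W' x - of_real m * U' x) U'"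
    using L2_inner_diff_left[OF sl_L2[OF t'] W22_reprD(3)[OF t'] W22_reprD(3)[OF t'], of "of_real m"] form_eq_ip[OF t']
    by (simp add: L2_inner_self)
  also have "\<dots> = L2_inner A U' - of_real \<theta> * L2_inner B U'"
    unfolding A'e by (rule L2_inner_diff_left[OF AL BL W22_reprD(3)[OF t']])
  also have "L2_inner A U' = L2_inner A U - of_real \<theta> * L2_inner A X"
    unfolding U'e using L2_inner_diff_right[OF T(3) TX(3) AL, of "of_real \<theta>"] by simp
  also have "L2_inner B U' = L2_inner B U - of_real \<theta> * L2_inner B X"
    unfolding U'e using L2_inner_diff_right[OF T(3) TX(3) BL, of "of_real \<theta>"] by simp
  finally have "Re (complex_of_real (form U' V' - m * (N2 U')\<^sup>2))
      = Re ((L2_inner A U - of_real \<theta> * L2_inner A X) - of_real \<theta> * (L2_inner B U - of_real \<theta> * L2_inner B X))"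
    by simp
  then have "form U' V' - m * (N2 U')\<^sup>2 = (form U V - m) - 2 * \<theta> * (1 - s) + \<theta> * \<theta> * (s - (N2 X)\<^sup>2)"
    unfolding AU AX BU BX by (simp add: s_def algebra_simps)
  moreover have "0 \<le> form U' V' - m * (N2 U')\<^sup>2" using fb t' unfolding form_bound_def by (metis diff_ge_0_iff_ge)
  moreover have "\<theta> * \<theta> * (s - (N2 X)\<^sup>2) \<le> \<theta> * \<theta> * 1"
    using s NX by (intro mult_left_mono) (auto intro: order_trans[of _ s])
  ultimately have "2 * \<theta> * (1 - s) \<le> 2 * \<theta> * \<theta>" using fU by (simp add: power2_eq_square)
  then have s1: "1 - s \<le> \<theta>" using \<theta>(1) by simp
  have "of_real ((N2 h)\<^sup>2) = L2_inner h h" by (simp add: L2_inner_self)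
  also have "\<dots> = L2_inner h U - L2_inner h X"
    using L2_inner_diff_right[OF T(3) TX(3) hL, of 1] by (simp add: h_def[abs_def])
  also have "\<dots> = (1 - L2_inner X U) - (cnj (L2_inner X U) - of_real ((N2 X)\<^sup>2))"
    using BU BX L2_inner_cong_left[OF Bh BL T(3)] L2_inner_cong_left[OF Bh BL TX(3)] by simp
  finally have "Re (of_real ((N2 h)\<^sup>2)) = Re ((1 - L2_inner X U) - (cnj (L2_inner X U) - of_real ((N2 X)\<^sup>2)))" by simp
  then have "(N2 h)\<^sup>2 = 1 - 2 * s + (N2 X)\<^sup>2" by (simp add: s_def)
  moreover have "(N2 X)\<^sup>2 \<le> 1" using NX by (simp add: power_le_one)
  ultimately have Nh: "(N2 h)\<^sup>2 \<le> 2 * \<theta>" using s1 by linarith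
  have "c * N2 X \<le> N2 B" using c(2)[OF X(1)] by (simp add: B_def[abs_def])
  also have "N2 B = N2 h" by (rule L2_cong(2)[OF Bh BL, symmetric])
  finally have "(c * N2 X)\<^sup>2 \<le> (N2 h)\<^sup>2" using c(1) by (intro power_mono) auto
  then have "c\<^sup>2 * (N2 X)\<^sup>2 \<le> c\<^sup>2 / 8" using Nh \<theta>(3) by (simp add: power_mult_distrib)
  moreover have "(1 / 2)\<^sup>2 \<le> (N2 X)\<^sup>2" using s s1 \<theta>(2) by (intro power_mono) auto
  then have "c\<^sup>2 * (1 / 4) \<le> c\<^sup>2 * (N2 X)\<^sup>2" by (intro mult_left_mono) (auto simp: power_divide)
  ultimately show False using c(1) by simp
qed

end

lemma (in periodic_coeffs) form_bound_lowest:
  assumes "\<And>m. periodic_eigenvalue P q m \<Longrightarrow> m0 \<le> m"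
  shows "form_bound m0"
proof (rule form_bottom)
  fix l assume "l < m0"
  from discr_gt_2[OF assms this] obtain c where
    "0 < c" "\<And>U V W. W22_repr U V W \<Longrightarrow> c * N2 U \<le> N2 (\<lambda>x. sl U V W x - of_real l * U x)"
    by (rule hyperbolic_lower) auto
  then show "\<exists>c>0. \<forall>U V W. W22_repr U V W \<longrightarrow> c * N2 U \<le> N2 (\<lambda>x. sl U V W x - of_real l * U x)"
    by blast
qed

section \<open>Piecewise continuous periodic coefficients\<close>

lemma locally_finite_imp_countable:
  fixes S :: "real set"
  assumes "\<And>a b. finite (S \<inter> {a..b})"
  shows "countable S"
proof -
  have "S = (\<Union>n::nat. S \<inter> {- real n..real n})"
  proof (intro set_eqI iffI)
    fix x assume "x \<in> S"
    moreover obtain n :: nat where "\<bar>x\<bar> \<le> real n" using real_arch_simple by blast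
    ultimately have "x \<in> S \<inter> {- real n..real n}" by auto
    then show "x \<in> (\<Union>n::nat. S \<inter> {- real n..real n})" by blast
  qed auto
  moreover have "countable (\<Union>n::nat. S \<inter> {- real n..real n})"
    by (rule countable_UN) (simp, rule countable_finite[OF assms])
  ultimately show ?thesis by simp
qed

lemma piecewise_continuous_measurable:
  assumes "piecewise_continuous f"
  shows "f \<in> borel_measurable lebesgue"
proof -
  obtain S where S: "\<And>a b. finite (S \<inter> {a..b})" "\<And>x. x \<notin> S \<Longrightarrow> isCont f x"
    using assms by (auto simp: piecewise_continuous_def)
  have "f \<in> borel_measurable borel"
    by (rule borel_measurable_continuous_countable_exceptions[OF locally_finite_imp_countable[OF S(1)]])
      (auto intro: continuous_at_imp_continuous_on S(2))
  then show ?thesis by (intro measurable_completion) simp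
qed

text \<open>Compactness by bisection: the one-sided limits bound f on either side of a point, and
  the value at the point itself is added to the bound.\<close>

lemma piecewise_continuous_bounded:
  assumes "piecewise_continuous f"
  obtains B where "\<And>x. x \<in> {0..1} \<Longrightarrow> \<bar>f x\<bar> \<le> B"
proof -
  define P where "P a b \<longleftrightarrow> (\<exists>B. \<forall>x\<in>{a..b}. \<bar>f x\<bar> \<le> B)" for a b
  have "P 0 1"
  proof (rule Bolzano)
    fix a b c :: real assume ab: "P a b" "P b c" "a \<le> b" "b \<le> c"
    then obtain B B' where "\<forall>x\<in>{a..b}. \<bar>f x\<bar> \<le> B" "\<forall>x\<in>{b..c}. \<bar>f x\<bar> \<le> B'" by (auto simp: P_def)
    then have "\<forall>x\<in>{a..c}. \<bar>f x\<bar> \<le> max B B'"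
      by (metis atLeastAtMost_iff le_max_iff_disj linear)
    then show "P a c" by (auto simp: P_def)
  next
    fix x :: real
    obtain l r where lr: "(f \<longlongrightarrow> l) (at_left x)" "(f \<longlongrightarrow> r) (at_right x)"
      using assms unfolding piecewise_continuous_def by blast
    have "\<forall>\<^sub>F y in at_left x. \<bar>f y\<bar> < \<bar>l\<bar> + 1" "\<forall>\<^sub>F y in at_right x. \<bar>f y\<bar> < \<bar>r\<bar> + 1"
      using order_tendstoD(2)[OF tendsto_rabs[OF lr(1)]] order_tendstoD(2)[OF tendsto_rabs[OF lr(2)]] by auto
    then obtain d d' where d: "d > 0" "\<And>y. y < x \<Longrightarrow> dist y x < d \<Longrightarrow> \<bar>f y\<bar> < \<bar>l\<bar> + 1"
      and d': "d' > 0" "\<And>y. x < y \<Longrightarrow> dist y x < d' \<Longrightarrow> \<bar>f y\<bar> < \<bar>r\<bar> + 1"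
      unfolding eventually_at by (metis greaterThan_iff lessThan_iff less_irrefl)
    show "\<exists>d>0. \<forall>a b. a \<le> x \<and> x \<le> b \<and> b - a < d \<longrightarrow> P a b"
    proof (intro exI[of _ "min d d'"] conjI allI impI)
      fix a b assume ab: "a \<le> x \<and> x \<le> b \<and> b - a < min d d'"
      have "\<bar>f y\<bar> \<le> max (\<bar>f x\<bar>) (max (\<bar>l\<bar> + 1) (\<bar>r\<bar> + 1))" if "y \<in> {a..b}" for y
      proof -
        have "dist y x < d" "dist y x < d'" using that ab by (auto simp: dist_real_def)
        then show ?thesis using d(2)[of y] d'(2)[of y] by (cases y x rule: linorder_cases) (auto simp: le_max_iff_disj)
      qed
      then show "P a b" unfolding P_def by blast
    qed (use d d' in auto)
  qed simp
  then show ?thesis using that unfolding P_def by blast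
qed

lemma piecewise_C1_periodic_coeffs:
  assumes per: "one_periodic p" "one_periodic q" and p: "piecewise_C1 p" and q: "piecewise_continuous q"
    and p0: "0 < p0" "\<forall>x. p0 \<le> p x"
  obtains P' p1 p2 q1 where "periodic_coeffs p P' q p0 p1 p2 q1"
proof -
  have pp: "p (x + 1) = p x" and qq: "q (x + 1) = q x" for x using per by (auto simp: one_periodic_def)
  have pc: "continuous_on UNIV p" using p by (simp add: piecewise_C1_def)
  obtain f' S where f': "piecewise_continuous f'" and S: "\<And>a b. finite (S \<inter> {a..b})"
    and der: "\<And>x. x \<notin> S \<Longrightarrow> (p has_real_derivative f' x) (at x)"
    using p by (auto simp: piecewise_C1_def)
  obtain p1 where p1: "1 \<le> p1" "\<And>x. \<bar>p x\<bar> \<le> p1" using periodic_continuous_bounded[OF pc pp] by blast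
  obtain q1 where q1: "\<And>x. x \<in> {0..1} \<Longrightarrow> \<bar>q x\<bar> \<le> q1" using piecewise_continuous_bounded[OF q] by blast
  have q1': "\<bar>q x\<bar> \<le> q1" for x
    using q1[OF frac_in_unit_interval[of x]] periodic_frac[of q, OF qq, of x] by simp
  \<comment> \<open>Determined by p alone and therefore periodic. The given \<open>f'\<close> is not
    tied to p on the exceptional set and may fail to be periodic there.\<close>
  define P' where "P' x = (if p differentiable (at x) then deriv p x else 0)" for x
  have P'f: "P' x = f' x" if "x \<notin> S" for x
    using der[OF that] by (auto simp: P'_def real_differentiable_def DERIV_imp_deriv)
  have P'per: "P' (x + 1) = P' x" for x
  proof -
    have "(p has_real_derivative D) (at (x + 1)) \<longleftrightarrow> (p has_real_derivative D) (at x)" for D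
      by (subst DERIV_shift) (simp add: pp)
    then show ?thesis by (simp add: P'_def real_differentiable_def deriv_def)
  qed
  obtain B where B: "\<And>x. x \<in> {0..1} \<Longrightarrow> \<bar>f' x\<bar> \<le> B" using piecewise_continuous_bounded[OF f'] by blast
  \<comment> \<open>Off S the values are those of \<open>f'\<close>. The finitely many exceptional
    points of one period are bounded by their sum, since p may be differentiable there with a
    derivative other than \<open>f'\<close>.\<close>
  define p2 where "p2 = max B (\<Sum>x\<in>S \<inter> {0..1}. \<bar>P' x\<bar>)"
  have p2: "\<bar>P' x\<bar> \<le> p2" if x: "x \<in> {0..1}" for x
  proof (cases "x \<in> S")
    case True
    then have "\<bar>P' x\<bar> \<le> (\<Sum>x\<in>S \<inter> {0..1}. \<bar>P' x\<bar>)" using x S by (intro member_le_sum) auto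
    then show ?thesis by (simp add: p2_def)
  next
    case False
    then show ?thesis using B[OF x] P'f by (simp add: p2_def)
  qed
  have p2': "\<bar>P' x\<bar> \<le> p2" for x
    using p2[OF frac_in_unit_interval[of x]] periodic_frac[of P', OF P'per, of x] by simp
  have P'm: "P' \<in> borel_measurable lebesgue"
  proof (rule measurable_discrete_difference[OF piecewise_continuous_measurable[OF f']])
    show "countable S" by (rule locally_finite_imp_countable[OF S])
  qed (use P'f in auto)
  have pm: "p \<in> borel_measurable lebesgue" by (rule continuous_imp_lebesgue_measurable[OF pc])
  have ppos: "0 < p x" for x using p0 by (metis less_le_trans)
  have int: "(\<lambda>x. complex_of_real (g x)) absolutely_integrable_on {a..b}"
    if "g \<in> borel_measurable lebesgue" "\<And>x. \<bar>g x\<bar> \<le> c" for g :: "real \<Rightarrow> real" and c a b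
    using locally_integrable_exp_bound[of "\<lambda>x. complex_of_real (g x)" c 0] that
    unfolding locally_integrable_UNIV_iff by simp
  have derS: "(p has_real_derivative P' x) (at x)" if "x \<notin> S" for x using der[OF that] P'f[OF that] by simp
  have "periodic_coeffs p P' q p0 p1 p2 q1"
  proof
    show "p x \<le> p1" for x using p1(2)[of x] by simp
    show "abs_cont (\<lambda>x. complex_of_real (p x)) (\<lambda>x. complex_of_real (P' x))"
    proof (rule abs_cont_strong[OF S])
      show "((\<lambda>x. complex_of_real (p x)) has_vector_derivative complex_of_real (P' x)) (at x)" if "x \<notin> S" for x
        using derS[OF that] by (intro has_vector_derivative_of_real) (simp add: has_real_derivative_iff_has_vector_derivative)
    qed (auto intro!: continuous_intros pc int[OF P'm p2'])
    show "abs_cont (\<lambda>x. complex_of_real (1 / p x)) (\<lambda>x. complex_of_real (- P' x / (p x)\<^sup>2))"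
    proof (rule abs_cont_strong[OF S])
      have "p x \<noteq> 0" for x using ppos[of x] by simp
      then show "continuous_on UNIV (\<lambda>x. complex_of_real (1 / p x))"
        by (intro continuous_intros pc) auto
      show "((\<lambda>x. complex_of_real (1 / p x)) has_vector_derivative complex_of_real (- P' x / (p x)\<^sup>2)) (at x)"
        if "x \<notin> S" for x
      proof -
        have "((\<lambda>x. 1 / p x) has_real_derivative - P' x / (p x)\<^sup>2) (at x)"
          using derS[OF that] ppos[of x] by (auto intro!: derivative_eq_intros simp: power2_eq_square)
        then show ?thesis
          by (intro has_vector_derivative_of_real) (simp add: has_real_derivative_iff_has_vector_derivative)
      qed
      fix a b
      show "(\<lambda>x. complex_of_real (- P' x / (p x)\<^sup>2)) absolutely_integrable_on {a..b}"
      proof (rule int)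
        show "(\<lambda>x. - P' x / (p x)\<^sup>2) \<in> borel_measurable lebesgue" using P'm pm by measurable
        show "\<bar>- P' x / (p x)\<^sup>2\<bar> \<le> p2 / p0\<^sup>2" for x
          unfolding abs_divide abs_minus_cancel
          using p2'[of x] p0 by (intro frac_le) (auto intro: power_mono order_trans[of _ "\<bar>P' x\<bar>"])
      qed
    qed
  qed (use p0 p2' q1' P'm pp qq piecewise_continuous_measurable[OF q] in auto)
  then show ?thesis by (rule that)
qed

section \<open>The perturbation\<close>

lemma lin_op_zero_extended:
  assumes T: "linear_W22_L2 Q T" and Q: "open Q"
  shows "lin_op (zero_extended Q T)" "N2 (zero_extended Q T u) = L2_norm Q (T u)"
proof -
  have Qs: "Q \<in> sets lebesgue" using Q by simp
  have sq: "(cmod (zero_extended Q T u x))\<^sup>2 = indicator Q x *\<^sub>R (cmod (T u x))\<^sup>2" for u x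
    by (simp add: zero_extended_def indicator_def)
  have L: "zero_extended Q T u \<in> L2" if "T u \<in> L2_space Q" for u
  proof -
    have "zero_extended Q T u \<in> borel_measurable lebesgue"
      unfolding zero_extended_def using that Qs by (simp add: borel_measurable_if L2_space_def)
    then show ?thesis
      using that Qs unfolding L2_iff sq by (simp add: L2_space_def integrable_restrict_space)
  qed
  have W: "u \<in> W22 Q" if "u \<in> W22R" for u by (rule W22_restrict(1)[OF that Q])
  show "lin_op (zero_extended Q T)"
    unfolding linear_W22_L2_def
  proof (intro conjI ballI impI allI)
    fix u assume u: "u \<in> W22R"
    show "zero_extended Q T u \<in> L2" using T W[OF u] L by (auto simp: linear_W22_L2_def)
    show "ae_eq UNIV (zero_extended Q T (\<lambda>x. c * u x)) (\<lambda>x. c * zero_extended Q T u x)" for c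
    proof -
      have "ae_eq Q (T (\<lambda>x. c * u x)) (\<lambda>x. c * T u x)" using T W[OF u] by (auto simp: linear_W22_L2_def)
      then show ?thesis unfolding ae_eq_UNIV_iff ae_eq_iff[OF Qs]
        by eventually_elim (simp add: zero_extended_def)
    qed
    fix v assume v: "v \<in> W22R"
    have "ae_eq Q (T (\<lambda>x. u x + v x)) (\<lambda>x. T u x + T v x)"
      using T W[OF u] W[OF v] by (auto simp: linear_W22_L2_def)
    then show "ae_eq UNIV (zero_extended Q T (\<lambda>x. u x + v x)) (\<lambda>x. zero_extended Q T u x + zero_extended Q T v x)"
      unfolding ae_eq_UNIV_iff ae_eq_iff[OF Qs] by eventually_elim (simp add: zero_extended_def)
    assume "ae_eq UNIV u v"
    then have "ae_eq Q u v" using Qs by (rule ae_eq_subset)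
    then have "ae_eq Q (T u) (T v)" using T W[OF u] W[OF v] by (auto simp: linear_W22_L2_def)
    then show "ae_eq UNIV (zero_extended Q T u) (zero_extended Q T v)"
      unfolding ae_eq_UNIV_iff ae_eq_iff[OF Qs] by eventually_elim (simp add: zero_extended_def)
  qed
  show "N2 (zero_extended Q T u) = L2_norm Q (T u)"
    unfolding L2_norm_def lebesgue_on_UNIV_eq sq integral_lebesgue_on_indicator[OF Qs] ..
qed

text \<open>Half of the lower bound survives the perturbation and gives injectivity and a bounded
  inverse; surjectivity comes from the Neumann series.\<close>

lemma perturbed_resolvent_set:
  assumes A: "lin_op A" and B: "lin_op B" and eq: "\<And>u x. T u x - z * u x = A u x + B u x"
    and c: "0 < c" and low: "\<And>u. u \<in> W22R \<Longrightarrow> c * Wnorm u \<le> N2 (A u)"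
    and small: "\<And>u. u \<in> W22R \<Longrightarrow> N2 (B u) \<le> c / 2 * Wnorm u" and onto: "onto_op A"
  shows "z \<in> resolvent_set W22R T"
proof -
  have low2: "c / 2 * Wnorm u \<le> N2 (\<lambda>x. A u x + B u x)" if "u \<in> W22R" for u
    using N2_triangle_rev[OF lin_opD(1)[OF A that] lin_opD(1)[OF B that]] low[OF that] small[OF that] by simp
  show ?thesis
    unfolding resolvent_set_def mem_Collect_eq eq
  proof (intro conjI ballI impI)
    fix u v assume u: "u \<in> W22R" and v: "v \<in> W22R"
      and ae: "ae_eq UNIV (\<lambda>x. A u x + B u x) (\<lambda>x. A v x + B v x)"
    define d where "d x = u x - v x" for x
    have d: "d \<in> W22R" unfolding d_def[abs_def] by (rule W22_diff[OF u v])
    have "ae_eq UNIV (\<lambda>x. 0) (\<lambda>x. A d x + B d x)"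
      using ae lin_op_diff[OF A u v] lin_op_diff[OF B u v] unfolding ae_eq_UNIV_iff
    proof eventually_elim
      case (elim x)
      have "A d x + B d x = (A u x + B u x) - (A v x + B v x)"
        unfolding d_def[abs_def] elim(2,3) by simp
      then show ?case unfolding elim(1) by simp
    qed
    from L2_cong(2)[OF this L2_zero] have "c / 2 * Wnorm d \<le> 0" using low2[OF d] by simp
    then have "Wnorm d \<le> 0" using c by (simp add: mult_le_0_iff)
    then have "N2 d = 0" using N2_le_Wnorm[of d] L2_norm_nonneg[of UNIV d] by linarith
    from N2_eq_0_imp[OF W22_L2[OF d] this] show "ae_eq UNIV u v"
      unfolding ae_eq_UNIV_iff by eventually_elim (simp add: d_def)
  next
    fix f assume "f \<in> L2"
    then show "\<exists>u\<in>W22R. ae_eq UNIV (\<lambda>x. A u x + B u x) f"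
      using onto_op_perturb[OF A B low small onto] by (auto simp: onto_op_def)
  next
    show "\<exists>C. \<forall>u\<in>W22R. N2 u \<le> C * N2 (\<lambda>x. A u x + B u x)"
    proof (intro exI[of _ "2 / c"] ballI)
      fix u assume u: "u \<in> W22R"
      have "Wnorm u \<le> 2 / c * N2 (\<lambda>x. A u x + B u x)" using low2[OF u] c by (simp add: field_simps)
      then show "N2 u \<le> 2 / c * N2 (\<lambda>x. A u x + B u x)" using N2_le_Wnorm[of u] by linarith
    qed
  qed
qed

lemma sin_ge_half:
  assumes "0 \<le> x" "x \<le> (1::real)"
  shows "x / 2 \<le> sin x"
proof -
  have "sin 0 - 0 / 2 \<le> sin x - x / 2"
  proof (rule DERIV_nonneg_imp_nondecreasing[OF assms(1)])
    fix t :: real assume t: "0 \<le> t" "t \<le> x"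
    \<comment> \<open>On the unit interval the cosine is at least cos (pi / 3) = 1/2, because pi
      exceeds 3.\<close>
    have "cos (pi / 3) \<le> cos t"
      using t assms pi_gt3 by (intro cos_monotone_0_pi_le) auto
    then show "\<exists>y. ((\<lambda>x. sin x - x / 2) has_real_derivative y) (at t) \<and> 0 \<le> y"
      by (intro exI[of _ "cos t - 1 / 2"]) (auto intro!: derivative_eq_intros simp: cos_60)
  qed
  then show ?thesis by simp
qed

context bounded_coeffs
begin

text \<open>Two regimes: the first bound serves points near the vertex, where the edge of the sector
  comes within order d^2 of the half-line; the second grows with the distance from the vertex and
  will absorb |z|.\<close>

lemma gap_outside_sector:
  assumes d: "0 < d" "d \<le> 1" and z: "z \<notin> sector d (of_real (m - d))"
  shows "d\<^sup>2 / 4 \<le> gap m z" "cmod (z - of_real (m - d)) * d / 2 \<le> gap m z"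
proof -
  define w where "w = z - of_real (m - d)"
  have im: "Im z = Im w" and re: "m - Re z = d - Re w" by (simp_all add: w_def)
  have g: "\<bar>Im w\<bar> \<le> gap m z" "d - Re w \<le> gap m z" unfolding gap_def im re by auto
  have d2: "d\<^sup>2 \<le> d" using d by (simp add: power2_eq_square mult_left_le)
  have "d\<^sup>2 / 4 \<le> gap m z \<and> cmod w * d / 2 \<le> gap m z"
  \<comment> \<open>This case contains the vertex itself, which \<open>sector\<close> excludes and
    which must therefore be treated as an outside point.\<close>
  proof (cases "Re w \<le> 0")
    case True
    have gd: "d \<le> gap m z" using g True by linarith
    have "cmod w \<le> \<bar>Re w\<bar> + \<bar>Im w\<bar>" by (rule cmod_le)
    also have "\<dots> \<le> 2 * gap m z" using g True d by linarith
    finally have "cmod w * d \<le> (2 * gap m z) * 1" using d gd by (intro mult_mono) auto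
    then show ?thesis using gd d2 d by simp
  next
    case False
    then have w0: "w \<noteq> 0" by auto
    have arg: "d \<le> \<bar>Arg w\<bar>" using z w0 by (auto simp: sector_def w_def)
    have arg2: "\<bar>Arg w\<bar> < pi / 2" using False Arg_Re_pos[of w] by simp
    have "Im w = cmod w * sin (Arg w)"
      using arg_cong[OF rcis_cmod_Arg[of w], of Im] by simp
    moreover have "\<bar>sin (Arg w)\<bar> = sin \<bar>Arg w\<bar>"
      using arg2 sin_ge_zero[of "\<bar>Arg w\<bar>"] by (auto simp: abs_if split: if_splits)
    ultimately have imw: "\<bar>Im w\<bar> = cmod w * sin \<bar>Arg w\<bar>" by (simp add: abs_mult)
    have "d / 2 \<le> sin d" using d by (intro sin_ge_half) auto
    also have "\<dots> \<le> sin \<bar>Arg w\<bar>" using d arg arg2 by (intro sin_monotone_2pi_le) auto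
    finally have "cmod w * (d / 2) \<le> \<bar>Im w\<bar>" unfolding imw by (rule mult_left_mono) simp
    then have 2: "cmod w * d / 2 \<le> gap m z" using g by simp
    show ?thesis
    \<comment> \<open>Close to the vertex the shift by d to the left of m provides the bound,
      farther away the angle does.\<close>
    proof (cases "cmod w \<le> d / 2")
      case True
      then have "d / 2 \<le> gap m z" using g complex_Re_le_cmod[of w] by linarith
      then show ?thesis using 2 d2 d by simp
    next
      case False
      then have "(d / 2) * d \<le> cmod w * d" using d by (intro mult_right_mono) auto
      then show ?thesis using 2 by (simp add: power2_eq_square)
    qed
  qed
  then show "d\<^sup>2 / 4 \<le> gap m z" "cmod (z - of_real (m - d)) * d / 2 \<le> gap m z" by (auto simp: w_def)
qed

lemma outside_sector_resolvent:
  assumes fb: "form_bound m" and d: "0 < d" "d \<le> 1" and z: "z \<notin> sector d (of_real (m - d))"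
    and T: "linear_W22_L2 Q T" "open Q" and bT: "bounded_by_W22_L2 Q c T" and e: "0 < e"
    and small: "e * \<bar>c\<bar> * (CW * (11 + 4 * \<bar>m\<bar>)) \<le> d\<^sup>2 / 2"
  shows "z \<in> resolvent_set W22R (perturbed_op P q Q e T)"
proof -
  define g where "g = gap m z"
  define M where "M = 1 + (cmod z + 1) / g"
  have g: "d\<^sup>2 / 4 \<le> g" "cmod (z - of_real (m - d)) * d / 2 \<le> g"
    using gap_outside_sector[OF d z] by (simp_all add: g_def)
  have g0: "0 < g" using g(1) d by (smt (verit) zero_less_power divide_pos_pos)
  have "cmod z \<le> cmod (z - of_real (m - d)) + cmod (of_real (m - d))"
    using norm_triangle_ineq[of "z - of_real (m - d)" "of_real (m - d)"] by simp
  also have "\<dots> \<le> cmod (z - of_real (m - d)) + (\<bar>m\<bar> + 1)"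
    using d unfolding norm_of_real by (intro add_left_mono) linarith
  finally have cz: "cmod z + 1 \<le> cmod (z - of_real (m - d)) + (\<bar>m\<bar> + 2)" by simp
  \<comment> \<open>The 11 is 1 from g itself, 2 from the distance to the vertex and 8 from 4 (|m| +
    2); the 2 in that bracket consists of the shift d \<le> 1 and the 1 in |z| + 1.\<close>
  have M1: "M \<le> (11 + 4 * \<bar>m\<bar>) / d\<^sup>2"
  proof -
    have d2: "d\<^sup>2 \<le> d" "d\<^sup>2 \<le> 1" using d by (simp_all add: power2_eq_square mult_left_le mult_le_one)
    have "cmod (z - of_real (m - d)) * d\<^sup>2 \<le> cmod (z - of_real (m - d)) * d"
      using d2 by (intro mult_left_mono) auto
    also have "\<dots> \<le> 2 * g" using g(2) by simp
    finally have 1: "cmod (z - of_real (m - d)) * d\<^sup>2 \<le> 2 * g" .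
    have 2: "(\<bar>m\<bar> + 2) * d\<^sup>2 \<le> (\<bar>m\<bar> + 2) * (4 * g)" using g(1) by (intro mult_left_mono) auto
    have 3: "g * d\<^sup>2 \<le> g * 1" using d2 g0 by (intro mult_left_mono) auto
    have "(g + (cmod z + 1)) * d\<^sup>2 \<le> (g + (cmod (z - of_real (m - d)) + (\<bar>m\<bar> + 2))) * d\<^sup>2"
      using cz by (intro mult_right_mono) auto
    also have "\<dots> \<le> (11 + 4 * \<bar>m\<bar>) * g"
      using 1 2 3 by (simp add: distrib_right distrib_left algebra_simps)
    finally have "(g + (cmod z + 1)) * d\<^sup>2 \<le> (11 + 4 * \<bar>m\<bar>) * g" .
    moreover have "M = (g + (cmod z + 1)) / g" using g0 by (simp add: M_def add_divide_distrib)
    ultimately have "M * d\<^sup>2 \<le> ((11 + 4 * \<bar>m\<bar>) * g) / g"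
      using divide_right_mono[of "(g + (cmod z + 1)) * d\<^sup>2" "(11 + 4 * \<bar>m\<bar>) * g" g] g0 by simp
    then show ?thesis using g0 d by (simp add: le_divide_eq)
  qed
  have M0: "0 < M" using g0 unfolding M_def by (intro add_pos_nonneg divide_nonneg_nonneg) auto
  define A where "A u x = sl_op UNIV P q u x + (- z) * u x" for u x
  define B where "B u x = 0 * zero_extended Q T u x + (- of_real e) * zero_extended Q T u x" for u x
  note ze = lin_op_zero_extended[OF T]
  show ?thesis
  proof (rule perturbed_resolvent_set)
    show "lin_op A" unfolding A_def[abs_def] by (rule lin_op_lincomb[OF lin_op_sl lin_op_id])
    have "lin_op (\<lambda>u x. zero_extended Q T u x + (- 1 - of_real e) * zero_extended Q T u x)"
      by (rule lin_op_lincomb[OF ze(1) ze(1)])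
    then show "lin_op B" unfolding B_def[abs_def] by (simp add: algebra_simps)
    show "perturbed_op P q Q e T u x - z * u x = A u x + B u x" for u x
      by (simp add: perturbed_op_def A_def B_def)
    show "0 < 1 / (CW * M)" using CW_pos M0 by simp
    show "1 / (CW * M) * Wnorm u \<le> N2 (A u)" if u: "u \<in> W22R" for u
    proof -
      have "Wnorm u \<le> (CW * M) * N2 (A u)"
        using resolvent_lower(2)[OF fb u g0, of z] by (simp add: A_def[abs_def] M_def g_def)
      then show ?thesis
        using mult_pos_pos[OF CW_pos M0] by (simp add: pos_divide_le_eq mult.commute)
    qed
    show "N2 (B u) \<le> 1 / (CW * M) / 2 * Wnorm u" if u: "u \<in> W22R" for u
    proof -
      have "N2 (B u) = N2 (\<lambda>x. (- of_real e) * zero_extended Q T u x)" by (simp add: B_def[abs_def])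
      also have "\<dots> = e * L2_norm Q (T u)" unfolding N2_scale ze(2) using e by simp
      also have "\<dots> \<le> e * (\<bar>c\<bar> * Wnorm u)"
      proof (intro mult_left_mono)
        have "L2_norm Q (T u) \<le> c * W22_norm Q u"
          using bT W22_restrict(1)[OF u T(2)] by (auto simp: bounded_by_W22_L2_def)
        also have "\<dots> \<le> \<bar>c\<bar> * W22_norm Q u" by (intro mult_right_mono) (auto simp: W22_norm_def)
        also have "\<dots> \<le> \<bar>c\<bar> * Wnorm u" by (intro mult_left_mono W22_restrict(2)[OF u T(2)]) auto
        finally show "L2_norm Q (T u) \<le> \<bar>c\<bar> * Wnorm u" .
      qed (use e in simp)
      also have "\<dots> = (e * \<bar>c\<bar>) * Wnorm u" by simp
      also have "\<dots> \<le> 1 / (CW * M) / 2 * Wnorm u"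
      proof (rule mult_right_mono)
        have "(e * \<bar>c\<bar>) * (CW * M) \<le> (e * \<bar>c\<bar>) * (CW * ((11 + 4 * \<bar>m\<bar>) / d\<^sup>2))"
          using M1 CW_pos e by (intro mult_left_mono) auto
        also have "\<dots> = (e * \<bar>c\<bar> * (CW * (11 + 4 * \<bar>m\<bar>))) / d\<^sup>2" by simp
        also have "\<dots> \<le> (d\<^sup>2 / 2) / d\<^sup>2" by (intro divide_right_mono small) simp
        also have "\<dots> = 1 / 2" using d by simp
        finally show "e * \<bar>c\<bar> \<le> 1 / (CW * M) / 2"
          using CW_pos M0 by (simp add: field_simps)
      qed simp
      finally show ?thesis .
    qed
    \<comment> \<open>The path in \<open>resolvent_onto\<close> starts at -(q1 + 1), hence the
      requirement that the form bound be at least -q1. The larger of two form bounds is a form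
      bound, and enlarging m keeps the gap positive.\<close>
    have "form_bound (max m (- q1))" using fb form_bound_q1 by (simp add: max_def)
    moreover have "0 < gap (max m (- q1)) z" using g0 by (auto simp: g_def gap_def)
    ultimately have "onto_op (\<lambda>u x. sl_op UNIV P q u x - z * u x)"
      by (intro resolvent_onto) auto
    then show "onto_op A" by (simp add: A_def[abs_def])
  qed
qed

end

theorem theorem2p1:
  fixes p q :: "real \<Rightarrow> real"
    and p0 \<mu>0 \<alpha> \<beta> \<epsilon>0 C :: real
    and Q :: "real set"
    and L :: "real \<Rightarrow> (real \<Rightarrow> complex) \<Rightarrow> (real \<Rightarrow> complex)"
  assumes "one_periodic p" and "one_periodic q"
    and "piecewise_C1 p" and "piecewise_continuous q"
    and "0 < p0" and "\<forall>x. p0 \<le> p x" and "p 0 = 1"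
    and "\<alpha> < \<beta>" and "Q = {\<alpha><..<\<beta>}"
    and "0 < \<epsilon>0"
    and "\<forall>\<epsilon>. 0 < \<epsilon> \<and> \<epsilon> < \<epsilon>0 \<longrightarrow> linear_W22_L2 Q (L \<epsilon>) \<and> bounded_by_W22_L2 Q C (L \<epsilon>)"
    and "lowest_periodic_eigenvalue p q \<mu>0"
  shows "\<exists>\<delta>1 \<delta>2 :: real \<Rightarrow> real.
           (\<forall>\<epsilon>>0. 0 < \<delta>1 \<epsilon> \<and> 0 < \<delta>2 \<epsilon>) \<and>
           (\<delta>1 \<longlongrightarrow> 0) (at_right 0) \<and> (\<delta>2 \<longlongrightarrow> 0) (at_right 0) \<and>
           (\<forall>\<^sub>F \<epsilon> in at_right 0.
              op_spectrum (W22 UNIV) (perturbed_op p q Q \<epsilon> (L \<epsilon>))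
                \<subseteq> sector (\<delta>2 \<epsilon>) (of_real (\<mu>0 - \<delta>1 \<epsilon>)))"
proof -
  obtain P' p1 p2 q1 where "periodic_coeffs p P' q p0 p1 p2 q1"
    using piecewise_C1_periodic_coeffs[OF assms(1-6)] by blast
  then interpret periodic_coeffs p P' q p0 p1 p2 q1 .
  have fb: "form_bound \<mu>0"
    using assms(12) by (intro form_bound_lowest) (auto simp: lowest_periodic_eigenvalue_def)
  \<comment> \<open>A constant times \<epsilon> must stay below \<delta>^2 / 2, so any exponent
    strictly between 0 and 1/2 would do. The same function serves as the opening and as the
    shift.\<close>
  define \<delta> where "\<delta> \<epsilon> = sqrt (sqrt \<epsilon>)" for \<epsilon> :: real
  define M where "M = \<bar>C\<bar> * (CW * (11 + 4 * \<bar>\<mu>0\<bar>))"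
  have Q: "open Q" using assms(9) by simp
  have "(\<delta> \<longlongrightarrow> sqrt (sqrt 0)) (at_right 0)"
    unfolding \<delta>_def[abs_def] by (intro tendsto_real_sqrt tendsto_ident_at)
  then have lim: "(\<delta> \<longlongrightarrow> 0) (at_right 0)" by simp
  have "((\<lambda>\<epsilon>. sqrt \<epsilon> * M) \<longlongrightarrow> sqrt 0 * M) (at_right 0)"
    by (intro tendsto_intros)
  then have ev: "\<forall>\<^sub>F \<epsilon> in at_right 0. sqrt \<epsilon> * M < 1 / 2"
    by (rule order_tendstoD(2)) simp
  have ev2: "\<forall>\<^sub>F \<epsilon> in at_right 0. \<epsilon> \<in> {0<..<min 1 \<epsilon>0}"
    using assms(10) by (intro eventually_at_right_real) simp
  have "\<forall>\<^sub>F \<epsilon> in at_right 0. op_spectrum W22R (perturbed_op p q Q \<epsilon> (L \<epsilon>))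
      \<subseteq> sector (\<delta> \<epsilon>) (of_real (\<mu>0 - \<delta> \<epsilon>))"
    using ev ev2
  proof eventually_elim
    case (elim \<epsilon>)
    then have \<epsilon>: "0 < \<epsilon>" "\<epsilon> < 1" "\<epsilon> < \<epsilon>0" by auto
    then have L: "linear_W22_L2 Q (L \<epsilon>)" "bounded_by_W22_L2 Q C (L \<epsilon>)" using assms(11) by auto
    have \<delta>: "0 < \<delta> \<epsilon>" "\<delta> \<epsilon> \<le> 1" "(\<delta> \<epsilon>)\<^sup>2 = sqrt \<epsilon>" using \<epsilon> by (simp_all add: \<delta>_def)
    have "\<epsilon> * M = sqrt \<epsilon> * (sqrt \<epsilon> * M)" using \<epsilon> by (simp add: mult.assoc[symmetric])
    also have "\<dots> \<le> sqrt \<epsilon> * (1 / 2)" using elim(1) \<epsilon> by (intro mult_left_mono) auto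
    finally have small: "\<epsilon> * \<bar>C\<bar> * (CW * (11 + 4 * \<bar>\<mu>0\<bar>)) \<le> (\<delta> \<epsilon>)\<^sup>2 / 2"
      by (simp add: M_def \<delta>(3) mult.assoc)
    show ?case
    proof
      fix z assume "z \<in> op_spectrum W22R (perturbed_op p q Q \<epsilon> (L \<epsilon>))"
      then show "z \<in> sector (\<delta> \<epsilon>) (of_real (\<mu>0 - \<delta> \<epsilon>))"
        using outside_sector_resolvent[OF fb \<delta>(1,2) _ L(1) Q L(2) \<epsilon>(1) small]
        by (auto simp: op_spectrum_def)
    qed
  qed
  moreover have "\<forall>\<epsilon>>0. 0 < \<delta> \<epsilon>" by (simp add: \<delta>_def)
  ultimately show ?thesis using lim by (intro exI[of _ \<delta>]) simp
qed

end
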